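(* Let $0<\delta<0.5$ be a constant, let $\theta=-\log\delta$ and let $t=\min\left\{\frac{\delta n}{260},\frac{n}{1000+200\theta}\right\}$. Let $H=(V,E)$ be an arbitrary graph on vertex set $V=[n]$ with minimum degree at least $\delta n$. If $m\geq \min\left\{(435+75\theta)tn,\ \left|\binom{[n]}{2}\setminus E\right|\right\}$ and $r\geq (120+20\theta)n$, then with high probability (i.e. with probability tending to $1$ as $n\to\infty$) the random edge-colored graph $G^r_{H,m}$ contains $t$ edge-disjoint rainbow Hamilton cycles.
   Context: Given a graph $H=(V,E)$ on $V=[n]$, let $R$ be a set of $m$ edges chosen uniformly at random from $\binom{[n]}{2}\setminus E$, and let $G_{H,m}=(V,E\cup R)$. The graph $G^r_{H,m}$ is obtained by coloring every edge of $G_{H,m}$ independently and uniformly at random with a color from $[r]$. A Hamilton cycle (or path) is rainbow if no color appears twice on its edges. *)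

theory Defs
  imports "HOL-Probability.Probability" "HOL-Library.Ramsey"
begin

(* A graph on the vertex set {1..n} is given by its edge set, a subset of
   [{1..n}]^2, the set of all 2-element subsets of {1..n}. *)

definition degree :: "nat set set \<Rightarrow> nat \<Rightarrow> nat" where
  "degree E v = card {e \<in> E. v \<in> e}"

(* Meaningful for n > 0 only. *)
definition min_degree :: "nat \<Rightarrow> nat set set \<Rightarrow> nat" where
  "min_degree n E = Min (degree E ` {1..n})"

definition non_edges :: "nat \<Rightarrow> nat set set \<Rightarrow> nat set set" where
  "non_edges n E = [{1..n}]\<^bsup>2\<^esup> - E"

(* The uniform choice is from a nonempty set exactly when m is at most the
   number of non-edges. *)
definition perturbed_graph :: "nat \<Rightarrow> nat set set \<Rightarrow> nat \<Rightarrow> nat set set pmf" where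
  "perturbed_graph n E m =
     map_pmf (\<lambda>R. E \<union> R) (pmf_of_set ([non_edges n E]\<^bsup>m\<^esup>))"

(* Independent uniform colors on the edges; 0 is only the default value of the
   coloring outside the edge set. *)
definition random_coloring :: "nat \<Rightarrow> nat set set \<Rightarrow> (nat set \<Rightarrow> nat) pmf" where
  "random_coloring r F = Pi_pmf F 0 (\<lambda>_. pmf_of_set {1..r})"

definition colored_perturbed_graph ::
    "nat \<Rightarrow> nat set set \<Rightarrow> nat \<Rightarrow> nat \<Rightarrow> (nat set set \<times> (nat set \<Rightarrow> nat)) pmf" where
  "colored_perturbed_graph n E m r =
     bind_pmf (perturbed_graph n E m)
       (\<lambda>F. map_pmf (\<lambda>c. (F, c)) (random_coloring r F))"

definition cycle_edges :: "nat list \<Rightarrow> nat set set" where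
  "cycle_edges vs = (\<lambda>i. {vs ! i, vs ! (Suc i mod length vs)}) ` {..<length vs}"

(* Cycles are identified with their edge sets, so the choice of starting vertex
   and orientation does not matter. *)
definition hamilton_cycle :: "nat \<Rightarrow> nat set set \<Rightarrow> nat set set \<Rightarrow> bool" where
  "hamilton_cycle n F C \<longleftrightarrow> n \<ge> 3 \<and> C \<subseteq> F \<and>
     (\<exists>vs. distinct vs \<and> set vs = {1..n} \<and> C = cycle_edges vs)"

definition rainbow :: "(nat set \<Rightarrow> nat) \<Rightarrow> nat set set \<Rightarrow> bool" where
  "rainbow c C \<longleftrightarrow> inj_on c C"

(* The number of cycles x may be a non-integral real, in which case at least
   x (that is, the ceiling of x many) cycles are required. *)
definition has_disjoint_rainbow_hamilton_cycles ::
    "nat \<Rightarrow> real \<Rightarrow> nat set set \<times> (nat set \<Rightarrow> nat) \<Rightarrow> bool" where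
  "has_disjoint_rainbow_hamilton_cycles n x = (\<lambda>(F, c).
     \<exists>\<C>. finite \<C> \<and> real (card \<C>) \<ge> x \<and> pairwise disjnt \<C> \<and>
         (\<forall>C\<in>\<C>. hamilton_cycle n F C \<and> rainbow c C))"

end

(*
  Since t is linear in n, the number of random edges is quadratic: with p = (870 + 150 \<theta>) t / n, the
  perturbed graph dominates a binomial random graph with constant edge probability p (a uniform m-set costs a factor polynomial in n against independent edges, and
  all failure probabilities below are exponentially small).

  Give every pair of vertices a random label naming one of T classes and an orientation. In each
  class keep the first edge of every colour. The result is rainbow, and as the class has at most half
  as many edges as there are colours, each edge is kept with conditional probability at least 1/2.
  A first moment bound shows that the kept arcs hit every A x B with |A| + |B| > (1 + \<epsilon>) n, where
  \<epsilon> = exp (-11) \<delta>^2, so Hall's theorem gives a partial injection defined outside \<epsilon> n vertices.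
  Sparse random digraphs have few short cycles, so its chains can be concatenated to a cyclic
  ordering of the vertices in which all but O(\<epsilon> n) consecutive pairs are kept edges.

  The remaining breaks are removed one by one with edges whose colours come from three small
  reserved palettes A, B, C: if the last and the first vertex form a break, choose an edge from the
  first vertex (colour in A), one from the last vertex (colour in B), and an edge (colour in C)
  closing the two resulting path ends to a cycle. Each cycle uses only O(\<epsilon> n) reserved edges,
  so the reserve survives all t cycles, which are constructed greedily from different classes.
*)

theory Submission
  imports Defs "HOL-Real_Asymp.Real_Asymp"
begin

section \<open>Matchings, chains and cyclic orderings\<close>

text \<open>The comparison with independent edges costs a factor of order \<open>n ^ 2\<close>, so
  every event about colours must fail with probability \<open>o(1 / n ^ 2)\<close>. The number of
  short directed cycles of a class has bounded expectation, which gives no tail bound of this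
  strength. Therefore the labels are a source of randomness separate from edges and colours:
  averaging fixes one labelling in which fewer than half of the classes have many short cycles and
  the conditional failure probability of the colours is still small. From then on only edges and
  colours are random.

  Two inequalities shape the constants. The bound \<open>120 + 20 * \<theta>\<close> makes
  \<open>n\<close> times the probability of keeping a given arc in a given class exceed
  \<open>24 + 4 * \<theta> = 2 * (1 + ln (1 / \<epsilon>))\<close>, the entropy of a pair of sets
  described by \<open>\<epsilon> * n\<close> vertices each. In the other direction
  \<open>\<epsilon>\<close> must be small against \<open>p ^ 2\<close>, hence the factor
  \<open>\<delta> ^ 2\<close>: the repairs block of order \<open>\<epsilon> * p * n ^ 2\<close>
  closing edges, whereas two sets of order \<open>p * n\<close> span only of order
  \<open>p ^ 3 * n ^ 2\<close> edges.\<close>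

lemma hall_matching:
  fixes N :: "'a \<Rightarrow> 'b set"
  assumes "finite A" "\<And>x. x \<in> A \<Longrightarrow> finite (N x)"
    and "\<And>S. S \<subseteq> A \<Longrightarrow> card S \<le> card (\<Union>(N ` S))"
  shows "\<exists>f. inj_on f A \<and> (\<forall>x\<in>A. f x \<in> N x)"
  using assms
proof (induction "card A" arbitrary: A N rule: less_induct)
  case less
  note fin = less.prems(1) and finN = less.prems(2) and H = less.prems(3)
  have finU: "finite (\<Union>(N ` S))" if "S \<subseteq> A" for S
    using that fin finN by (auto intro: finite_subset)
  show ?case
  proof (cases "A = {}")
    case True then show ?thesis by auto
  next
    case nonempty: False
    \<comment> \<open>Without a proper nonempty tight set every such set has a spare neighbour, so
      any edge from \<open>a\<close> to \<open>b\<close> may be fixed and Hall's condition survives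
      the removal of both ends. A tight set \<open>S\<close> is matched into its own neighbourhood,
      and the rest can avoid that neighbourhood.\<close>
    show ?thesis
    proof (cases "\<exists>S. S \<subset> A \<and> S \<noteq> {} \<and> card S = card (\<Union>(N ` S))")
      case False
      then have strict: "card S < card (\<Union>(N ` S))" if "S \<subset> A" "S \<noteq> {}" for S
        using that H[of S] by (metis le_neq_implies_less psubset_imp_subset)
      obtain a where a: "a \<in> A" using nonempty by auto
      have "card {a} \<le> card (\<Union>(N ` {a}))" using H[of "{a}"] a by auto
      then obtain b where b: "b \<in> N a" by (cases "N a = {}") auto
      have "\<exists>f. inj_on f (A - {a}) \<and> (\<forall>x\<in>A - {a}. f x \<in> N x - {b})"
      proof (rule less.hyps)
        show "card (A - {a}) < card A" using a fin by (meson card_Diff1_less)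
        show "finite (A - {a})" using fin by auto
        show "finite (N x - {b})" if "x \<in> A - {a}" for x using finN that by auto
        show "card S \<le> card (\<Union>x\<in>S. N x - {b})" if "S \<subseteq> A - {a}" for S
        proof (cases "S = {}")
          case False
          have eq: "(\<Union>x\<in>S. N x - {b}) = \<Union>(N ` S) - {b}" by auto
          have "S \<subset> A" using that a by auto
          then have "card S < card (\<Union>(N ` S))" using strict[of S] False by simp
          moreover have "card (\<Union>(N ` S)) \<le> Suc (card (\<Union>(N ` S) - {b}))"
            by (simp only: card_Diff_singleton_if split: if_splits) arith
          ultimately show ?thesis unfolding eq by simp
        qed auto
      qed
      then obtain f where f: "inj_on f (A - {a})" "\<forall>x\<in>A - {a}. f x \<in> N x - {b}" by auto
      have "inj_on (f(a := b)) A" using f by (auto simp: inj_on_def)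
      then show ?thesis using f b by (intro exI[of _ "f(a := b)"]) auto
    next
      case True
      then obtain S where S: "S \<subset> A" "S \<noteq> {}" "card S = card (\<Union>(N ` S))" by auto
      have finS: "finite S" using S fin by (meson finite_subset psubset_imp_subset)
      have "\<exists>f. inj_on f S \<and> (\<forall>x\<in>S. f x \<in> N x)"
        using psubset_card_mono[OF fin S(1)] S(1) finN H finS by (intro less.hyps) auto
      then obtain f where f: "inj_on f S" "\<forall>x\<in>S. f x \<in> N x" by auto
      let ?N = "\<lambda>x. N x - \<Union>(N ` S)"
      have "\<exists>g. inj_on g (A - S) \<and> (\<forall>x\<in>A - S. g x \<in> ?N x)"
      proof (rule less.hyps)
        show "card (A - S) < card A" using S fin by (intro psubset_card_mono) auto
        show "finite (A - S)" using fin by auto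
        show "finite (?N x)" if "x \<in> A - S" for x using finN that by auto
        show "card W \<le> card (\<Union>(?N ` W))" if W: "W \<subseteq> A - S" for W
        proof -
          have finW: "finite W" using W fin by (meson finite_Diff finite_subset)
          have "card W + card S = card (W \<union> S)"
            using W finW finS by (intro card_Un_disjoint[symmetric]) auto
          also have "\<dots> \<le> card (\<Union>(N ` (W \<union> S)))" using H[of "W \<union> S"] W S by auto
          also have "\<Union>(N ` (W \<union> S)) = \<Union>(?N ` W) \<union> \<Union>(N ` S)" by auto
          also have "card \<dots> \<le> card (\<Union>(?N ` W)) + card (\<Union>(N ` S))" by (rule card_Un_le)
          finally show ?thesis using S by simp
        qed
      qed
      then obtain g where g: "inj_on g (A - S)" "\<forall>x\<in>A - S. g x \<in> ?N x" by auto
      let ?h = "\<lambda>x. if x \<in> S then f x else g x"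
      have "inj_on ?h (S \<union> (A - S))"
      proof (subst inj_on_Un, intro conjI)
        show "inj_on ?h S" using f(1) by (auto simp: inj_on_def)
        show "inj_on ?h (A - S)" using g(1) by (auto simp: inj_on_def)
        have "f x \<noteq> g y" if "x \<in> S" "y \<in> A - S" for x y
        proof -
          have "f x \<in> \<Union>(N ` S)" using f(2) that(1) by (intro UN_I[of x]) auto
          moreover have "g y \<notin> \<Union>(N ` S)" using g(2) that(2) by (auto simp only: Diff_iff dest!: bspec)
          ultimately show ?thesis by metis
        qed
        then show "?h ` (S - (A - S)) \<inter> ?h ` (A - S - S) = {}" 
          by (intro equals0I) (elim IntE imageE, simp split: if_splits)
      qed
      then have "inj_on ?h A" by (rule inj_on_subset) auto
      then show ?thesis using f g by (intro exI[of _ ?h]) auto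
    qed
  qed
qed

text \<open>Reduction to the exact theorem: \<open>s\<close> dummy partners (tagged by
  \<open>Inr\<close>) adjacent to everything restore Hall's condition, and at most \<open>s\<close>
  elements are matched to them. \<open>D\<close> consists of the others.\<close>

lemma hall_matching_deficiency:
  fixes N :: "'a \<Rightarrow> 'b set"
  assumes fin: "finite A" "\<And>x. x \<in> A \<Longrightarrow> finite (N x)"
    and H: "\<And>S. S \<subseteq> A \<Longrightarrow> card S \<le> card (\<Union>(N ` S)) + s"
  shows "\<exists>D f. D \<subseteq> A \<and> inj_on f D \<and> (\<forall>x\<in>D. f x \<in> N x) \<and> card (A - D) \<le> s"
proof -
  let ?N = "\<lambda>x. Inl ` N x \<union> Inr ` {..<s} :: ('b + nat) set"
  have "\<exists>g. inj_on g A \<and> (\<forall>x\<in>A. g x \<in> ?N x)"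
  proof (rule hall_matching)
    show "card S \<le> card (\<Union>(?N ` S))" if S: "S \<subseteq> A" for S
    proof (cases "S = {}")
      case False
      have "finite (\<Union>(N ` S))" using S fin by (auto intro: finite_subset)
      then have "card (Inl ` \<Union>(N ` S) \<union> Inr ` {..<s} :: ('b + nat) set) = card (\<Union>(N ` S)) + s"
        by (subst card_Un_disjoint) (auto simp: card_image)
      moreover have "\<Union>(?N ` S) = Inl ` \<Union>(N ` S) \<union> Inr ` {..<s}" using False by auto
      ultimately show ?thesis using H[OF S] by simp
    qed auto
  qed (use fin in auto)
  then obtain g where g: "inj_on g A" "\<And>x. x \<in> A \<Longrightarrow> g x \<in> ?N x" by auto
  let ?D = "{x \<in> A. isl (g x)}"
  have "inj_on (projl \<circ> g) ?D"
    using g(1) by (auto simp: inj_on_def isl_def)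
  moreover have "\<forall>x\<in>?D. (projl \<circ> g) x \<in> N x" using g(2) by fastforce
  moreover have "card (A - ?D) \<le> s"
  proof -
    have "g ` (A - ?D) \<subseteq> Inr ` {..<s}" using g(2) by fastforce
    then have "card (g ` (A - ?D)) \<le> card (Inr ` {..<s} :: ('b + nat) set)"
      by (intro card_mono) auto
    moreover have "inj_on g (A - ?D)" using g(1) by (rule inj_on_subset) auto
    ultimately show ?thesis by (simp add: card_image)
  qed
  ultimately show ?thesis by (intro exI[of _ ?D] exI[of _ "projl \<circ> g"]) auto
qed

text \<open>The arcs from \<open>x\<close> to \<open>f x\<close> form directed paths and cycles.
  They are inserted one at a time: before \<open>x\<close> enters \<open>D\<close> it has no
  outgoing arc and so ends its chain, and by injectivity \<open>f x\<close> has no incoming arc and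
  so starts its chain. Two different chains are glued; within one chain the arc closes a cycle, a
  state recorded by \<open>last xs \<in> D\<close>.\<close>

lemma partial_injection_chains:
  assumes "finite D" "D \<subseteq> V" "finite V" "inj_on f D" "f ` D \<subseteq> V"
  shows "\<exists>P. finite P \<and> pairwise (\<lambda>xs ys. set xs \<inter> set ys = {}) P \<and> \<Union>(set ` P) = V \<and>
    (\<forall>xs\<in>P. xs \<noteq> [] \<and> distinct xs \<and> successively (\<lambda>u v. u \<in> D \<and> v = f u) xs \<and>
            (last xs \<in> D \<longrightarrow> f (last xs) = hd xs))"
  using assms(1,2,4,5)
proof (induction D rule: finite_induct)
  case empty
  have "pairwise (\<lambda>xs ys. set xs \<inter> set ys = {}) ((\<lambda>v. [v]) ` V)"
    by (auto simp: pairwise_def)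
  then show ?case using assms(3) by (intro exI[of _ "(\<lambda>v. [v]) ` V"]) auto
next
  case (insert x D)
  then obtain P where P: "finite P" "pairwise (\<lambda>xs ys. set xs \<inter> set ys = {}) P" "\<Union>(set ` P) = V"
    and chain: "\<And>xs. xs \<in> P \<Longrightarrow> xs \<noteq> [] \<and> distinct xs \<and>
        successively (\<lambda>u v. u \<in> D \<and> v = f u) xs \<and> (last xs \<in> D \<longrightarrow> f (last xs) = hd xs)"
    by (auto simp: inj_on_def)
  let ?R = "\<lambda>u v. u \<in> D \<and> v = f u" and ?R' = "\<lambda>u v. u \<in> insert x D \<and> v = f u"
  have mono: "successively ?R' xs" if "successively ?R xs" for xs
    using that by (rule successively_mono) auto
  have disj: "p = q" if "p \<in> P" "q \<in> P" "u \<in> set p" "u \<in> set q" for p q u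
    using P(2) that by (auto simp: pairwise_def)
  obtain p where p: "p \<in> P" "x \<in> set p" using P(3) insert.prems by auto
  have lastp: "last p = x"
  proof (rule ccontr)
    assume "last p \<noteq> x"
    moreover obtain ys zs where s: "p = ys @ x # zs" using p by (meson split_list)
    ultimately obtain z zs' where "zs = z # zs'" by (cases zs) auto
    then have "x \<in> D" using chain[OF p(1)] s by (auto simp: successively_append_iff)
    then show False using insert by auto
  qed
  obtain q where q: "q \<in> P" "f x \<in> set q" using P(3) insert.prems by auto
  have fx: "f u \<noteq> f x" if "u \<in> D" for u
    using insert.prems(2) insert.hyps that by (auto simp: inj_on_def)
  have hdq: "hd q = f x"
  proof (rule ccontr)
    assume "hd q \<noteq> f x"
    moreover obtain ys zs where s: "q = ys @ f x # zs" using q by (meson split_list)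
    ultimately have "ys \<noteq> []" by (cases ys) auto
    then have "last ys \<in> D \<and> f x = f (last ys)"
      using chain[OF q(1)] s by (auto simp: successively_append_iff)
    then show False using fx by metis
  qed
  have lastq: "last q \<notin> D" using chain[OF q(1)] hdq fx by auto
  show ?case
  proof (cases "p = q")
    case True
    have "last xs \<in> insert x D \<longrightarrow> f (last xs) = hd xs" if xs: "xs \<in> P" for xs
    proof (cases "last xs = x")
      case eq: True
      then have "x \<in> set xs" using chain[OF xs] last_in_set by metis
      then have "xs = p" using disj[OF xs p(1)] p(2) by auto
      then show ?thesis using True hdq eq by auto
    qed (use chain[OF xs] in auto)
    then show ?thesis using P chain mono by (intro exI[of _ P]) blast
  next
    case False
    let ?P = "insert (p @ q) (P - {p, q})"
    have disjpq: "set p \<inter> set q = {}" using P(2) p q False by (auto simp: pairwise_def)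
    have 1: "pairwise (\<lambda>xs ys. set xs \<inter> set ys = {}) ?P"
    proof (subst pairwise_insert, intro conjI allI impI)
      show "pairwise (\<lambda>xs ys. set xs \<inter> set ys = {}) (P - {p, q})"
        using P(2) by (rule pairwise_subset) auto
      fix xs assume "xs \<in> P - {p, q} \<and> xs \<noteq> p @ q"
      then have "set p \<inter> set xs = {}" "set q \<inter> set xs = {}"
        using pairwiseD[OF P(2) p(1), of xs] pairwiseD[OF P(2) q(1), of xs] by auto
      then show "set (p @ q) \<inter> set xs = {}" "set xs \<inter> set (p @ q) = {}" by auto
    qed
    have 2: "\<Union>(set ` ?P) = V" using P(3) p(1) q(1) by auto
    have 3: "xs \<noteq> [] \<and> distinct xs \<and> successively ?R' xs \<and>
             (last xs \<in> insert x D \<longrightarrow> f (last xs) = hd xs)" if "xs \<in> ?P" for xs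
    proof (cases "xs = p @ q")
      case True
      have "successively ?R' (p @ q)"
        using mono chain[OF p(1)] chain[OF q(1)] lastp hdq by (auto simp: successively_append_iff)
      moreover have "last (p @ q) \<notin> insert x D"
        using lastq chain[OF q(1)] last_in_set[of q] disjpq p(2) by auto
      ultimately show ?thesis using True chain[OF p(1)] chain[OF q(1)] disjpq by auto
    next
      case False
      then have xs: "xs \<in> P" "xs \<noteq> p" using that by auto
      have "x \<notin> set xs" using disj[OF xs(1) p(1)] xs(2) p(2) by auto
      then have "last xs \<noteq> x" using chain[OF xs(1)] last_in_set by metis
      then show ?thesis using chain[OF xs(1)] mono by auto
    qed
    show ?thesis using 1 2 3 P(1) by (intro exI[of _ ?P]) auto
  qed
qed

section \<open>Breaks of linear and cyclic orderings\<close>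

fun breaks :: "'a set set \<Rightarrow> 'a list \<Rightarrow> nat" where
  "breaks G (x # y # zs) = of_bool ({x, y} \<notin> G) + breaks G (y # zs)"
| "breaks G _ = 0"

definition cyclic_breaks :: "'a set set \<Rightarrow> 'a list \<Rightarrow> nat" where
  "cyclic_breaks G xs = breaks G xs + of_bool ({last xs, hd xs} \<notin> G)"

lemma breaks_append:
  assumes "xs \<noteq> []" "ys \<noteq> []"
  shows "breaks G (xs @ ys) = breaks G xs + of_bool ({last xs, hd ys} \<notin> G) + breaks G ys"
  using assms(1)
proof (induction xs rule: induct_list012)
  case (2 x)
  then show ?case using assms(2) by (cases ys) auto
qed auto

lemma breaks_rev [simp]: "breaks G (rev xs) = breaks G xs"
proof (induction xs rule: induct_list012)
  case (3 x y zs)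
  have "breaks G (rev (x # y # zs)) = breaks G (rev (y # zs) @ [x])" by simp
  also have "\<dots> = breaks G (rev (y # zs)) + of_bool ({y, x} \<notin> G)"
    by (subst breaks_append) auto
  finally show ?case using 3 by (simp add: insert_commute)
qed auto

lemma breaks_mono: "G \<subseteq> G' \<Longrightarrow> breaks G' xs \<le> breaks G xs"
  by (induction xs rule: induct_list012) auto

lemma cyclic_breaks_rotate:
  assumes "xs \<noteq> []" "ys \<noteq> []"
  shows "cyclic_breaks G (ys @ xs) = cyclic_breaks G (xs @ ys)"
  using assms by (simp add: cyclic_breaks_def breaks_append)

lemma breaks_pos_split:
  "breaks G vs > 0 \<Longrightarrow> \<exists>xs ys. vs = xs @ ys \<and> xs \<noteq> [] \<and> ys \<noteq> [] \<and> {last xs, hd ys} \<notin> G"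
proof (induction vs rule: induct_list012)
  case (3 x y zs)
  show ?case
  proof (cases "{x, y} \<in> G")
    case False
    then show ?thesis by (intro exI[of _ "[x]"] exI[of _ "y # zs"]) auto
  next
    case True
    then obtain xs ys where "y # zs = xs @ ys \<and> xs \<noteq> [] \<and> ys \<noteq> [] \<and> {last xs, hd ys} \<notin> G"
      using 3 by auto
    then show ?thesis by (intro exI[of _ "x # xs"] exI[of _ ys]) auto
  qed
qed auto

section \<open>Removing breaks by exchanges\<close>

lemma cyclic_breaks_pos_rotate:
  assumes "cyclic_breaks G vs > 0"
  shows "\<exists>ws. mset ws = mset vs \<and> cyclic_breaks G ws = cyclic_breaks G vs \<and> {last ws, hd ws} \<notin> G"
proof (cases "{last vs, hd vs} \<in> G")
  case True
  then have "breaks G vs > 0" using assms by (simp add: cyclic_breaks_def)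
  then obtain xs ys where "vs = xs @ ys \<and> xs \<noteq> [] \<and> ys \<noteq> [] \<and> {last xs, hd ys} \<notin> G"
    using breaks_pos_split by blast
  then show ?thesis
    by (intro exI[of _ "ys @ xs"]) (auto simp: cyclic_breaks_rotate)
qed auto

text \<open>Both exchanges cut the cyclic list \<open>P @ Q @ S\<close> at its three junctions, one
  of which is a break, and rejoin the pieces by three given edges: no break can arise and the old
  one disappears. The two patterns belong to the two relative orders of the new neighbours of the
  first and the last vertex.\<close>

lemma exchange_outer:
  assumes "P \<noteq> []" "Q \<noteq> []" "S \<noteq> []" "{last S, hd P} \<notin> G" "G \<subseteq> G'"
    and "{hd P, hd Q} \<in> G'" "{last Q, last S} \<in> G'" "{hd S, last P} \<in> G'"
  shows "cyclic_breaks G' (rev P @ Q @ rev S) < cyclic_breaks G (P @ Q @ S)"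
  using assms breaks_mono[OF assms(5), of P] breaks_mono[OF assms(5), of Q] breaks_mono[OF assms(5), of S]
  by (simp add: cyclic_breaks_def breaks_append hd_rev last_rev)

lemma exchange_inner:
  assumes "P \<noteq> []" "Q \<noteq> []" "S \<noteq> []" "{last S, hd P} \<notin> G" "G \<subseteq> G'"
    and "{hd Q, last S} \<in> G'" "{hd S, hd P} \<in> G'" "{last P, last Q} \<in> G'"
  shows "cyclic_breaks G' (rev Q @ rev S @ P) < cyclic_breaks G (P @ Q @ S)"
  using assms breaks_mono[OF assms(5), of P] breaks_mono[OF assms(5), of Q] breaks_mono[OF assms(5), of S]
  by (simp add: cyclic_breaks_def breaks_append hd_rev last_rev)

lemma breaks_zero_nth:
  "breaks G vs = 0 \<Longrightarrow> Suc i < length vs \<Longrightarrow> {vs ! i, vs ! Suc i} \<in> G"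
proof (induction vs arbitrary: i rule: induct_list012)
  case (3 x y zs)
  then show ?case by (cases i) (auto split: if_splits)
qed auto

lemma cycle_edges_subset:
  assumes "cyclic_breaks G vs = 0"
  shows "cycle_edges vs \<subseteq> G"
proof
  fix e assume "e \<in> cycle_edges vs"
  then obtain i where i: "i < length vs" "e = {vs ! i, vs ! (Suc i mod length vs)}"
    by (auto simp: cycle_edges_def)
  show "e \<in> G"
  proof (cases "Suc i < length vs")
    case True
    then show ?thesis using i assms breaks_zero_nth[of G vs i] by (simp add: cyclic_breaks_def)
  next
    case False
    then have "Suc i = length vs" using i by simp
    moreover from this have "vs \<noteq> []" "i = length vs - 1" by auto
    ultimately show ?thesis using i assms
      by (simp add: cyclic_breaks_def last_conv_nth hd_conv_nth split: if_splits)
  qed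
qed

lemma breaks_concat:
  assumes "\<And>xs. xs \<in> set xss \<Longrightarrow> xs \<noteq> [] \<and> breaks G xs = 0"
  shows "breaks G (concat xss) \<le> length xss - 1"
  using assms
proof (induction xss)
  case (Cons xs xss)
  show ?case
  proof (cases xss)
    case (Cons ys yss)
    have "breaks G (xs @ concat xss) \<le> breaks G xs + 1 + breaks G (concat xss)"
      using Cons.prems Cons by (subst breaks_append) auto
    then show ?thesis using Cons.IH Cons.prems Cons by auto
  qed (use Cons in auto)
qed auto

lemma successively_breaks_zero:
  assumes "successively R xs" "\<And>u v. R u v \<Longrightarrow> {u, v} \<in> G"
  shows "breaks G xs = 0"
  using assms by (induction xs rule: induct_list012) auto

text \<open>A closing edge is sought between two large fixed sets, so the order of \<open>i\<close>
  and \<open>j\<close>, which decides the exchange pattern, must be the same for all candidates.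
  With \<open>z\<close> the \<open>q\<close>-th smallest element of \<open>I\<close>, at least
  \<open>q\<close> elements of \<open>I\<close> lie weakly on either side of \<open>z\<close>, and
  one side of \<open>z\<close> contains at least \<open>q\<close> elements of
  \<open>J\<close>.\<close>

lemma median_split:
  fixes I J :: "nat set"
  assumes "finite I" "finite J" "card I \<ge> 2 * q" "card J \<ge> 2 * q" "q > 0"
  shows "\<exists>I' J'. I' \<subseteq> I \<and> J' \<subseteq> J \<and> card I' \<ge> q \<and> card J' \<ge> q \<and>
    ((\<forall>i\<in>I'. \<forall>j\<in>J'. i \<le> j) \<or> (\<forall>i\<in>I'. \<forall>j\<in>J'. j < i))"
proof -
  let ?P = "\<lambda>z. card {i \<in> I. i \<le> z} \<ge> q"
  have "{i \<in> I. i \<le> Max I} = I" using assms(1) by auto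
  then have "?P (Max I)" using assms by simp
  then have P: "?P (LEAST z. ?P z)" by (rule LeastI)
  define z where "z = (LEAST z. ?P z)"
  have "card {i \<in> I. i < z} < q"
  proof (cases z)
    case 0 then show ?thesis using assms(5) by simp
  next
    case (Suc y)
    then have "\<not> ?P y" using not_less_Least[of y ?P] unfolding z_def by auto
    moreover have "{i \<in> I. i < z} = {i \<in> I. i \<le> y}" using Suc by auto
    ultimately show ?thesis by simp
  qed
  moreover have "card I = card {i \<in> I. i < z} + card {i \<in> I. z \<le> i}"
    using assms(1) by (subst card_Un_disjoint[symmetric]) (auto intro: arg_cong[where f = card])
  ultimately have 1: "card {i \<in> I. z \<le> i} \<ge> q" using assms(3) by linarith
  have 2: "card {i \<in> I. i \<le> z} \<ge> q" using P unfolding z_def .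
  have "card J = card {j \<in> J. j < z} + card {j \<in> J. z \<le> j}"
    using assms(2) by (subst card_Un_disjoint[symmetric]) (auto intro: arg_cong[where f = card])
  then consider "card {j \<in> J. j < z} \<ge> q" | "card {j \<in> J. z \<le> j} \<ge> q"
    using assms(4) by linarith
  then show ?thesis
  proof cases
    case a: 1
    then show ?thesis using 1
      by (intro exI[of _ "{i \<in> I. z \<le> i}"] exI[of _ "{j \<in> J. j < z}"]) auto
  next
    case 2
    then show ?thesis using \<open>card {i \<in> I. i \<le> z} \<ge> q\<close>
      by (intro exI[of _ "{i \<in> I. i \<le> z}"] exI[of _ "{j \<in> J. z \<le> j}"]) auto
  qed
qed

text \<open>A position \<open>i\<close> of an \<open>A\<close>-coloured neighbour of the first
  vertex and a position \<open>j\<close> of a \<open>B\<close>-coloured neighbour of the last one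
  determine the third edge of an exchange: it joins the predecessor of \<open>i\<close> to the
  successor of \<open>j\<close> if \<open>i \<le> j\<close>, and to the predecessor of
  \<open>j\<close> if \<open>j < i\<close>. After \<open>median_split\<close> there are
  \<open>q\<close> candidates for each end, and \<open>cl\<close> supplies a
  \<open>C\<close>-coloured edge between them.\<close>

lemma break_removal:
  fixes vs :: "'a list" and F U G :: "'a set set" and c :: "'a set \<Rightarrow> 'c"
  assumes vs: "distinct vs" "set vs = V" and q: "q > 0" and F: "F \<subseteq> [V]\<^bsup>2\<^esup>"
    and bad: "{last vs, hd vs} \<notin> G"
    and a: "\<And>v. v \<in> V \<Longrightarrow> \<exists>X\<subseteq>V. card X \<ge> 2 * q + 1 \<and> (\<forall>u\<in>X. {v, u} \<in> F - U \<and> c {v, u} \<in> A - c ` G)"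
    and b: "\<And>v. v \<in> V \<Longrightarrow> \<exists>X\<subseteq>V. card X \<ge> 2 * q + 1 \<and> (\<forall>u\<in>X. {v, u} \<in> F - U \<and> c {v, u} \<in> B - c ` G)"
    and cl: "\<And>S T. S \<subseteq> V \<Longrightarrow> T \<subseteq> V \<Longrightarrow> card S \<ge> q \<Longrightarrow> card T \<ge> q \<Longrightarrow>
      \<exists>u\<in>S. \<exists>w\<in>T. {u, w} \<in> F - U \<and> c {u, w} \<in> C - c ` G"
    and ne: "V \<noteq> {}"
  shows "\<exists>ws e1 e2 e3. distinct ws \<and> set ws = V \<and> {e1, e2, e3} \<subseteq> F - U \<and>
    c e1 \<in> A - c ` G \<and> c e2 \<in> B - c ` G \<and> c e3 \<in> C - c ` G \<and>
    cyclic_breaks (G \<union> {e1, e2, e3}) ws < cyclic_breaks G vs"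
proof -
  define n where "n = length vs"
  have n0: "n > 0" "vs \<noteq> []" using ne vs n_def by auto
  have finV: "finite V" using vs by auto
  have h: "hd vs = vs ! 0" "last vs = vs ! (n - 1)"
    using n0 by (auto simp: hd_conv_nth last_conv_nth n_def)
  have inV: "vs ! i \<in> V" if "i < n" for i using that vs n_def by auto
  obtain X where X: "X \<subseteq> V" "card X \<ge> 2 * q + 1"
    "\<And>u. u \<in> X \<Longrightarrow> {hd vs, u} \<in> F - U \<and> c {hd vs, u} \<in> A - c ` G"
    using a[of "hd vs"] n0 vs by auto
  obtain Y where Y: "Y \<subseteq> V" "card Y \<ge> 2 * q + 1"
    "\<And>u. u \<in> Y \<Longrightarrow> {last vs, u} \<in> F - U \<and> c {last vs, u} \<in> B - c ` G"
    using b[of "last vs"] n0 vs by auto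
  have idx: "card {i. i < n \<and> vs ! i \<in> Z} = card Z" if "Z \<subseteq> V" for Z
  proof -
    have "inj_on ((!) vs) {i. i < n \<and> vs ! i \<in> Z}"
      using vs(1) by (auto simp: inj_on_def n_def nth_eq_iff_index_eq)
    moreover have "(!) vs ` {i. i < n \<and> vs ! i \<in> Z} = Z"
      using that vs(2) by (force simp: n_def in_set_conv_nth)
    ultimately show ?thesis by (metis card_image)
  qed
  define I where "I = {i. i < n \<and> vs ! i \<in> X}"
  \<comment> \<open>Index 0 is discarded so that the piece \<open>take j vs\<close> is nonempty when
    \<open>j < i\<close>. This is where the \<open>+ 1\<close> of \<open>2 * q + 1\<close> is
    spent.\<close>
  define J where "J = {j. j < n \<and> vs ! j \<in> Y} - {0}"
  \<comment> \<open>Since \<open>F\<close> has no loops, \<open>i\<close> is not the first position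
    and \<open>j\<close> is not the last one, so the predecessor of \<open>i\<close> and the
    successor of \<open>j\<close> exist.\<close>
  have loop: "{v, v} \<notin> F" for v using F by (auto simp: nsets_def)
  have cI: "card I \<ge> 2 * q" using idx[OF X(1)] X(2) by (simp add: I_def)
  have cJ: "card J \<ge> 2 * q"
    using idx[OF Y(1)] Y(2) diff_card_le_card_Diff[of "{0}" "{j. j < n \<and> vs ! j \<in> Y}"]
    by (simp add: J_def)
  have I0: "i \<ge> 1 \<and> i < n" if "i \<in> I" for i
  proof -
    have "i \<noteq> 0" using that X(3) loop h unfolding I_def by (metis DiffD1 mem_Collect_eq)
    then show ?thesis using that by (simp add: I_def)
  qed
  have J0: "j \<ge> 1 \<and> j < n - 1" if "j \<in> J" for j
  proof -
    have "j \<noteq> n - 1" using that Y(3) loop h unfolding J_def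
      by (metis DiffD1 mem_Collect_eq)
    then show ?thesis using that by (auto simp: J_def)
  qed
  obtain I' J' where IJ: "I' \<subseteq> I" "J' \<subseteq> J" "card I' \<ge> q" "card J' \<ge> q"
    "(\<forall>i\<in>I'. \<forall>j\<in>J'. i \<le> j) \<or> (\<forall>i\<in>I'. \<forall>j\<in>J'. j < i)"
    using median_split[of I J q] cI cJ q by (auto simp: I_def J_def)
  have card_im: "card ((\<lambda>i. vs ! g i) ` K) = card K" if "inj_on g K" "\<forall>i\<in>K. g i < n" for g K
    using that vs(1) by (intro card_image) (auto simp: inj_on_def n_def nth_eq_iff_index_eq)
  let ?S = "(\<lambda>i. vs ! (i - 1)) ` I'"
  have S: "?S \<subseteq> V" "card ?S \<ge> q"
  proof -
    have "card ?S = card I'"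
    proof (intro card_im inj_onI ballI)
      fix i j assume "i \<in> I'" "j \<in> I'" "i - 1 = j - 1"
      moreover from this have "i \<ge> 1" "j \<ge> 1" using I0 IJ(1) by blast+
      ultimately show "i = j" by linarith
    next
      fix i assume "i \<in> I'" then have "i < n" using I0 IJ(1) by blast
      then show "i - 1 < n" by simp
    qed
    then show "card ?S \<ge> q" using IJ by simp
    show "?S \<subseteq> V" using I0 IJ(1) inV by force
  qed
  from IJ(5) show ?thesis
  proof
    assume le: "\<forall>i\<in>I'. \<forall>j\<in>J'. i \<le> j"
    let ?T = "(\<lambda>j. vs ! (j + 1)) ` J'"
    have T: "?T \<subseteq> V" "card ?T \<ge> q"
    proof -
      have "card ?T = card J'"
        using J0 IJ(2) by (intro card_im) (fastforce simp: inj_on_def)+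
      then show "card ?T \<ge> q" using IJ by simp
      show "?T \<subseteq> V" using J0 IJ(2) inV by force
    qed
    obtain i j where ij: "i \<in> I'" "j \<in> J'" 
      and e3: "{vs ! (i - 1), vs ! (j + 1)} \<in> F - U" "c {vs ! (i - 1), vs ! (j + 1)} \<in> C - c ` G"
      using cl[OF S(1) T(1) S(2) T(2)] by auto
    have iI: "i \<in> I" "j \<in> J" using ij IJ by auto
    have ile: "i \<le> j" "1 \<le> i" "j < n - 1" using le ij I0 J0 iI by auto
    define P Q R where "P = take i vs" and "Q = take (j + 1 - i) (drop i vs)" and "R = drop (j + 1) vs"
    have dec: "vs = P @ Q @ R"
      unfolding P_def Q_def R_def using ile 
      by (metis Nat.add_diff_assoc2 add.commute append_take_drop_id drop_drop le_add_diff_inverse2 le_SucI Suc_eq_plus1)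
    have ends: "P \<noteq> []" "Q \<noteq> []" "R \<noteq> []" "hd P = hd vs" "last P = vs ! (i - 1)" "hd Q = vs ! i"
      "last Q = vs ! j" "hd R = vs ! (j + 1)"
      using ile n0 by (auto simp: P_def Q_def R_def n_def hd_conv_nth last_conv_nth hd_drop_conv_nth)
    have lastR: "last R = last vs" using ile by (simp add: R_def n_def)
    let ?e1 = "{hd vs, vs ! i}" and ?e2 = "{last vs, vs ! j}" and ?e3 = "{vs ! (i - 1), vs ! (j + 1)}"
    have "cyclic_breaks (G \<union> {?e1, ?e2, ?e3}) (rev P @ Q @ rev R) < cyclic_breaks G (P @ Q @ R)"
      using ends lastR bad by (intro exchange_outer) (auto simp: insert_commute)
    moreover have "mset (rev P @ Q @ rev R) = mset vs" using dec by simp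
    then have "distinct (rev P @ Q @ rev R)" "set (rev P @ Q @ rev R) = V"
      using vs by (metis mset_eq_imp_distinct_iff, metis mset_eq_setD)
    moreover have "?e1 \<in> F - U" "c ?e1 \<in> A - c ` G" using X(3) iI(1) unfolding I_def by auto
    moreover have "?e2 \<in> F - U" "c ?e2 \<in> B - c ` G" using Y(3) iI(2) unfolding J_def by auto
    ultimately show ?thesis using e3 dec
      by (intro exI[of _ "rev P @ Q @ rev R"] exI[of _ ?e1] exI[of _ ?e2] exI[of _ ?e3]) simp
  next
    assume le: "\<forall>i\<in>I'. \<forall>j\<in>J'. j < i"
    let ?T = "(\<lambda>j. vs ! (j - 1)) ` J'"
    have T: "?T \<subseteq> V" "card ?T \<ge> q"
    proof -
      have "card ?T = card J'"
      proof (intro card_im inj_onI ballI)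
        fix i j assume "i \<in> J'" "j \<in> J'" "i - 1 = j - 1"
        moreover from this have "i \<ge> 1" "j \<ge> 1" using J0 IJ(2) by blast+
        ultimately show "i = j" by linarith
      next
        fix i assume "i \<in> J'" then have "i < n - 1" using J0 IJ(2) by blast
        then show "i - 1 < n" by simp
      qed
      then show "card ?T \<ge> q" using IJ by simp
      show "?T \<subseteq> V" using J0 IJ(2) inV by force
    qed
    obtain i j where ij: "i \<in> I'" "j \<in> J'" 
      and e3: "{vs ! (i - 1), vs ! (j - 1)} \<in> F - U" "c {vs ! (i - 1), vs ! (j - 1)} \<in> C - c ` G"
      using cl[OF S(1) T(1) S(2) T(2)] by auto
    have iI: "i \<in> I" "j \<in> J" using ij IJ by auto
    have ile: "j < i" "1 \<le> j" "i < n" using le ij I0 J0 iI by auto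
    define P Q R where "P = take j vs" and "Q = take (i - j) (drop j vs)" and "R = drop i vs"
    have dec: "vs = P @ Q @ R"
      unfolding P_def Q_def R_def using ile
      by (metis append_take_drop_id drop_drop le_add_diff_inverse2 less_imp_le)
    have ends: "P \<noteq> []" "Q \<noteq> []" "R \<noteq> []" "hd P = hd vs" "last P = vs ! (j - 1)" "hd Q = vs ! j"
      "last Q = vs ! (i - 1)" "hd R = vs ! i"
      using ile n0 by (auto simp: P_def Q_def R_def n_def hd_conv_nth last_conv_nth hd_drop_conv_nth)
    have lastR: "last R = last vs" using ile by (simp add: R_def n_def)
    let ?e1 = "{hd vs, vs ! i}" and ?e2 = "{last vs, vs ! j}" and ?e3 = "{vs ! (i - 1), vs ! (j - 1)}"
    have "cyclic_breaks (G \<union> {?e1, ?e2, ?e3}) (rev Q @ rev R @ P) < cyclic_breaks G (P @ Q @ R)"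
      using ends lastR bad by (intro exchange_inner) (auto simp: insert_commute)
    moreover have "mset (rev Q @ rev R @ P) = mset vs" using dec by simp
    then have "distinct (rev Q @ rev R @ P)" "set (rev Q @ rev R @ P) = V"
      using vs by (metis mset_eq_imp_distinct_iff, metis mset_eq_setD)
    moreover have "?e1 \<in> F - U" "c ?e1 \<in> A - c ` G" using X(3) iI(1) unfolding I_def by auto
    moreover have "?e2 \<in> F - U" "c ?e2 \<in> B - c ` G" using Y(3) iI(2) unfolding J_def by auto
    ultimately show ?thesis using e3 dec
      by (intro exI[of _ "rev Q @ rev R @ P"] exI[of _ ?e1] exI[of _ ?e2] exI[of _ ?e3]) simp
  qed
qed

text \<open>Each removal spends one colour of every palette and lowers the number of breaks. So for
  every palette the number of spent colours plus the number of remaining breaks stays at most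
  \<open>k\<close>, and never more than \<open>k\<close> of its colours are blocked. Quantifying
  over all sets \<open>K\<close> of that size makes the hypotheses independent of the run. The
  colours of \<open>M\<close> lie outside the palettes and block nothing.\<close>

lemma breaks_closure:
  fixes F U M :: "'a set set" and c :: "'a set \<Rightarrow> 'c"
  assumes vs: "distinct vs" "set vs = V" and q: "q > 0" and ne: "V \<noteq> {}" and F: "F \<subseteq> [V]\<^bsup>2\<^esup>"
    and disjABC: "A \<inter> B = {}" "A \<inter> C = {}" "B \<inter> C = {}"
    and M: "inj_on c M" "c ` M \<inter> (A \<union> B \<union> C) = {}" "cyclic_breaks M vs \<le> k"
    and a: "\<And>v K. v \<in> V \<Longrightarrow> finite K \<Longrightarrow> card K \<le> k \<Longrightarrow>
      \<exists>X\<subseteq>V. card X \<ge> 2 * q + 1 \<and> (\<forall>u\<in>X. {v, u} \<in> F - U \<and> c {v, u} \<in> A - K)"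
    and b: "\<And>v K. v \<in> V \<Longrightarrow> finite K \<Longrightarrow> card K \<le> k \<Longrightarrow>
      \<exists>X\<subseteq>V. card X \<ge> 2 * q + 1 \<and> (\<forall>u\<in>X. {v, u} \<in> F - U \<and> c {v, u} \<in> B - K)"
    and cl: "\<And>S T K. S \<subseteq> V \<Longrightarrow> T \<subseteq> V \<Longrightarrow> card S \<ge> q \<Longrightarrow> card T \<ge> q \<Longrightarrow> finite K \<Longrightarrow> card K \<le> k \<Longrightarrow>
      \<exists>u\<in>S. \<exists>w\<in>T. {u, w} \<in> F - U \<and> c {u, w} \<in> C - K"
  shows "\<exists>ws N. distinct ws \<and> set ws = V \<and> cyclic_breaks (M \<union> N) ws = 0 \<and> finite N \<and> N \<subseteq> F - U \<and>
    inj_on c (M \<union> N) \<and> c ` N \<subseteq> A \<union> B \<union> C \<and> card (c ` N \<inter> C) \<le> k"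
proof -
  have "\<exists>ws N'. distinct ws \<and> set ws = V \<and> cyclic_breaks (M \<union> N') ws = 0 \<and> finite N' \<and> N' \<subseteq> F - U \<and>
    inj_on c (M \<union> N') \<and> c ` N' \<subseteq> A \<union> B \<union> C \<and> card (c ` N' \<inter> C) \<le> k"
    if "distinct vs" "set vs = V" "finite N" "N \<subseteq> F - U" "inj_on c (M \<union> N)" "c ` N \<subseteq> A \<union> B \<union> C"
      "card (c ` N \<inter> A) + cyclic_breaks (M \<union> N) vs \<le> k"
      "card (c ` N \<inter> B) + cyclic_breaks (M \<union> N) vs \<le> k"
      "card (c ` N \<inter> C) + cyclic_breaks (M \<union> N) vs \<le> k" for vs N
    using that
  proof (induction "cyclic_breaks (M \<union> N) vs" arbitrary: vs N rule: less_induct)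
    case less
    note fin = less.prems(3)
    show ?case
    proof (cases "cyclic_breaks (M \<union> N) vs = 0")
      case True
      then show ?thesis using less.prems by (intro exI[of _ vs] exI[of _ N]) auto
    next
      case False
      then obtain us where us: "mset us = mset vs" "cyclic_breaks (M \<union> N) us = cyclic_breaks (M \<union> N) vs"
        "{last us, hd us} \<notin> M \<union> N"
        using cyclic_breaks_pos_rotate[of "M \<union> N" vs] by auto
      have us': "distinct us" "set us = V"
        using us(1) less.prems(1,2) by (metis mset_eq_imp_distinct_iff, metis mset_eq_setD)
      let ?G = "M \<union> N"
      have A': "A - c ` N \<inter> A \<subseteq> A - c ` ?G" "B - c ` N \<inter> B \<subseteq> B - c ` ?G" "C - c ` N \<inter> C \<subseteq> C - c ` ?G"
        using M(2) by auto
      have *: "\<exists>X\<subseteq>V. card X \<ge> 2 * q + 1 \<and> (\<forall>u\<in>X. {v, u} \<in> F - U \<and> c {v, u} \<in> A - c ` ?G)"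
              "\<exists>X\<subseteq>V. card X \<ge> 2 * q + 1 \<and> (\<forall>u\<in>X. {v, u} \<in> F - U \<and> c {v, u} \<in> B - c ` ?G)"
        if vV: "v \<in> V" for v
      proof -
        obtain X where "X \<subseteq> V" "card X \<ge> 2 * q + 1" "\<forall>u\<in>X. {v, u} \<in> F - U \<and> c {v, u} \<in> A - c ` N \<inter> A"
          using a[OF vV, of "c ` N \<inter> A"] less.prems(7) fin by auto
        then show "\<exists>X\<subseteq>V. card X \<ge> 2 * q + 1 \<and> (\<forall>u\<in>X. {v, u} \<in> F - U \<and> c {v, u} \<in> A - c ` ?G)"
          using A'(1) by (intro exI[of _ X]) blast
        obtain X where "X \<subseteq> V" "card X \<ge> 2 * q + 1" "\<forall>u\<in>X. {v, u} \<in> F - U \<and> c {v, u} \<in> B - c ` N \<inter> B"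
          using b[OF vV, of "c ` N \<inter> B"] less.prems(8) fin by auto
        then show "\<exists>X\<subseteq>V. card X \<ge> 2 * q + 1 \<and> (\<forall>u\<in>X. {v, u} \<in> F - U \<and> c {v, u} \<in> B - c ` ?G)"
          using A'(2) by (intro exI[of _ X]) blast
      qed
      have **: "\<exists>u\<in>S. \<exists>w\<in>T. {u, w} \<in> F - U \<and> c {u, w} \<in> C - c ` ?G"
        if "S \<subseteq> V" "T \<subseteq> V" "card S \<ge> q" "card T \<ge> q" for S T
      proof -
        have "finite (c ` N \<inter> C)" "card (c ` N \<inter> C) \<le> k" using fin less.prems(9) by auto
        from cl[OF that this] show ?thesis using A'(3) by blast
      qed
      obtain ws e1 e2 e3 where e: "distinct ws" "set ws = V" "{e1, e2, e3} \<subseteq> F - U"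
        "c e1 \<in> A - c ` ?G" "c e2 \<in> B - c ` ?G" "c e3 \<in> C - c ` ?G"
        "cyclic_breaks (?G \<union> {e1, e2, e3}) ws < cyclic_breaks ?G us"
        using break_removal[OF us' q F us(3) *  ** ne] by blast
      define N' where "N' = N \<union> {e1, e2, e3}"
      have G': "?G \<union> {e1, e2, e3} = M \<union> N'" by (auto simp: N'_def)
      have dec: "cyclic_breaks (M \<union> N') ws < cyclic_breaks ?G vs" using e(7) us(2) G' by simp
      have dc: "c e1 \<noteq> c e2" "c e1 \<noteq> c e3" "c e2 \<noteq> c e3" using e(4,5,6) disjABC by auto
      have inj: "inj_on c (M \<union> N')"
        unfolding G'[symmetric] using less.prems(5) e(4,5,6) dc
        by (simp add: inj_on_insert) blast
      have im: "c ` N' \<inter> A = insert (c e1) (c ` N \<inter> A)" "c ` N' \<inter> B = insert (c e2) (c ` N \<inter> B)"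
        "c ` N' \<inter> C = insert (c e3) (c ` N \<inter> C)"
        using e(4,5,6) disjABC by (auto simp: N'_def)
      have cards: "card (c ` N' \<inter> A) \<le> Suc (card (c ` N \<inter> A))" "card (c ` N' \<inter> B) \<le> Suc (card (c ` N \<inter> B))"
        "card (c ` N' \<inter> C) \<le> Suc (card (c ` N \<inter> C))"
        unfolding im by (rule card_insert_le_m1; simp)+
      show ?thesis
      proof (rule less.hyps[OF dec e(1,2)])
        show "finite N'" "N' \<subseteq> F - U" using fin less.prems(4) e(3) by (auto simp: N'_def)
        show "c ` N' \<subseteq> A \<union> B \<union> C" using less.prems(6) e(4,5,6) by (auto simp: N'_def)
        show "card (c ` N' \<inter> A) + cyclic_breaks (M \<union> N') ws \<le> k" using cards(1) dec less.prems(7) by linarith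
        show "card (c ` N' \<inter> B) + cyclic_breaks (M \<union> N') ws \<le> k" using cards(2) dec less.prems(8) by linarith
        show "card (c ` N' \<inter> C) + cyclic_breaks (M \<union> N') ws \<le> k" using cards(3) dec less.prems(9) by linarith
      qed (rule inj)
    qed
  qed
  from this[OF vs, of "{}"] show ?thesis using M by simp
qed

section \<open>Greedy packing of edge-disjoint rainbow cycles\<close>

lemma card_cycle_edges_at:
  assumes "distinct vs"
  shows "card {e \<in> cycle_edges vs. v \<in> e} \<le> 2"
proof -
  let ?n = "length vs"
  let ?I = "{i. i < ?n \<and> vs ! i = v}" and ?J = "{i. i < ?n \<and> vs ! (Suc i mod ?n) = v}"
  have I: "card ?I \<le> 1"
    using assms unfolding One_nat_def by (subst card_le_Suc0_iff_eq) (auto simp: nth_eq_iff_index_eq)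
  have eq: "i = j" if "i \<in> ?J" "j \<in> ?J" for i j
  proof -
    have "?n > 0" using that by (cases vs) auto
    then have "vs ! (Suc i mod ?n) = vs ! (Suc j mod ?n)" "Suc i mod ?n < ?n" "Suc j mod ?n < ?n"
      using that by auto
    then have "Suc i mod ?n = Suc j mod ?n" using assms nth_eq_iff_index_eq by blast
    then show ?thesis using that by (auto simp: mod_Suc split: if_splits)
  qed
  have J: "card ?J \<le> 1" unfolding One_nat_def
  proof (subst card_le_Suc0_iff_eq)
    show "\<forall>i\<in>?J. \<forall>j\<in>?J. i = j" using eq by blast
  qed auto
  have "{e \<in> cycle_edges vs. v \<in> e} \<subseteq> (\<lambda>i. {vs ! i, vs ! (Suc i mod ?n)}) ` (?I \<union> ?J)"
    by (auto simp: cycle_edges_def)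
  then have "card {e \<in> cycle_edges vs. v \<in> e} \<le> card (?I \<union> ?J)"
    by (rule surj_card_le[rotated]) auto
  also have "\<dots> \<le> card ?I + card ?J" by (rule card_Un_le)
  finally show ?thesis using I J by linarith
qed

lemma finite_cycle_edges [simp]: "finite (cycle_edges vs)"
  by (simp add: cycle_edges_def)

text \<open>One class is completed after the other. At a vertex, the finished cycles occupy at most
  \<open>2 * t\<close> edges and the current repairs block at most \<open>k\<close> colours. An
  occupied edge costs at most one colour, so the reserves in \<open>a\<close> and \<open>b\<close>
  are measured in colours rather than edges. Among the closing edges, a finished cycle occupies at
  most \<open>k\<close>, and a blocked colour removes its whole colour class, of size at most
  \<open>m\<close>.\<close>

lemma rainbow_cycle_packing:
  fixes F :: "nat set set" and c :: "nat set \<Rightarrow> 'c" and M :: "'i \<Rightarrow> nat set set"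
  assumes V: "finite V" "V \<noteq> {}" and q: "q > 0" and F: "F \<subseteq> [V]\<^bsup>2\<^esup>"
    and disjABC: "A \<inter> B = {}" "A \<inter> C = {}" "B \<inter> C = {}" and I: "finite I" "t \<le> card I"
    and M: "\<And>i. i \<in> I \<Longrightarrow> M i \<subseteq> F \<and> inj_on c (M i) \<and> c ` M i \<inter> (A \<union> B \<union> C) = {}"
    and Mdisj: "\<And>i j. i \<in> I \<Longrightarrow> j \<in> I \<Longrightarrow> i \<noteq> j \<Longrightarrow> M i \<inter> M j = {}"
    and vs: "\<And>i. i \<in> I \<Longrightarrow> distinct (vs i) \<and> set (vs i) = V \<and> cyclic_breaks (M i) (vs i) \<le> k"
    and a: "\<And>v. v \<in> V \<Longrightarrow> card (c ` {e \<in> F. v \<in> e} \<inter> A) \<ge> 2 * t + k + 2 * q + 1"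
    and b: "\<And>v. v \<in> V \<Longrightarrow> card (c ` {e \<in> F. v \<in> e} \<inter> B) \<ge> 2 * t + k + 2 * q + 1"
    and cl: "\<And>S T. S \<subseteq> V \<Longrightarrow> T \<subseteq> V \<Longrightarrow> card S \<ge> q \<Longrightarrow> card T \<ge> q \<Longrightarrow>
      card {e \<in> F. c e \<in> C \<and> (\<exists>u\<in>S. \<exists>w\<in>T. e = {u, w})} > t * k + k * m"
    and mult: "\<And>x. x \<in> C \<Longrightarrow> card {e \<in> F. c e = x} \<le> m"
  shows "\<exists>\<C>. finite \<C> \<and> card \<C> = t \<and> pairwise disjnt \<C> \<and>
    (\<forall>H\<in>\<C>. H \<subseteq> F \<and> inj_on c H \<and> (\<exists>vs. distinct vs \<and> set vs = V \<and> H = cycle_edges vs))"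
proof -
  have finF: "finite F" using F V(1) by (meson finite_imp_finite_nsets finite_subset)
  let ?ham = "\<lambda>H. H \<subseteq> F \<and> inj_on c H \<and> (\<exists>vs. distinct vs \<and> set vs = V \<and> H = cycle_edges vs)"
  \<comment> \<open>The invariant also records that an edge of a finished cycle outside its own
    \<open>M i\<close> has a reserved colour. Together with the disjointness of the
    \<open>M i\<close> this keeps the classes still to be processed untouched.\<close>
  let ?inv = "\<lambda>s J H. J \<subseteq> I \<and> card J = s \<and> (\<forall>i\<in>J. ?ham (H i) \<and>
      (\<forall>e\<in>H i. e \<in> M i \<or> c e \<in> A \<union> B \<union> C) \<and> card {e \<in> H i. c e \<in> C} \<le> k) \<and>
      (\<forall>i\<in>J. \<forall>j\<in>J. i \<noteq> j \<longrightarrow> H i \<inter> H j = {})"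
  have "\<exists>J H. ?inv s J H" if "s \<le> t" for s
    using that
  proof (induction s)
    case 0 then show ?case by (intro exI[of _ "{}"]) auto
  next
    case (Suc s)
    then have "\<exists>J H. ?inv s J H" by simp
    then obtain J H where inv: "?inv s J H" by blast
    have J: "J \<subseteq> I" "card J = s" by (rule conjunct1[OF inv], rule conjunct1[OF conjunct2[OF inv]])
    have H: "?ham (H i)" if "i \<in> J" for i
      using bspec[OF conjunct1[OF conjunct2[OF conjunct2[OF inv]]] that] by simp
    have HM: "e \<in> M i \<or> c e \<in> A \<union> B \<union> C" if "i \<in> J" "e \<in> H i" for i e
      using bspec[OF conjunct1[OF conjunct2[OF conjunct2[OF inv]]] that(1)] that(2) by simp
    have HC: "card {e \<in> H i. c e \<in> C} \<le> k" if "i \<in> J" for i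
      using bspec[OF conjunct1[OF conjunct2[OF conjunct2[OF inv]]] that] by simp
    have Hd: "H i \<inter> H j = {}" if "i \<in> J" "j \<in> J" "i \<noteq> j" for i j
      using conjunct2[OF conjunct2[OF conjunct2[OF inv]]] that by blast
    have finJ: "finite J" using J I finite_subset by blast
    have "J \<noteq> I" using J I Suc.prems by auto
    then obtain i where i: "i \<in> I" "i \<notin> J" using J by auto
    define U where "U = \<Union>(H ` J)"
    have finH: "finite (H j)" if "j \<in> J" for j using H[OF that] by auto
    have finU: "finite U" using finJ finH by (auto simp: U_def)
    have Uv: "card {e \<in> U. v \<in> e} \<le> 2 * t" for v
    proof -
      have "{e \<in> U. v \<in> e} = (\<Union>j\<in>J. {e \<in> H j. v \<in> e})" by (auto simp: U_def)
      also have "card \<dots> \<le> (\<Sum>j\<in>J. card {e \<in> H j. v \<in> e})" by (rule card_UN_le[OF finJ])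
      also have "\<dots> \<le> (\<Sum>j\<in>J. 2)" using H card_cycle_edges_at by (intro sum_mono) metis
      finally show ?thesis using J Suc.prems by simp
    qed
    have UC: "card {e \<in> U. c e \<in> C} \<le> t * k"
    proof -
      have "{e \<in> U. c e \<in> C} = (\<Union>j\<in>J. {e \<in> H j. c e \<in> C})" by (auto simp: U_def)
      also have "card \<dots> \<le> (\<Sum>j\<in>J. card {e \<in> H j. c e \<in> C})" by (rule card_UN_le[OF finJ])
      also have "\<dots> \<le> (\<Sum>j\<in>J. k)" using HC by (intro sum_mono) auto
      also have "\<dots> \<le> t * k" using J Suc.prems by simp
      finally show ?thesis .
    qed
    have nbrs: "\<exists>X\<subseteq>V. card X \<ge> 2 * q + 1 \<and> (\<forall>u\<in>X. {v, u} \<in> F - U \<and> c {v, u} \<in> Z - K)"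
      if "v \<in> V" "finite K" "card K \<le> k"
        and Z: "card (c ` {e \<in> F. v \<in> e} \<inter> Z) \<ge> 2 * t + k + 2 * q + 1" for v K Z
    proof -
      let ?L = "c ` {e \<in> F. v \<in> e} \<inter> Z"
      let ?L' = "?L - (K \<union> c ` {e \<in> U. v \<in> e})"
      let ?X = "{u \<in> V. {v, u} \<in> F - U \<and> c {v, u} \<in> Z - K}"
      have "card (K \<union> c ` {e \<in> U. v \<in> e}) \<le> card K + card (c ` {e \<in> U. v \<in> e})" by (rule card_Un_le)
      also have "\<dots> \<le> k + 2 * t"
        using that(3) Uv[of v] card_image_le[of "{e \<in> U. v \<in> e}" c] finU by (intro add_mono) auto
      finally have "card ?L' \<ge> 2 * q + 1"
        using diff_card_le_card_Diff[of "K \<union> c ` {e \<in> U. v \<in> e}" ?L] that(2) finU Z by simp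
      moreover have "?L' \<subseteq> (\<lambda>u. c {v, u}) ` ?X"
      proof
        fix x assume x: "x \<in> ?L'"
        then obtain e where e: "e \<in> F" "v \<in> e" "x = c e" "e \<notin> U" by auto
        then obtain u where "e = {v, u}" "u \<in> V" using F by (auto simp: nsets_2_eq)
        then show "x \<in> (\<lambda>u. c {v, u}) ` ?X" using e x by auto
      qed
      then have "card ?L' \<le> card ?X" by (rule surj_card_le[rotated]) (use V in auto)
      ultimately show ?thesis by (intro exI[of _ ?X]) auto
    qed
    have close: "\<exists>u\<in>S. \<exists>w\<in>T. {u, w} \<in> F - U \<and> c {u, w} \<in> C - K"
      if "S \<subseteq> V" "T \<subseteq> V" "card S \<ge> q" "card T \<ge> q" "finite K" "card K \<le> k" for S T K
    proof -
      let ?W = "{e \<in> F. c e \<in> C \<and> (\<exists>u\<in>S. \<exists>w\<in>T. e = {u, w})}"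
      let ?R = "{e \<in> U. c e \<in> C} \<union> (\<Union>x\<in>K \<inter> C. {e \<in> F. c e = x})"
      have "card ?R \<le> card {e \<in> U. c e \<in> C} + card (\<Union>x\<in>K \<inter> C. {e \<in> F. c e = x})" by (rule card_Un_le)
      also have "card (\<Union>x\<in>K \<inter> C. {e \<in> F. c e = x}) \<le> (\<Sum>x\<in>K \<inter> C. card {e \<in> F. c e = x})"
        using that(5) by (intro card_UN_le) auto
      also have "\<dots> \<le> (\<Sum>x\<in>K \<inter> C. m)" using mult by (intro sum_mono) auto
      also have "\<dots> \<le> k * m" using that(5,6) card_mono[of K "K \<inter> C"] by auto
      finally have "card ?R < card ?W" using UC cl[OF that(1-4)] by simp
      moreover have "finite ?R" using finU finF that(5) by auto
      ultimately have "\<not> ?W \<subseteq> ?R" using card_mono[of ?R ?W] by (meson leD)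
      then obtain e where e: "e \<in> ?W" "e \<notin> ?R" by (meson subsetI)
      then obtain u w where uw: "u \<in> S" "w \<in> T" "e = {u, w}" by auto
      have "e \<in> F - U \<and> c e \<in> C - K" using e by auto
      then show ?thesis using uw by blast
    qed
    have "\<exists>ws N. distinct ws \<and> set ws = V \<and> cyclic_breaks (M i \<union> N) ws = 0 \<and> finite N \<and> N \<subseteq> F - U \<and>
      inj_on c (M i \<union> N) \<and> c ` N \<subseteq> A \<union> B \<union> C \<and> card (c ` N \<inter> C) \<le> k"
      using vs[OF i(1)] M[OF i(1)] close
      by (intro breaks_closure[where vs = "vs i" and q = q] nbrs a b q F disjABC V(2)) auto
    then obtain ws N where N: "distinct ws" "set ws = V" "cyclic_breaks (M i \<union> N) ws = 0" "finite N"
      "N \<subseteq> F - U" "inj_on c (M i \<union> N)" "c ` N \<subseteq> A \<union> B \<union> C" "card (c ` N \<inter> C) \<le> k" by auto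
    define D where "D = cycle_edges ws"
    have D: "D \<subseteq> M i \<union> N" using cycle_edges_subset[OF N(3)] by (simp add: D_def)
    have MU: "M i \<inter> U = {}"
    proof (intro equals0I)
      fix e assume e: "e \<in> M i \<inter> U"
      then obtain j where j: "j \<in> J" "e \<in> H j" by (auto simp: U_def)
      from HM[OF this] show False
        using Mdisj[of i j] i j(1) J(1) e M[OF i(1)] by auto
    qed
    have DU: "D \<inter> U = {}" using D MU N(5) by auto
    have "{e \<in> D. c e \<in> C} \<subseteq> {e \<in> N. c e \<in> C}" using D M[OF i(1)] by auto
    then have "card {e \<in> D. c e \<in> C} \<le> card {e \<in> N. c e \<in> C}" using N(4) by (intro card_mono) auto
    also have "\<dots> = card (c ` {e \<in> N. c e \<in> C})"
      using N(6) by (intro card_image[symmetric]) (auto simp: inj_on_def)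
    also have "c ` {e \<in> N. c e \<in> C} = c ` N \<inter> C" by auto
    finally have DC: "card {e \<in> D. c e \<in> C} \<le> k" using N(8) by simp
    have Dham: "?ham D"
      using D M[OF i(1)] N D_def by (auto intro: inj_on_subset)
    have "?inv (Suc s) (insert i J) (H(i := D))"
    proof (intro conjI ballI impI)
      show "insert i J \<subseteq> I" using J i by auto
      show "card (insert i J) = Suc s" using J i finJ by simp
    next
      fix j assume j: "j \<in> insert i J"
      show "(H(i := D)) j \<subseteq> F" "inj_on c ((H(i := D)) j)"
        "\<exists>vs. distinct vs \<and> set vs = V \<and> (H(i := D)) j = cycle_edges vs"
        using Dham H[of j] j by (cases "j = i"; simp)+
      show "e \<in> M j \<or> c e \<in> A \<union> B \<union> C" if "e \<in> (H(i := D)) j" for e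
        using that D N(7) HM[of j e] j by (cases "j = i") auto
      show "card {e \<in> (H(i := D)) j. c e \<in> C} \<le> k"
        using DC HC[of j] j by (cases "j = i") auto
    next
      fix j l assume "j \<in> insert i J" "l \<in> insert i J" "j \<noteq> l"
      then show "(H(i := D)) j \<inter> (H(i := D)) l = {}"
        using DU Hd by (auto simp: U_def)
    qed
    then show ?case by blast
  qed
  from this[of t] obtain J H where inv: "?inv t J H" by blast
  have J: "J \<subseteq> I" "card J = t" by (rule conjunct1[OF inv], rule conjunct1[OF conjunct2[OF inv]])
  have H: "?ham (H i)" if "i \<in> J" for i
    using bspec[OF conjunct1[OF conjunct2[OF conjunct2[OF inv]]] that] by simp
  have Hd: "H i \<inter> H j = {}" if "i \<in> J" "j \<in> J" "i \<noteq> j" for i j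
    using conjunct2[OF conjunct2[OF conjunct2[OF inv]]] that by blast
  have ne: "H i \<noteq> {}" if "i \<in> J" for i
    using H[OF that] V(2) by (auto simp: cycle_edges_def)
  have "inj_on H J"
  proof (rule inj_onI)
    fix i j assume ij: "i \<in> J" "j \<in> J" "H i = H j"
    then show "i = j" using Hd[of i j] ne[of i] by auto
  qed
  then have "card (H ` J) = t" using J by (simp add: card_image)
  moreover have "finite (H ` J)" using J I finite_subset by blast
  moreover have "pairwise disjnt (H ` J)"
  proof (rule pairwiseI)
    fix x y assume "x \<in> H ` J" "y \<in> H ` J" "x \<noteq> y"
    then show "disjnt x y" using Hd by (fastforce simp: disjnt_def)
  qed
  ultimately show ?thesis using H by (intro exI[of _ "H ` J"]) auto
qed

section \<open>From expansion to an ordering with few breaks\<close>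

definition closed_walks :: "('a \<Rightarrow> 'a \<Rightarrow> bool) \<Rightarrow> 'a set \<Rightarrow> nat \<Rightarrow> 'a list set" where
  "closed_walks R V l = {xs. distinct xs \<and> set xs \<subseteq> V \<and> 3 \<le> length xs \<and> length xs \<le> l \<and>
     successively R xs \<and> R (last xs) (hd xs)}"

lemma finite_closed_walks: "finite V \<Longrightarrow> finite (closed_walks R V l)"
  by (rule finite_subset[OF _ finite_lists_length_le[of V l]]) (auto simp: closed_walks_def)

lemma closed_walks_mono: "(\<And>u v. R u v \<Longrightarrow> R' u v) \<Longrightarrow> closed_walks R V l \<subseteq> closed_walks R' V l"
  by (auto simp: closed_walks_def intro: successively_mono)

text \<open>No arc leads from \<open>A\<close> to a vertex outside its neighbourhood, so
  \<open>ex\<close> is Hall's condition with deficiency \<open>s\<close>. The chains of the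
  resulting partial injection are of three kinds: at most \<open>s\<close> end outside
  \<open>D\<close>, at most \<open>z\<close> are closed with at most \<open>l\<close> vertices, and
  at most \<open>card V div Suc l\<close> have more than \<open>l\<close> vertices. A break of their
  cyclic concatenation can occur only where two chains meet. Antisymmetry of \<open>R\<close>
  excludes closed chains with one or two vertices, which is why \<open>closed_walks\<close> starts
  at length 3.\<close>

lemma few_breaks_ordering:
  fixes V :: "'a set"
  assumes V: "finite V" "V \<noteq> {}" and M: "\<And>u v. R u v \<Longrightarrow> {u, v} \<in> M"
    and R: "\<And>u v. R u v \<Longrightarrow> \<not> R v u"
    and ex: "\<And>A B. A \<subseteq> V \<Longrightarrow> B \<subseteq> V \<Longrightarrow> card A + card B > card V + s \<Longrightarrow> \<exists>u\<in>A. \<exists>v\<in>B. R u v"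
    and Z: "card (closed_walks R V l) \<le> z"
  shows "\<exists>vs. distinct vs \<and> set vs = V \<and> cyclic_breaks M vs \<le> s + card V div Suc l + z"
proof -
  let ?N = "\<lambda>u. {v \<in> V. R u v}"
  have "card A \<le> card (\<Union>(?N ` A)) + s" if A: "A \<subseteq> V" for A
  proof (rule ccontr)
    assume "\<not> card A \<le> card (\<Union>(?N ` A)) + s"
    moreover have "card (V - \<Union>(?N ` A)) = card V - card (\<Union>(?N ` A))"
      using V by (intro card_Diff_subset) (auto intro: finite_subset[of _ V])
    moreover have "card (\<Union>(?N ` A)) \<le> card V" using V by (intro card_mono) auto
    ultimately have "\<exists>u\<in>A. \<exists>v\<in>V - \<Union>(?N ` A). R u v" using A by (intro ex) auto
    then show False by auto
  qed
  from hall_matching_deficiency[OF V(1) _ this] V(1)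
  obtain D f where D: "D \<subseteq> V" "inj_on f D" "\<And>x. x \<in> D \<Longrightarrow> f x \<in> V \<and> R x (f x)" "card (V - D) \<le> s"
    by auto
  have finD: "finite D" using D(1) V(1) finite_subset by blast
  let ?R = "\<lambda>u v. u \<in> D \<and> v = f u"
  have "f ` D \<subseteq> V" using D(3) by auto
  from partial_injection_chains[OF finD D(1) V(1) D(2) this]
  obtain P where P: "finite P" "pairwise (\<lambda>xs ys. set xs \<inter> set ys = {}) P" "\<Union>(set ` P) = V"
    and ch: "\<And>xs. xs \<in> P \<Longrightarrow> xs \<noteq> [] \<and> distinct xs \<and> successively ?R xs \<and>
            (last xs \<in> D \<longrightarrow> f (last xs) = hd xs)" by auto
  have disj: "xs = ys" if "xs \<in> P" "ys \<in> P" "x \<in> set xs" "x \<in> set ys" for xs ys x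
    using pairwiseD[OF P(2) that(1,2)] that(3,4) by auto
  let ?O = "{xs \<in> P. last xs \<notin> D}" and ?S = "{xs \<in> P. last xs \<in> D \<and> length xs \<le> l}"
    and ?L = "{xs \<in> P. length xs > l}"
  have fin: "finite ?O" "finite ?S" "finite ?L" using P(1) by auto
  have sub: "set xs \<subseteq> V" if "xs \<in> P" for xs using P(3) that by auto
  have "card ?O \<le> card (V - D)"
  proof (rule card_inj_on_le[where f = last])
    show "inj_on last ?O"
      using disj ch by (intro inj_onI) (metis (no_types, lifting) last_in_set mem_Collect_eq)
    show "last ` ?O \<subseteq> V - D" using ch sub by fastforce
  qed (use V in auto)
  then have cO: "card ?O \<le> s" using D(4) by simp
  have "?S \<subseteq> closed_walks R V l"
  proof
    fix xs assume "xs \<in> ?S"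
    then have xs: "xs \<in> P" "last xs \<in> D" "length xs \<le> l" by auto
    note c = ch[OF xs(1)]
    have f: "f (last xs) = hd xs" "R (last xs) (hd xs)" using c xs(2) D(3)[of "last xs"] by auto
    have "3 \<le> length xs"
    proof (rule ccontr)
      assume "\<not> 3 \<le> length xs"
      then consider "length xs = 0" | "length xs = 1" | "length xs = 2" by linarith
      then show False
      proof cases
        case 1 then show False using c by simp
      next
        case 2
        then obtain u where "xs = [u]" by (cases xs) auto
        then show False using f R[of u u] by auto
      next
        case 3
        then obtain u v where uv: "xs = [u, v]" by (auto simp: numeral_2_eq_2 length_Suc_conv)
        then have "R u v" using c D(3)[of u] by auto
        then show False using f uv R[of u v] by auto
      qed
    qed
    moreover have "successively R xs" using c D(3) by (auto intro: successively_mono[of ?R])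
    ultimately show "xs \<in> closed_walks R V l"
      using c xs f sub[OF xs(1)] by (auto simp: closed_walks_def)
  qed
  then have cS: "card ?S \<le> z" using card_mono[OF finite_closed_walks[OF V(1)]] Z order_trans by blast
  have "card ?L * Suc l \<le> (\<Sum>xs\<in>?L. card (set xs))"
    using ch sum_mono[of ?L "\<lambda>_. Suc l" "\<lambda>xs. card (set xs)"] by (auto simp: distinct_card Suc_le_eq)
  also have "\<dots> = card (\<Union>(set ` ?L))"
    using fin disj by (subst card_UN_disjoint) auto
  also have "\<dots> \<le> card V" using sub V by (intro card_mono) auto
  finally have "card ?L \<le> card V div Suc l" by (simp add: less_eq_div_iff_mult_less_eq)
  have "P \<subseteq> ?O \<union> ?S \<union> ?L" by auto
  then have "card P \<le> card (?O \<union> ?S \<union> ?L)" using fin by (intro card_mono) auto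
  also have "\<dots> \<le> card ?O + card ?S + card ?L"
    using card_Un_le[of "?O \<union> ?S" ?L] card_Un_le[of ?O ?S] by linarith
  also have "\<dots> \<le> s + card V div Suc l + z"
    using cO cS \<open>card ?L \<le> card V div Suc l\<close> by linarith
  finally have cP: "card P \<le> s + card V div Suc l + z" .
  obtain xss where xss: "set xss = P" "distinct xss" using finite_distinct_list[OF P(1)] by blast
  have z: "breaks M xs = 0" if "xs \<in> P" for xs
  proof (rule successively_breaks_zero)
    show "successively ?R xs" using ch[OF that] by simp
    show "{u, v} \<in> M" if "?R u v" for u v using that D(3) M by blast
  qed
  have "breaks M (concat xss) \<le> length xss - 1" using z ch xss by (intro breaks_concat) auto
  moreover have "length xss = card P" using xss distinct_card by metis
  moreover have "P \<noteq> {}" using P(3) V by auto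
  then have "card P > 0" using P(1) by (simp add: card_gt_0_iff)
  ultimately have "cyclic_breaks M (concat xss) \<le> card P"
    by (auto simp: cyclic_breaks_def of_bool_def)
  moreover have "distinct (concat xss)"
  proof (intro distinct_concat)
    show "distinct ys" if "ys \<in> set xss" for ys using ch that xss by blast
    show "set ys \<inter> set zs = {}" if "ys \<in> set xss" "zs \<in> set xss" "ys \<noteq> zs" for ys zs
      using disj[of ys zs] that xss by blast
  qed (rule xss)
  moreover have "set (concat xss) = V" using xss P(3) by simp
  ultimately show ?thesis using cP by (intro exI[of _ "concat xss"]) linarith
qed

section \<open>Expectations over finite product distributions\<close>

abbreviation expect where "expect \<equiv> measure_pmf.expectation"
abbreviation Pr where "Pr \<equiv> measure_pmf.prob"

lemma expectation_finite_pmf: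
  fixes f :: "'a \<Rightarrow> real"
  assumes "finite (set_pmf p)"
  shows "expect p f = (\<Sum>x\<in>set_pmf p. pmf p x * f x)"
  using assms by (subst integral_measure_pmf_real[where A = "set_pmf p"]) (auto simp: mult.commute)

lemma expectation_finite_pmf_mono:
  fixes f :: "'a \<Rightarrow> real"
  assumes "finite (set_pmf p)" "\<And>x. x \<in> set_pmf p \<Longrightarrow> f x \<le> g x"
  shows "expect p f \<le> expect p g"
  using assms by (simp add: expectation_finite_pmf sum_mono mult_left_mono)

lemma expectation_bind_finite_pmf:
  fixes h :: "'b \<Rightarrow> real"
  assumes "finite (set_pmf p)" "\<And>x. x \<in> set_pmf p \<Longrightarrow> finite (set_pmf (f x))"
  shows "expect (bind_pmf p f) h = expect p (\<lambda>x. expect (f x) h)"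
  using assms by (subst pmf_expectation_bind[of "set_pmf p"]) (auto simp: expectation_finite_pmf[of p])

lemma expectation_swap_finite_pmf:
  fixes f :: "'a \<Rightarrow> 'b \<Rightarrow> real"
  assumes "finite (set_pmf p)" "finite (set_pmf q)"
  shows "expect p (\<lambda>x. expect q (f x)) = expect q (\<lambda>y. expect p (\<lambda>x. f x y))"
  using assms unfolding expectation_finite_pmf[OF assms(1)] expectation_finite_pmf[OF assms(2)]
  by (simp add: sum_distrib_left mult_ac) (rule sum.swap)

lemma prob_finite_pmf:
  assumes "finite (set_pmf p)"
  shows "Pr p S = expect p (\<lambda>x. of_bool (x \<in> S))"
proof -
  have "expect p (\<lambda>x. of_bool (x \<in> S)) = expect p (indicator S :: _ \<Rightarrow> real)"
    by (intro arg_cong[where f = "expect p"]) (auto simp: indicator_def)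
  then show ?thesis by simp
qed

lemma expectation_affine_of_bool:
  fixes a b :: real
  assumes "finite (set_pmf p)"
  shows "expect p (\<lambda>x. a * (1 - b * of_bool (x \<in> S))) = a * (1 - b * Pr p S)"
proof -
  have "expect p (\<lambda>x. a * (1 - b * of_bool (x \<in> S))) =
      a * (\<Sum>x\<in>set_pmf p. pmf p x) - a * b * (\<Sum>x\<in>set_pmf p. pmf p x * of_bool (x \<in> S))"
    unfolding expectation_finite_pmf[OF assms] sum_distrib_left sum_subtractf[symmetric]
    by (intro sum.cong) (auto simp: algebra_simps)
  then show ?thesis
    by (simp add: prob_finite_pmf[OF assms] expectation_finite_pmf[OF assms] sum_pmf_eq_1[OF assms]
        algebra_simps)
qed

lemma prob_le_expectation:
  fixes f :: "'a \<Rightarrow> real"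
  assumes "finite (set_pmf p)" "\<And>x. x \<in> set_pmf p \<Longrightarrow> x \<in> S \<Longrightarrow> 1 \<le> f x"
    and "\<And>x. x \<in> set_pmf p \<Longrightarrow> 0 \<le> f x"
  shows "Pr p S \<le> expect p f"
  unfolding prob_finite_pmf[OF assms(1)]
  using assms by (intro expectation_finite_pmf_mono) auto

lemma prob_UN_le:
  assumes "finite I"
  shows "Pr p (\<Union>i\<in>I. S i) \<le> (\<Sum>i\<in>I. Pr p (S i))"
  using assms by (intro measure_pmf.finite_measure_subadditive_finite) auto

lemma finite_set_Pi_pmf [intro]:
  assumes "finite A" "\<And>x. x \<in> A \<Longrightarrow> finite (set_pmf (p x))"
  shows "finite (set_pmf (Pi_pmf A d p))"
  using assms by (simp add: set_Pi_pmf finite_PiE_dflt)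

text \<open>The coordinate \<open>e\<close> is exposed last, given all others. This is the
  conditioning used for the greedy selection.\<close>

lemma expectation_Pi_pmf_insert:
  fixes f :: "('a \<Rightarrow> 'b) \<Rightarrow> real"
  assumes "finite A" "e \<notin> A" "\<And>x. x \<in> insert e A \<Longrightarrow> finite (set_pmf (p x))"
  shows "expect (Pi_pmf (insert e A) d p) f = expect (Pi_pmf A d p) (\<lambda>x. expect (p e) (\<lambda>y. f (x(e := y))))"
proof -
  have fin: "finite (set_pmf (Pi_pmf A d p))" "finite (set_pmf (p e))" using assms by auto
  have "expect (Pi_pmf (insert e A) d p) f = expect (p e) (\<lambda>y. expect (Pi_pmf A d p) (\<lambda>x. f (x(e := y))))"
    unfolding Pi_pmf_insert'[OF assms(1,2)] using fin
    by (simp add: expectation_bind_finite_pmf)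
  also have "\<dots> = expect (Pi_pmf A d p) (\<lambda>x. expect (p e) (\<lambda>y. f (x(e := y))))"
    using fin by (intro expectation_swap_finite_pmf)
  finally show ?thesis .
qed

lemma expectation_Pi_pmf_prod_le_prod:
  fixes g :: "'a \<Rightarrow> 'b \<Rightarrow> real"
  assumes "finite A" "\<And>e. e \<in> A \<Longrightarrow> finite (set_pmf (p e))" "\<And>e y. e \<in> A \<Longrightarrow> 0 \<le> g e y"
    and "\<And>e. e \<in> A \<Longrightarrow> expect (p e) (g e) \<le> b e"
  shows "expect (Pi_pmf A d p) (\<lambda>x. \<Prod>e\<in>A. g e (x e)) \<le> (\<Prod>e\<in>A. b e)"
proof -
  have "expect (Pi_pmf A d p) (\<lambda>x. \<Prod>e\<in>A. g e (x e)) = (\<Prod>e\<in>A. expect (p e) (g e))"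
    using assms by (intro expectation_prod_Pi_pmf) (auto intro: integrable_measure_pmf_finite)
  also have "\<dots> \<le> (\<Prod>e\<in>A. b e)"
    using assms by (intro prod_mono conjI Bochner_Integration.integral_nonneg) auto
  finally show ?thesis .
qed

text \<open>Common form of the exponential moments of independent choices, obtained from
  \<open>1 + b \<le> exp b\<close>. For lower tails \<open>b\<close> is negative.\<close>

lemma expectation_Pi_pmf_prod_le:
  fixes g :: "'a \<Rightarrow> 'b \<Rightarrow> real"
  assumes "finite A" "\<And>e. e \<in> A \<Longrightarrow> finite (set_pmf (p e))" "\<And>e y. e \<in> A \<Longrightarrow> 0 \<le> g e y"
    and "\<And>e. e \<in> A \<Longrightarrow> expect (p e) (g e) \<le> 1 + b e"
  shows "expect (Pi_pmf A d p) (\<lambda>x. \<Prod>e\<in>A. g e (x e)) \<le> exp (\<Sum>e\<in>A. b e)"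
proof -
  have "expect (Pi_pmf A d p) (\<lambda>x. \<Prod>e\<in>A. g e (x e)) \<le> (\<Prod>e\<in>A. exp (b e))"
  proof (rule expectation_Pi_pmf_prod_le_prod[OF assms(1-3)])
    show "expect (p e) (g e) \<le> exp (b e)" if "e \<in> A" for e
      using assms(4)[OF that] exp_ge_add_one_self[of "b e"] by linarith
  qed
  then show ?thesis by (simp add: exp_sum assms(1))
qed

text \<open>Colour 0 stands for an absent edge.\<close>

definition edge_colour_pmf :: "real \<Rightarrow> nat \<Rightarrow> nat pmf" where
  "edge_colour_pmf p r = bind_pmf (bernoulli_pmf p) (\<lambda>b. if b then pmf_of_set {1..r} else return_pmf 0)"

lemma finite_set_edge_colour_pmf [simp]: "r > 0 \<Longrightarrow> finite (set_pmf (edge_colour_pmf p r))"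
  by (auto simp: edge_colour_pmf_def)

lemma expectation_edge_colour_pmf:
  fixes f :: "nat \<Rightarrow> real"
  assumes "r > 0" "0 \<le> p" "p \<le> 1"
  shows "expect (edge_colour_pmf p r) f = p * (\<Sum>x\<in>{1..r}. f x) / r + (1 - p) * f 0"
proof -
  have "expect (edge_colour_pmf p r) f =
      expect (bernoulli_pmf p) (\<lambda>b. expect (if b then pmf_of_set {1..r} else return_pmf 0) f)"
    unfolding edge_colour_pmf_def
  proof (rule expectation_bind_finite_pmf)
    show "finite (set_pmf (bernoulli_pmf p))" by (rule finite_subset[OF subset_UNIV]) simp
    show "finite (set_pmf (if b then pmf_of_set {1..r} else return_pmf 0))" for b
      using assms(1) by (cases b) (auto simp: set_pmf_of_set)
  qed
  also have "\<dots> = p * expect (pmf_of_set {1..r}) f + (1 - p) * f 0"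
    using integral_bernoulli_pmf[OF assms(2,3),
        of "\<lambda>b. expect (if b then pmf_of_set {1..r} else return_pmf 0) f"] by simp
  also have "expect (pmf_of_set {1..r}) f = (\<Sum>x\<in>{1..r}. f x) / r"
    using assms by (subst integral_pmf_of_set) auto
  finally show ?thesis by simp
qed

lemma prob_edge_colour_pmf:
  assumes "r > 0" "0 \<le> p" "p \<le> 1" "S \<subseteq> {1..r}"
  shows "Pr (edge_colour_pmf p r) S = p * card S / r"
proof -
  have "Pr (edge_colour_pmf p r) S = p * (\<Sum>x\<in>{1..r}. of_bool (x \<in> S)) / r + (1 - p) * of_bool (0 \<in> S)"
    using assms by (subst prob_finite_pmf) (auto simp: expectation_edge_colour_pmf)
  moreover have "(\<Sum>x\<in>{1..r}. of_bool (x \<in> S) :: real) = card S"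
  proof -
    have "{1..r} \<inter> S = S" using assms(4) by auto
    then show ?thesis by (simp add: of_bool_def sum.If_cases)
  qed
  moreover have "0 \<notin> S" using assms(4) by auto
  ultimately show ?thesis by simp
qed

text \<open>The recursion settles \<open>es\<close> before \<open>e\<close>, so the list is
  processed from its end and the selection from the tail does not depend on \<open>x e\<close>.
  Given the tail, the fate of \<open>e\<close> is decided by a single independent colour.\<close>

fun greedy_rainbow :: "('e \<Rightarrow> bool) \<Rightarrow> 'c set \<Rightarrow> 'e list \<Rightarrow> ('e \<Rightarrow> 'c) \<Rightarrow> 'e set" where
  "greedy_rainbow P C [] x = {}"
| "greedy_rainbow P C (e # es) x =
    (let K = greedy_rainbow P C es x in if P e \<and> x e \<in> C - x ` K then insert e K else K)"

lemma greedy_rainbow_subset: "greedy_rainbow P C es x \<subseteq> {e \<in> set es. P e \<and> x e \<in> C}"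
  by (induction es) (auto simp: Let_def)

lemma finite_greedy_rainbow [simp]: "finite (greedy_rainbow P C es x)"
  by (rule finite_subset[OF greedy_rainbow_subset]) auto

lemma inj_on_greedy_rainbow: "inj_on x (greedy_rainbow P C es x)"
  by (induction es) (auto simp: Let_def)

lemma greedy_rainbow_upd:
  "e \<notin> set es \<Longrightarrow> greedy_rainbow P C es (x(e := y)) = greedy_rainbow P C es x"
proof (induction es)
  case (Cons a es)
  have "e \<notin> greedy_rainbow P C es x" using greedy_rainbow_subset[of P C es x] Cons.prems by auto
  then have "(x(e := y)) ` greedy_rainbow P C es x = x ` greedy_rainbow P C es x"
    by (intro image_cong) auto
  then show ?case using Cons by (auto simp: Let_def)
qed auto

text \<open>The weight \<open>z ^ _\<close> yields both the probability that no edge of \<open>T\<close> is kept (\<open>z = 0\<close>) and a lower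
  tail bound for the number of kept edges.\<close>

lemma greedy_rainbow_tail:
  fixes \<kappa> :: "'c pmf"
  assumes "distinct es" and fin: "finite (set_pmf \<kappa>)" and z: "0 \<le> z" "z \<le> 1" and q: "0 \<le> q" "q \<le> 1"
    and T: "T \<subseteq> {e \<in> set es. P e}"
    and K: "\<And>K. finite K \<Longrightarrow> card K \<le> cap \<Longrightarrow> Pr \<kappa> (C - K) \<ge> q"
  shows "expect (Pi_pmf (set es) d (\<lambda>_. \<kappa>)) (\<lambda>x. z ^ card (greedy_rainbow P C es x \<inter> T) *
      of_bool (card (greedy_rainbow P C es x) \<le> cap)) \<le> (1 - (1 - z) * q) ^ card T"
  using assms(1) T
proof (induction es arbitrary: T)
  case Nil
  then show ?case by simp
next
  case (Cons e es)
  let ?K = "greedy_rainbow P C es" and ?K' = "greedy_rainbow P C (e # es)"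
  let ?T = "T - {e}"
  let ?g = "\<lambda>x. z ^ card (?K x \<inter> ?T) * of_bool (card (?K x) \<le> cap)"
  let ?f = "\<lambda>x. z ^ card (?K' x \<inter> T) * of_bool (card (?K' x) \<le> cap)"
  let ?w = "if e \<in> T then 1 - (1 - z) * q else 1"
  have b: "0 \<le> (1 - z) * q" "(1 - z) * q \<le> 1" using z q by (auto intro: mult_le_one)
  have e: "e \<notin> set es" "distinct es" using Cons.prems by auto
  have finT: "finite T" using Cons.prems finite_subset by fastforce
  \<comment> \<open>Given the tail, the colour of \<open>e\<close> lies in \<open>C\<close> and
    avoids the at most \<open>cap\<close> kept colours with probability at least \<open>q\<close>.
    If more than \<open>cap\<close> edges have been kept, both sides are zero, because the kept set
    never shrinks.\<close>
  have step: "expect \<kappa> (\<lambda>y. ?f (x(e := y))) \<le> ?w * ?g x" for x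
  proof -
    have eK: "e \<notin> ?K x" using greedy_rainbow_subset[of P C es x] e by auto
    have im: "(x(e := y)) ` ?K x = x ` ?K x" for y using eK by (intro image_cong) auto
    have K': "?K' (x(e := y)) = (if P e \<and> y \<in> C - x ` ?K x then insert e (?K x) else ?K x)" for y
      unfolding greedy_rainbow.simps(2) greedy_rainbow_upd[OF e(1)] Let_def im by simp
    have KT: "?K x \<inter> T = ?K x \<inter> ?T" using eK by auto
    have g0: "0 \<le> ?g x" using z by simp
    show ?thesis
    proof (cases "e \<in> T")
      case False
      have le: "?f (x(e := y)) \<le> ?g x" for y
      proof -
        have "?K' (x(e := y)) \<inter> T = ?K x \<inter> ?T" unfolding K' using False KT by auto
        moreover have "card (?K x) \<le> card (?K' (x(e := y)))"
          unfolding K' by (auto intro: card_mono)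
        ultimately show ?thesis using z by (auto simp: of_bool_def)
      qed
      have "expect \<kappa> (\<lambda>y. ?f (x(e := y))) \<le> expect \<kappa> (\<lambda>_. ?g x)"
        using fin le by (intro expectation_finite_pmf_mono)
      then show ?thesis using False by simp
    next
      case True
      then have Pe: "P e" using Cons.prems by auto
      have le: "?f (x(e := y)) \<le> ?g x * (1 - (1 - z) * of_bool (y \<in> C - x ` ?K x))" for y
      proof (cases "y \<in> C - x ` ?K x")
        case y: True
        have "insert e (?K x) \<inter> T = insert e (?K x \<inter> ?T)" using True KT by auto
        moreover have "e \<notin> ?K x \<inter> ?T" by auto
        ultimately show ?thesis using y Pe z eK unfolding K' by (auto simp: of_bool_def)
      next
        case False
        then show ?thesis unfolding K' using KT by (auto simp: of_bool_def)
      qed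
      have "expect \<kappa> (\<lambda>y. ?f (x(e := y))) \<le> expect \<kappa> (\<lambda>y. ?g x * (1 - (1 - z) * of_bool (y \<in> C - x ` ?K x)))"
        using fin le by (intro expectation_finite_pmf_mono)
      also have "\<dots> = ?g x * (1 - (1 - z) * Pr \<kappa> (C - x ` ?K x))"
        by (rule expectation_affine_of_bool[OF fin])
      also have "\<dots> \<le> ?g x * (1 - (1 - z) * q)"
      proof (cases "card (?K x) \<le> cap")
        case True
        have "card (x ` ?K x) \<le> card (?K x)" by (intro card_image_le) simp
        then have "q \<le> Pr \<kappa> (C - x ` ?K x)" using K[of "x ` ?K x"] True by simp
        then have "(1 - z) * q \<le> (1 - z) * Pr \<kappa> (C - x ` ?K x)" using z by (intro mult_left_mono) auto
        then show ?thesis using g0 by (intro mult_left_mono) auto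
      qed simp
      finally show ?thesis using True by (simp add: mult.commute)
    qed
  qed
  have "expect (Pi_pmf (set (e # es)) d (\<lambda>_. \<kappa>)) ?f =
      expect (Pi_pmf (set es) d (\<lambda>_. \<kappa>)) (\<lambda>x. expect \<kappa> (\<lambda>y. ?f (x(e := y))))"
    unfolding list.set using fin e by (intro expectation_Pi_pmf_insert) auto
  also have "\<dots> \<le> expect (Pi_pmf (set es) d (\<lambda>_. \<kappa>)) (\<lambda>x. ?w * ?g x)"
    using fin step by (intro expectation_finite_pmf_mono finite_set_Pi_pmf) auto
  also have "\<dots> = ?w * expect (Pi_pmf (set es) d (\<lambda>_. \<kappa>)) ?g" by simp
  also have "\<dots> \<le> ?w * (1 - (1 - z) * q) ^ card ?T"
    using b Cons.prems e by (intro mult_left_mono Cons.IH) auto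
  also have "\<dots> = (1 - (1 - z) * q) ^ card T"
  proof (cases "e \<in> T")
    case True
    then show ?thesis using power_Suc[of "1 - (1 - z) * q" "card ?T"] card_Suc_Diff1[OF finT True] by simp
  qed simp
  finally show ?case .
qed

section \<open>Random labels and random colours\<close>

lemma expectation_two_valued:
  fixes a b :: real
  assumes "finite (set_pmf p)"
  shows "expect p (\<lambda>y. if y \<in> S then a else b) = b + (a - b) * Pr p S"
proof -
  have "expect p (\<lambda>y. if y \<in> S then a else b) =
      b * (\<Sum>x\<in>set_pmf p. pmf p x) + (a - b) * (\<Sum>x\<in>set_pmf p. pmf p x * of_bool (x \<in> S))"
    unfolding expectation_finite_pmf[OF assms] sum_distrib_left sum.distrib[symmetric]
    by (intro sum.cong) (auto simp: algebra_simps)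
  then show ?thesis
    by (simp add: prob_finite_pmf[OF assms] expectation_finite_pmf[OF assms] sum_pmf_eq_1[OF assms])
qed

lemma power_card_eq_prod:
  fixes a :: real
  assumes "finite A" "B \<subseteq> A"
  shows "a ^ card B = (\<Prod>e\<in>A. if e \<in> B then a else 1)"
  using assms by (simp add: prod.If_cases Int_absorb1)

lemma prob_unif: "finite A \<Longrightarrow> S \<subseteq> A \<Longrightarrow> A \<noteq> {} \<Longrightarrow> Pr (pmf_of_set A) S = card S / card A"
  by (simp add: measure_pmf_of_set Int_absorb1)

lemma card_nsets_2_le: "finite V \<Longrightarrow> real (card ([V]\<^bsup>2\<^esup>)) \<le> real (card V) ^ 2 / 2"
proof -
  assume "finite V"
  then have "card ([V]\<^bsup>2\<^esup>) = card V choose 2" by (simp add: card_nsets)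
  then have "2 * card ([V]\<^bsup>2\<^esup>) \<le> card V * (card V - 1)"
    by (simp only: choose_two times_div_less_eq_dividend)
  also have "\<dots> \<le> card V * card V" by simp
  finally have "real (2 * card ([V]\<^bsup>2\<^esup>)) \<le> real (card V * card V)" by (simp only: of_nat_le_iff)
  then show ?thesis by (simp add: power2_eq_square)
qed

section \<open>Expansion of the kept arcs of one class\<close>

definition ordered_pairs :: "'a set \<Rightarrow> 'a set \<Rightarrow> ('a \<times> 'a) set" where
  "ordered_pairs A B = {(u, v). u \<in> A \<and> v \<in> B \<and> u \<noteq> v}"

lemma card_ordered_pairs:
  assumes "finite A" "finite B"
  shows "card A * card B \<le> card (ordered_pairs A B) + min (card A) (card B)"
proof -
  have "A \<times> B \<subseteq> ordered_pairs A B \<union> (\<lambda>u. (u, u)) ` (A \<inter> B)" by (auto simp: ordered_pairs_def)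
  moreover have fin: "finite (ordered_pairs A B)"
    by (rule finite_subset[of _ "A \<times> B"]) (use assms in \<open>auto simp: ordered_pairs_def\<close>)
  ultimately have "card (A \<times> B) \<le> card (ordered_pairs A B \<union> (\<lambda>u. (u, u)) ` (A \<inter> B))"
    using assms by (intro card_mono) auto
  also have "\<dots> \<le> card (ordered_pairs A B) + card ((\<lambda>u. (u, u)) ` (A \<inter> B))" by (rule card_Un_le)
  also have "card ((\<lambda>u. (u, u)) ` (A \<inter> B)) \<le> card (A \<inter> B)" using assms by (intro card_image_le) auto
  also have "card (A \<inter> B) \<le> min (card A) (card B)" using assms by (auto intro: card_mono)
  finally show ?thesis using assms by (simp add: card_cartesian_product)
qed

text \<open>The labels \<open>i\<close> and \<open>T + i\<close> are the two orientations in class \<open>i < T\<close>; having only one of them,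
  a pair never forms a directed 2-cycle.\<close>

definition larc :: "(nat set \<Rightarrow> nat) \<Rightarrow> nat \<Rightarrow> nat \<Rightarrow> nat \<Rightarrow> nat \<Rightarrow> bool" where
  "larc lab T i u v \<longleftrightarrow> u \<noteq> v \<and> lab {u, v} = (if u < v then i else T + i)"

definition in_class :: "(nat set \<Rightarrow> nat) \<Rightarrow> nat \<Rightarrow> nat \<Rightarrow> nat set \<Rightarrow> bool" where
  "in_class lab T i e \<longleftrightarrow> lab e \<in> {i, T + i}"

abbreviation labels :: "nat set \<Rightarrow> nat \<Rightarrow> (nat set \<Rightarrow> nat) pmf" where
  "labels V T \<equiv> Pi_pmf ([V]\<^bsup>2\<^esup>) 0 (\<lambda>_. pmf_of_set {..<2 * T})"

abbreviation colours :: "nat set \<Rightarrow> real \<Rightarrow> nat \<Rightarrow> (nat set \<Rightarrow> nat) pmf" where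
  "colours V p r \<equiv> Pi_pmf ([V]\<^bsup>2\<^esup>) 0 (\<lambda>_. edge_colour_pmf p r)"

lemma finite_labels [simp]: "finite V \<Longrightarrow> T > 0 \<Longrightarrow> finite (set_pmf (labels V T))"
proof -
  assume "finite V" "T > 0"
  then have "{..<2 * T} \<noteq> {}" "finite ([V]\<^bsup>2\<^esup>)" by (auto simp: finite_imp_finite_nsets lessThan_empty_iff)
  then show ?thesis by (intro finite_set_Pi_pmf) (auto simp: set_pmf_of_set)
qed

lemma finite_colours [simp]: "finite V \<Longrightarrow> r > 0 \<Longrightarrow> finite (set_pmf (colours V p r))"
  by (intro finite_set_Pi_pmf) (auto simp: finite_imp_finite_nsets)

abbreviation kept :: "(nat set \<Rightarrow> nat) \<Rightarrow> nat \<Rightarrow> nat \<Rightarrow> nat set \<Rightarrow> nat set list \<Rightarrow> (nat set \<Rightarrow> nat) \<Rightarrow> nat set set" where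
  "kept lab T i C es \<equiv> greedy_rainbow (in_class lab T i) C es"

lemma larc_asym: "i < T \<Longrightarrow> larc lab T i u v \<Longrightarrow> \<not> larc lab T i v u"
  by (auto simp: larc_def insert_commute split: if_splits)

text \<open>Two exposures. For fixed labels, \<open>greedy_rainbow_tail\<close> with
  \<open>z = 0\<close> bounds the conditional probability by \<open>1 - q\<close> to the power
  \<open>card (S lab)\<close>, the number of arcs of class \<open>i\<close> from \<open>A\<close> to
  \<open>B\<close>. Averaging over the independent labels factorises over the pairs, and each
  ordered pair is an arc of class \<open>i\<close> with probability
  \<open>1 / (2 * T)\<close>.\<close>

lemma prob_no_larc:
  assumes V: "finite V" "A \<subseteq> V" "B \<subseteq> V" and es: "distinct es" "set es = [V]\<^bsup>2\<^esup>" and i: "i < T"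
    and r: "r > 0" and q: "0 \<le> q" "q \<le> 1"
    and K: "\<And>K. finite K \<Longrightarrow> card K \<le> cap \<Longrightarrow> Pr (edge_colour_pmf p r) (C - K) \<ge> q"
  shows "expect (labels V T) (\<lambda>lab. Pr (colours V p r)
      {x. card (kept lab T i C es x) \<le> cap \<and>
          (\<forall>u\<in>A. \<forall>v\<in>B. larc lab T i u v \<longrightarrow> {u, v} \<notin> kept lab T i C es x)})
    \<le> exp (- q / (2 * real T) * card (ordered_pairs A B))"
proof -
  let ?W = "[V]\<^bsup>2\<^esup>"
  \<comment> \<open>A pair inside \<open>A \<inter> B\<close> has two admissible labels, one for
    each orientation, so the cardinalities of the sets \<open>L e\<close> add up to at least the
    number of ordered pairs.\<close>
  define L where "L e = {l. \<exists>u\<in>A. \<exists>v\<in>B. e = {u, v} \<and> u \<noteq> v \<and> l = (if u < v then i else T + i)}" for e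
  define S where "S lab = {e \<in> ?W. lab e \<in> L e}" for lab :: "nat set \<Rightarrow> nat"
  let ?G = "\<lambda>lab. kept lab T i C es"
  have finW: "finite ?W" using V by (simp add: finite_imp_finite_nsets)
  have fin: "finite A" "finite B" using V finite_subset by auto
  have T: "T > 0" using i by simp
  have L: "L e \<subseteq> {..<2 * T}" for e using i by (auto simp: L_def)
  have inner: "Pr (colours V p r) {x. card (?G lab x) \<le> cap \<and>
      (\<forall>u\<in>A. \<forall>v\<in>B. larc lab T i u v \<longrightarrow> {u, v} \<notin> ?G lab x)} \<le> (1 - q) ^ card (S lab)" for lab
  proof -
    have "S lab \<subseteq> {e \<in> set es. in_class lab T i e}"
      using es by (auto simp: S_def L_def in_class_def)
    then have "expect (colours V p r) (\<lambda>x. 0 ^ card (?G lab x \<inter> S lab) * of_bool (card (?G lab x) \<le> cap))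
        \<le> (1 - (1 - 0) * q) ^ card (S lab)"
      unfolding es(2)[symmetric] using es q r K by (intro greedy_rainbow_tail) auto
    moreover have "Pr (colours V p r) {x. card (?G lab x) \<le> cap \<and>
        (\<forall>u\<in>A. \<forall>v\<in>B. larc lab T i u v \<longrightarrow> {u, v} \<notin> ?G lab x)} \<le>
        expect (colours V p r) (\<lambda>x. 0 ^ card (?G lab x \<inter> S lab) * of_bool (card (?G lab x) \<le> cap))"
    proof (intro prob_le_expectation)
      fix x assume x: "x \<in> {x. card (?G lab x) \<le> cap \<and> (\<forall>u\<in>A. \<forall>v\<in>B. larc lab T i u v \<longrightarrow> {u, v} \<notin> ?G lab x)}"
      have "?G lab x \<inter> S lab = {}"
        using x by (auto simp: S_def L_def larc_def)
      then show "1 \<le> (0::real) ^ card (?G lab x \<inter> S lab) * of_bool (card (?G lab x) \<le> cap)"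
        using x by simp
    qed (use V r in auto)
    ultimately show ?thesis by simp
  qed
  have "expect (labels V T) (\<lambda>lab. Pr (colours V p r)
      {x. card (?G lab x) \<le> cap \<and> (\<forall>u\<in>A. \<forall>v\<in>B. larc lab T i u v \<longrightarrow> {u, v} \<notin> ?G lab x)})
      \<le> expect (labels V T) (\<lambda>lab. \<Prod>e\<in>?W. if lab e \<in> L e then 1 - q else 1)"
  proof (intro expectation_finite_pmf_mono)
    fix lab
    have "(1 - q) ^ card (S lab) = (\<Prod>e\<in>?W. if e \<in> S lab then 1 - q else 1)"
      using finW by (intro power_card_eq_prod) (auto simp: S_def)
    also have "\<dots> = (\<Prod>e\<in>?W. if lab e \<in> L e then 1 - q else 1)"
      by (intro prod.cong) (auto simp: S_def)
    finally show "Pr (colours V p r)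
      {x. card (?G lab x) \<le> cap \<and> (\<forall>u\<in>A. \<forall>v\<in>B. larc lab T i u v \<longrightarrow> {u, v} \<notin> ?G lab x)}
      \<le> (\<Prod>e\<in>?W. if lab e \<in> L e then 1 - q else 1)" using inner[of lab] by simp
  qed (use V T in auto)
  also have "\<dots> \<le> exp (\<Sum>e\<in>?W. - q * card (L e) / (2 * T))"
  proof (intro expectation_Pi_pmf_prod_le[where g = "\<lambda>e y. if y \<in> L e then 1 - q else 1"] finW)
    fix e
    have ne: "{..<2 * T} \<noteq> {}" using T by (auto simp: lessThan_empty_iff)
    then show "finite (set_pmf (pmf_of_set {..<2 * T}))" by (simp add: set_pmf_of_set)
    then have "expect (pmf_of_set {..<2 * T}) (\<lambda>y. if y \<in> L e then 1 - q else 1) =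
       1 + (1 - q - 1) * Pr (pmf_of_set {..<2 * T}) (L e)" by (rule expectation_two_valued)
    then show "expect (pmf_of_set {..<2 * T}) (\<lambda>y. if y \<in> L e then 1 - q else 1) \<le> 1 + - q * card (L e) / (2 * T)"
      using prob_unif[OF _ L ne] by simp
  qed (use q in auto)
  also have "(\<Sum>e\<in>?W. - q * card (L e) / (2 * T)) = - q / (2 * real T) * (\<Sum>e\<in>?W. card (L e))"
    by (simp add: sum_distrib_left sum_divide_distrib sum_negf)
  also have "(\<Sum>e\<in>?W. card (L e)) = card (Sigma ?W L)"
    using finW L finite_subset[OF L] by (subst card_SigmaI) auto
  also have "exp (- q / (2 * real T) * card (Sigma ?W L)) \<le> exp (- q / (2 * real T) * card (ordered_pairs A B))"
  proof -
    let ?f = "\<lambda>(u, v). ({u, v}, if u < v then i else T + i)"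
    have "inj_on ?f (ordered_pairs A B)"
      using i by (auto simp: inj_on_def ordered_pairs_def doubleton_eq_iff split: if_splits)
    moreover have "?f ` ordered_pairs A B \<subseteq> Sigma ?W L"
    proof
      fix w assume "w \<in> ?f ` ordered_pairs A B"
      then obtain u v where uv: "u \<in> A" "v \<in> B" "u \<noteq> v" "w = ({u, v}, if u < v then i else T + i)"
        by (auto simp: ordered_pairs_def)
      then have "(if u < v then i else T + i) \<in> L {u, v}" unfolding L_def by blast
      then show "w \<in> Sigma ?W L" using uv V by auto
    qed
    moreover have "finite (Sigma ?W L)" using finW L finite_subset[OF L] by auto
    ultimately have "card (ordered_pairs A B) \<le> card (Sigma ?W L)" by (rule card_inj_on_le)
    then show ?thesis using q by (simp add: divide_right_mono mult_left_mono)
  qed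
  finally show ?thesis by simp
qed

lemma expectation_sum_finite_pmf:
  fixes f :: "'i \<Rightarrow> 'a \<Rightarrow> real"
  assumes "finite (set_pmf p)"
  shows "expect p (\<lambda>x. \<Sum>i\<in>I. f i x) = (\<Sum>i\<in>I. expect p (f i))"
  using assms by (intro Bochner_Integration.integral_sum) (auto intro: integrable_measure_pmf_finite)

text \<open>Comparison with the single term \<open>x ^ j\<close> of \<open>(1 + x) ^ n\<close> at
  \<open>x = m / n\<close>. Allowing \<open>j < m\<close> matters for the larger of two sets, which
  is counted through its complement.\<close>

lemma binomial_le_exp_power:
  assumes "j \<le> m" "1 \<le> m" "m \<le> n"
  shows "real (n choose j) \<le> (exp 1 * n / m) ^ m"
proof -
  have n: "n > 0" using assms by simp
  have "real (n choose j) * (m / n) ^ m \<le> real (n choose j) * (m / n) ^ j"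
    using assms by (intro mult_left_mono power_decreasing) auto
  also have "\<dots> = real (n choose j) * (m / n) ^ j * 1 ^ (n - j)" by simp
  also have "\<dots> \<le> (\<Sum>k\<le>n. real (n choose k) * (m / n) ^ k * 1 ^ (n - k))"
    using assms by (intro member_le_sum) auto
  also have "\<dots> = (m / n + 1) ^ n" by (rule binomial_ring[symmetric])
  also have "\<dots> \<le> exp (m / n) ^ n" using exp_ge_add_one_self[of "m / n"]
    by (intro power_mono) (auto simp: add.commute)
  also have "\<dots> = exp 1 ^ m" using n by (simp add: exp_of_nat_mult[symmetric])
  finally have "real (n choose j) * (m / n) ^ m \<le> exp 1 ^ m" .
  then show ?thesis using n assms by (simp add: power_divide power_mult_distrib field_simps)
qed

text \<open>Let \<open>m\<close> be the smaller and \<open>M\<close> the larger size. Since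
  \<open>n - M < m\<close>, both binomial coefficients are at most
  \<open>(exp 1 * n / m) ^ m\<close>, and there are at least
  \<open>m * (M - 1) \<ge> m * (n - m)\<close> ordered pairs. Each summand is thus bounded by an
  \<open>m\<close>-th power whose base is controlled by \<open>H\<close>, and \<open>m > s\<close>
  gives the factor \<open>exp (- c * s)\<close>. The factor \<open>n + 1\<close> counts the values
  of \<open>card A\<close>.\<close>

lemma sum_exp_ordered_pairs:
  fixes h c :: real
  assumes V: "finite V" "card V = n" and h: "h \<ge> 0" and c: "c \<ge> 0"
    and H: "\<And>m. s < m \<Longrightarrow> m \<le> n \<Longrightarrow> 2 * m \<le> n + s + 1 \<Longrightarrow>
      (exp 1 * n / m) ^ 2 * exp (- h * (real n - real m)) \<le> exp (- c)"
  shows "(\<Sum>(A, B)\<in>{(A, B). A \<subseteq> V \<and> B \<subseteq> V \<and> card A + card B = n + s + 1}.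
      exp (- h * card (ordered_pairs A B))) \<le> (real n + 1) * exp (- c * real s)"
proof -
  let ?S = "{(A, B). A \<subseteq> V \<and> B \<subseteq> V \<and> card A + card B = n + s + 1}"
  let ?f = "\<lambda>w. exp (- h * card (ordered_pairs (fst w) (snd w)))"
  have finS: "finite ?S" by (rule finite_subset[of _ "Pow V \<times> Pow V"]) (use V in auto)
  have le: "card (fst w) \<le> n" "card (snd w) \<le> n" if "w \<in> ?S" for w
    using that V by (auto intro: card_mono)
  have summand: "real (n choose a) * real (n choose (n + s + 1 - a)) *
      exp (- h * (real (a * (n + s + 1 - a)) - real (min a (n + s + 1 - a)))) \<le> exp (- c * s)"
    if a: "a \<le> n" for a
  proof (cases "a \<le> s")
    \<comment> \<open>Sizes \<open>a \<le> s\<close> would force \<open>card B > n\<close>, so the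
      second binomial coefficient vanishes.\<close>
    case True
    then have "n choose (n + s + 1 - a) = 0" by (intro binomial_eq_0) auto
    then show ?thesis by (simp only: of_nat_0 mult_zero_left mult_zero_right exp_ge_zero)
  next
    case False
    define b where "b = n + s + 1 - a"
    have ab: "a + b = n + s + 1" "b \<le> n" "s < b" using False a by (auto simp: b_def)
    define m where "m = min a b"
    define M where "M = max a b"
    have mM: "m + M = n + s + 1" "m \<le> M" "s < m" "m \<le> n" "M \<le> n" using ab False a by (auto simp: m_def M_def)
    have m1: "1 \<le> m" using mM by simp
    have 1: "real (n choose a) * real (n choose b) = real (n choose m) * real (n choose M)"
      by (auto simp: m_def M_def min_def max_def)
    have "n choose M = n choose (n - M)" using mM by (intro binomial_symmetric) auto
    then have 2: "real (n choose M) \<le> (exp 1 * n / m) ^ m"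
      using mM by (simp only:) (intro binomial_le_exp_power, auto)
    have 3: "real (n choose m) \<le> (exp 1 * n / m) ^ m"
      using mM by (intro binomial_le_exp_power) auto
    have "real (a * b) - real m = real m * (real M - 1)"
      by (auto simp: m_def M_def min_def max_def algebra_simps)
    also have "\<dots> \<ge> real m * (real n - real m)"
    proof (intro mult_left_mono)
      have "real m + real M = real n + real s + 1" using mM(1) by (metis of_nat_1 of_nat_add)
      then show "real n - real m \<le> real M - 1" by simp
    qed simp
    finally have 4: "exp (- h * (real (a * b) - real m)) \<le> exp (- h * (real n - real m)) ^ m"
      using h by (auto simp: exp_of_nat_mult[symmetric] mult_left_mono mult_ac)
    have "real (n choose m) * real (n choose M) * exp (- h * (real (a * b) - real m))
        \<le> (exp 1 * n / m) ^ m * (exp 1 * n / m) ^ m * exp (- h * (real n - real m)) ^ m"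
      using 2 3 4 by (intro mult_mono) auto
    also have "\<dots> = ((exp 1 * n / m) ^ 2 * exp (- h * (real n - real m))) ^ m"
      by (simp only: power_mult_distrib power2_eq_square)
    also have "\<dots> \<le> exp (- c) ^ m" using H[of m] mM by (intro power_mono) auto
    also have "\<dots> = exp (- c * m)" by (simp add: exp_of_nat_mult[symmetric] mult.commute)
    also have "\<dots> \<le> exp (- c * s)" using c mM by (simp add: mult_left_mono)
    finally show ?thesis using 1 by (simp add: b_def m_def)
  qed
  have "(\<Sum>(A, B)\<in>?S. exp (- h * card (ordered_pairs A B))) = sum ?f ?S"
    by (intro sum.cong) auto
  also have "\<dots> = (\<Sum>a\<in>{..n}. sum ?f {w \<in> ?S. card (fst w) = a})"
    using finS le by (intro sum.group[symmetric]) auto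
  also have "\<dots> \<le> (\<Sum>a\<in>{..n}. exp (- c * s))"
  proof (intro sum_mono)
    fix a assume a: "a \<in> {..n}"
    let ?b = "n + s + 1 - a"
    have eq: "{w \<in> ?S. card (fst w) = a} = {A. A \<subseteq> V \<and> card A = a} \<times> {B. B \<subseteq> V \<and> card B = ?b}"
      using a by auto
    have "sum ?f {w \<in> ?S. card (fst w) = a} \<le> card {w \<in> ?S. card (fst w) = a} *
        exp (- h * (real (a * ?b) - real (min a ?b)))"
    proof (intro sum_bounded_above)
      fix w assume w: "w \<in> {w \<in> ?S. card (fst w) = a}"
      then have "card (fst w) = a" "card (snd w) = ?b" "finite (fst w)" "finite (snd w)"
        using V finite_subset by auto
      then have "a * ?b \<le> card (ordered_pairs (fst w) (snd w)) + min a ?b"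
        using card_ordered_pairs[of "fst w" "snd w"] by simp
      then have "real (a * ?b) \<le> real (card (ordered_pairs (fst w) (snd w)) + min a ?b)"
        by (rule of_nat_mono)
      then show "?f w \<le> exp (- h * (real (a * ?b) - real (min a ?b)))"
        using h by (simp add: mult_left_mono del: of_nat_mult)
    qed
    also have "card {w \<in> ?S. card (fst w) = a} = (n choose a) * (n choose ?b)"
      unfolding eq card_cartesian_product using V by (simp add: n_subsets)
    finally show "sum ?f {w \<in> ?S. card (fst w) = a} \<le> exp (- c * s)"
      using summand[of a] a by simp
  qed
  also have "\<dots> = (real n + 1) * exp (- c * s)" by simp
  finally show ?thesis .
qed

text \<open>A bad pair may be shrunk to \<open>card A + card B = n + s + 1\<close>, which leaves the
  union bound of \<open>sum_exp_ordered_pairs\<close>. The condition on \<open>cap\<close> is part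
  of the event because the greedy bound is valid only while at most \<open>cap\<close> colours are
  used.\<close>

lemma prob_poor_expansion:
  fixes h c :: real
  assumes V: "finite V" "card V = n" and es: "distinct es" "set es = [V]\<^bsup>2\<^esup>" and i: "i < T"
    and r: "r > 0" and q: "0 \<le> q" "q \<le> 1"
    and K: "\<And>K. finite K \<Longrightarrow> card K \<le> cap \<Longrightarrow> Pr (edge_colour_pmf p r) (C - K) \<ge> q" and c: "c \<ge> 0"
    and H: "\<And>m. s < m \<Longrightarrow> m \<le> n \<Longrightarrow> 2 * m \<le> n + s + 1 \<Longrightarrow>
      (exp 1 * n / m) ^ 2 * exp (- (q / (2 * real T)) * (real n - real m)) \<le> exp (- c)"
  shows "expect (labels V T) (\<lambda>lab. Pr (colours V p r)
      {x. card (kept lab T i C es x) \<le> cap \<and>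
          (\<exists>A B. A \<subseteq> V \<and> B \<subseteq> V \<and> card A + card B > n + s \<and>
          (\<forall>u\<in>A. \<forall>v\<in>B. larc lab T i u v \<longrightarrow> {u, v} \<notin> kept lab T i C es x))})
    \<le> (real n + 1) * exp (- c * real s)" (is "expect _ (\<lambda>lab. Pr _ (?poor lab)) \<le> _")
proof -
  let ?S = "{(A, B). A \<subseteq> V \<and> B \<subseteq> V \<and> card A + card B = n + s + 1}"
  let ?bad = "\<lambda>lab w. {x. card (kept lab T i C es x) \<le> cap \<and>
      (\<forall>u\<in>fst w. \<forall>v\<in>snd w. larc lab T i u v \<longrightarrow> {u, v} \<notin> kept lab T i C es x)}"
  have finS: "finite ?S" by (rule finite_subset[of _ "Pow V \<times> Pow V"]) (use V in auto)
  have finl: "finite (set_pmf (labels V T))" using V i by simp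
  have sub: "?poor lab \<subseteq> (\<Union>w\<in>?S. ?bad lab w)" for lab
  proof
    fix x assume "x \<in> ?poor lab"
    then obtain A B where AB: "card (kept lab T i C es x) \<le> cap"
      "A \<subseteq> V" "B \<subseteq> V" "card A + card B > n + s"
      "\<forall>u\<in>A. \<forall>v\<in>B. larc lab T i u v \<longrightarrow> {u, v} \<notin> kept lab T i C es x" by auto
    have "card A \<le> n" using AB V card_mono by metis
    have "n + s + 1 - card A \<le> card B" using AB(4) by linarith
    then obtain B' where B': "B' \<subseteq> B" "card B' = n + s + 1 - card A"
      by (meson obtain_subset_with_card_n)
    then have "(A, B') \<in> ?S" "x \<in> ?bad lab (A, B')" using AB \<open>card A \<le> n\<close> by auto
    then show "x \<in> (\<Union>w\<in>?S. ?bad lab w)" by blast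
  qed
  have "expect (labels V T) (\<lambda>lab. Pr (colours V p r) (?poor lab))
     \<le> expect (labels V T) (\<lambda>lab. \<Sum>w\<in>?S. Pr (colours V p r) (?bad lab w))"
  proof (intro expectation_finite_pmf_mono finl)
    fix lab
    show "Pr (colours V p r) (?poor lab) \<le> (\<Sum>w\<in>?S. Pr (colours V p r) (?bad lab w))"
      by (rule order_trans[OF measure_pmf.finite_measure_mono[OF sub] prob_UN_le[OF finS]]) simp
  qed
  also have "\<dots> = (\<Sum>w\<in>?S. expect (labels V T) (\<lambda>lab. Pr (colours V p r) (?bad lab w)))"
    by (rule expectation_sum_finite_pmf[OF finl])
  also have "\<dots> \<le> (\<Sum>w\<in>?S. exp (- (q / (2 * real T)) * card (ordered_pairs (fst w) (snd w))))"
  proof (intro sum_mono)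
    fix w assume "w \<in> ?S"
    then have "expect (labels V T) (\<lambda>lab. Pr (colours V p r) (?bad lab w))
      \<le> exp (- q / (2 * real T) * card (ordered_pairs (fst w) (snd w)))"
      using V es i r q K by (intro prob_no_larc) auto
    then show "expect (labels V T) (\<lambda>lab. Pr (colours V p r) (?bad lab w))
      \<le> exp (- (q / (2 * real T)) * card (ordered_pairs (fst w) (snd w)))" by simp
  qed
  also have "\<dots> = (\<Sum>(A, B)\<in>?S. exp (- (q / (2 * real T)) * card (ordered_pairs A B)))"
    by (intro sum.cong) auto
  also have "\<dots> \<le> (real n + 1) * exp (- c * real s)"
    using V c H q by (intro sum_exp_ordered_pairs) auto
  finally show ?thesis .
qed

text \<open>Chernoff bound with weight \<open>1 + \<eta>\<close> for all class edges with a colour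
  in \<open>C\<close>, among which are the kept ones. It disposes of the outcomes with more than
  \<open>cap\<close> kept edges, which the expansion bound leaves out.\<close>

lemma prob_large_class:
  fixes \<eta> :: real
  assumes V: "finite V" "card V = n" and es: "set es = [V]\<^bsup>2\<^esup>" and i: "i < T"
    and r: "r > 0" and p: "0 \<le> p" "p \<le> 1" and C: "C \<subseteq> {1..r}" and \<eta>: "0 \<le> \<eta>"
  shows "expect (labels V T) (\<lambda>lab. Pr (colours V p r)
      {x. card (kept lab T i C es x) \<ge> y})
    \<le> exp (\<eta> * n ^ 2 * p * card C / (2 * r * T)) / (1 + \<eta>) ^ y"
proof -
  let ?W = "[V]\<^bsup>2\<^esup>"
  let ?\<kappa> = "edge_colour_pmf p r"
  have finW: "finite ?W" using V by (simp add: finite_imp_finite_nsets)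
  have T: "T > 0" using i by simp
  let ?Z = "\<lambda>lab x. {e \<in> ?W. lab e \<in> {i, T + i} \<and> x e \<in> C}"
  let ?a = "\<eta> * p * card C / r"
  have a: "?a \<ge> 0" using \<eta> p by simp
  have inner: "Pr (colours V p r) {x. card (kept lab T i C es x) \<ge> y}
      \<le> (\<Prod>e\<in>?W. if lab e \<in> {i, T + i} then 1 + ?a else 1) / (1 + \<eta>) ^ y" for lab
  proof -
    have "Pr (colours V p r) {x. card (kept lab T i C es x) \<ge> y}
      \<le> expect (colours V p r) (\<lambda>x. (1 + \<eta>) ^ card (?Z lab x) / (1 + \<eta>) ^ y)"
    proof (intro prob_le_expectation)
      fix x assume "x \<in> {x. card (kept lab T i C es x) \<ge> y}"
      moreover have "card (kept lab T i C es x) \<le> card (?Z lab x)"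
        using greedy_rainbow_subset[of "in_class lab T i" C es x] es finW
        by (intro card_mono) (auto simp: in_class_def)
      ultimately have "(1 + \<eta>) ^ y \<le> (1 + \<eta>) ^ card (?Z lab x)"
        using \<eta> by (intro power_increasing) auto
      then show "1 \<le> (1 + \<eta>) ^ card (?Z lab x) / (1 + \<eta>) ^ y" using \<eta> by simp
    qed (use V r \<eta> in auto)
    also have "\<dots> = expect (colours V p r) (\<lambda>x. (1 + \<eta>) ^ card (?Z lab x)) / (1 + \<eta>) ^ y" by simp
    also have "expect (colours V p r) (\<lambda>x. (1 + \<eta>) ^ card (?Z lab x)) =
        expect (colours V p r) (\<lambda>x. \<Prod>e\<in>?W. if x e \<in> (if lab e \<in> {i, T + i} then C else {}) then 1 + \<eta> else 1)"
    proof (intro arg_cong[where f = "expect (colours V p r)"] ext)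
      fix x
      have "(1 + \<eta>) ^ card (?Z lab x) = (\<Prod>e\<in>?W. if e \<in> ?Z lab x then 1 + \<eta> else 1)"
        using finW by (intro power_card_eq_prod) auto
      also have "\<dots> = (\<Prod>e\<in>?W. if x e \<in> (if lab e \<in> {i, T + i} then C else {}) then 1 + \<eta> else 1)"
        by (intro prod.cong) auto
      finally show "(1 + \<eta>) ^ card (?Z lab x) =
        (\<Prod>e\<in>?W. if x e \<in> (if lab e \<in> {i, T + i} then C else {}) then 1 + \<eta> else 1)" .
    qed
    also have "\<dots> \<le> (\<Prod>e\<in>?W. if lab e \<in> {i, T + i} then 1 + ?a else 1)"
    proof (intro expectation_Pi_pmf_prod_le_prod[where
          g = "\<lambda>e y. if y \<in> (if lab e \<in> {i, T + i} then C else {}) then 1 + \<eta> else 1"] finW)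
      fix e
      show "expect ?\<kappa> (\<lambda>y. if y \<in> (if lab e \<in> {i, T + i} then C else {}) then 1 + \<eta> else 1)
        \<le> (if lab e \<in> {i, T + i} then 1 + ?a else 1)"
        using prob_edge_colour_pmf[OF r p C] r
        by (subst expectation_two_valued) (auto simp: mult.assoc)
    qed (use r \<eta> in auto)
    finally show ?thesis using \<eta> by (simp add: divide_right_mono)
  qed
  have "expect (labels V T) (\<lambda>lab. Pr (colours V p r) {x. card (kept lab T i C es x) \<ge> y})
    \<le> expect (labels V T) (\<lambda>lab. (\<Prod>e\<in>?W. if lab e \<in> {i, T + i} then 1 + ?a else 1) / (1 + \<eta>) ^ y)"
    using V T inner by (intro expectation_finite_pmf_mono) auto
  also have "\<dots> = expect (labels V T) (\<lambda>lab. (\<Prod>e\<in>?W. if lab e \<in> {i, T + i} then 1 + ?a else 1)) / (1 + \<eta>) ^ y"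
    by simp
  also have "expect (labels V T) (\<lambda>lab. (\<Prod>e\<in>?W. if lab e \<in> {i, T + i} then 1 + ?a else 1))
      \<le> exp (\<Sum>e\<in>?W. ?a / T)"
  proof (intro expectation_Pi_pmf_prod_le[where g = "\<lambda>e y. if y \<in> {i, T + i} then 1 + ?a else 1"] finW)
    fix e
    have ne: "{..<2 * T} \<noteq> {}" using T by (auto simp: lessThan_empty_iff)
    then show fin: "finite (set_pmf (pmf_of_set {..<2 * T}))" by (simp add: set_pmf_of_set)
    have "{i, T + i} \<subseteq> {..<2 * T}" using i by auto
    then have "Pr (pmf_of_set {..<2 * T}) {i, T + i} = 1 / T"
      using prob_unif[of "{..<2 * T}" "{i, T + i}"] ne T by (simp add: divide_simps)
    then show "expect (pmf_of_set {..<2 * T}) (\<lambda>y. if y \<in> {i, T + i} then 1 + ?a else 1) \<le> 1 + ?a / T"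
      using expectation_two_valued[OF fin, of "{i, T + i}" "1 + ?a" 1] by simp
  qed (use a in auto)
  also have "(\<Sum>e\<in>?W. ?a / T) = card ?W * (?a / T)" by simp
  also have "\<dots> \<le> (n ^ 2 / 2) * (?a / T)"
    using card_nsets_2_le[OF V(1)] V(2) T p \<eta> by (intro mult_right_mono) auto
  also have "\<dots> = \<eta> * n ^ 2 * p * card C / (2 * r * T)" by (simp add: mult_ac)
  finally show ?thesis using \<eta> by (simp add: divide_right_mono)
qed

section \<open>Tail bounds for the reserved palettes\<close>

lemma prob_few_colours_at_vertex:
  assumes V: "finite V" "card V = n" and es: "distinct es" "set es = [V]\<^bsup>2\<^esup>" and v: "v \<in> V"
    and r: "r > 0" and q: "0 \<le> q" "q \<le> 1" and C: "0 \<notin> C" and finC: "finite C"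
    and K: "\<And>K. finite K \<Longrightarrow> card K \<le> n \<Longrightarrow> Pr (edge_colour_pmf p r) (C - K) \<ge> q"
  shows "Pr (colours V p r) {x. card (x ` {e \<in> [V]\<^bsup>2\<^esup>. x e \<noteq> 0 \<and> v \<in> e} \<inter> C) \<le> y}
    \<le> 2 ^ y * exp (- q / 2 * (real n - 1))"
proof -
  let ?W = "[V]\<^bsup>2\<^esup>"
  \<comment> \<open>The number of distinct colours at \<open>v\<close> is bounded from below by the
    size of a greedy rainbow set among the edges at \<open>v\<close>. This set has at most
    \<open>n - 1\<close> edges, so the cap \<open>n\<close> is never exceeded; the weight
    \<open>z = 1/2\<close> gives the lower tail.\<close>
  let ?G = "greedy_rainbow (\<lambda>e. v \<in> e) C es"
  let ?T = "{e \<in> ?W. v \<in> e}"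
  have finW: "finite ?W" using V by (simp add: finite_imp_finite_nsets)
  have "?T = (\<lambda>u. {v, u}) ` (V - {v})" using v by (auto simp: nsets_2_eq)
  moreover have "inj_on (\<lambda>u. {v, u}) (V - {v})" by (auto simp: inj_on_def doubleton_eq_iff)
  ultimately have cT: "card ?T = n - 1" using V v by (simp add: card_image)
  have n: "n \<ge> 1" using V v by (metis One_nat_def Suc_leI card_gt_0_iff empty_iff)
  have Gsub: "?G x \<subseteq> ?T" "x ` ?G x \<subseteq> x ` {e \<in> ?W. x e \<noteq> 0 \<and> v \<in> e} \<inter> C" for x
  proof -
    have "?G x \<subseteq> {e \<in> ?W. v \<in> e \<and> x e \<in> C}"
      using greedy_rainbow_subset[of "\<lambda>e. v \<in> e" C es x] es by simp
    moreover have "{e \<in> ?W. v \<in> e \<and> x e \<in> C} \<subseteq> {e \<in> ?W. x e \<noteq> 0 \<and> v \<in> e}"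
      using C by (intro subsetI) (metis (mono_tags, lifting) mem_Collect_eq)
    ultimately have "?G x \<subseteq> {e \<in> ?W. x e \<noteq> 0 \<and> v \<in> e}" "x ` ?G x \<subseteq> C" "?G x \<subseteq> ?T"
      by blast+
    then show "?G x \<subseteq> ?T" "x ` ?G x \<subseteq> x ` {e \<in> ?W. x e \<noteq> 0 \<and> v \<in> e} \<inter> C" by blast+
  qed
  have cG: "card (?G x) \<le> n" for x
    using card_mono[OF _ Gsub(1)[of x]] finW cT by simp
  have "Pr (colours V p r) {x. card (x ` {e \<in> ?W. x e \<noteq> 0 \<and> v \<in> e} \<inter> C) \<le> y}
    \<le> expect (colours V p r) (\<lambda>x. 2 ^ y * ((1/2) ^ card (?G x \<inter> ?T) * of_bool (card (?G x) \<le> n)))"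
  proof (intro prob_le_expectation)
    fix x assume x: "x \<in> {x. card (x ` {e \<in> ?W. x e \<noteq> 0 \<and> v \<in> e} \<inter> C) \<le> y}"
    have "card (?G x) = card (x ` ?G x)" by (intro card_image[symmetric] inj_on_greedy_rainbow)
    also have "\<dots> \<le> card (x ` {e \<in> ?W. x e \<noteq> 0 \<and> v \<in> e} \<inter> C)"
      using finC Gsub(2) by (intro card_mono) auto
    also have "\<dots> \<le> y" using x by simp
    finally have "(1/2::real) ^ y \<le> (1/2) ^ card (?G x)" by (intro power_decreasing) auto
    moreover have "?G x \<inter> ?T = ?G x" using Gsub(1)[of x] by auto
    ultimately have "2 ^ y * (1/2::real) ^ y \<le> 2 ^ y * ((1/2) ^ card (?G x \<inter> ?T))"
      by (intro mult_left_mono) auto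
    then show "1 \<le> 2 ^ y * ((1/2::real) ^ card (?G x \<inter> ?T) * of_bool (card (?G x) \<le> n))"
      using cG[of x] by (simp add: power_one_over)
  qed (use V r in auto)
  also have "\<dots> = 2 ^ y * expect (colours V p r) (\<lambda>x. (1/2) ^ card (?G x \<inter> ?T) * of_bool (card (?G x) \<le> n))"
    by simp
  also have "\<dots> \<le> 2 ^ y * (1 - (1 - 1/2) * q) ^ card ?T"
    unfolding es(2)[symmetric] using es q r K
    by (intro mult_left_mono greedy_rainbow_tail) auto
  also have "\<dots> \<le> 2 ^ y * exp (- q / 2) ^ (n - 1)"
    unfolding cT using q exp_ge_add_one_self[of "- q / 2"]
    by (intro mult_left_mono power_mono) auto
  also have "exp (- q / 2) ^ (n - 1) = exp (- q / 2 * (real n - 1))"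
    using n by (simp add: exp_of_nat_mult[symmetric] of_nat_diff mult.commute)
  finally show ?thesis .
qed

text \<open>Each counted edge has weight \<open>1/2\<close>, at the cost of \<open>2 ^ y\<close>. In
  the denominator \<open>4 * r\<close>, one factor 2 is due to this weight, the other to edges that
  arise from two ordered pairs.\<close>

lemma prob_few_edges_between:
  assumes V: "finite V" "S \<subseteq> V" "T \<subseteq> V"
    and r: "r > 0" and p: "0 \<le> p" "p \<le> 1" and C: "C \<subseteq> {1..r}"
  shows "Pr (colours V p r) {x. card {e \<in> [V]\<^bsup>2\<^esup>. x e \<noteq> 0 \<and> x e \<in> C \<and> (\<exists>u\<in>S. \<exists>w\<in>T. e = {u, w})} \<le> y}
    \<le> 2 ^ y * exp (- p * card C / (4 * r) * card (ordered_pairs S T))"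
proof -
  let ?W = "[V]\<^bsup>2\<^esup>"
  let ?X = "{e \<in> ?W. \<exists>u\<in>S. \<exists>w\<in>T. e = {u, w}}"
  let ?Z = "\<lambda>x. {e \<in> ?W. x e \<noteq> 0 \<and> x e \<in> C \<and> (\<exists>u\<in>S. \<exists>w\<in>T. e = {u, w})}"
  let ?a = "p * card C / r"
  have finW: "finite ?W" using V by (simp add: finite_imp_finite_nsets)
  have C0: "0 \<notin> C" using C by auto
  have "Pr (colours V p r) {x. card (?Z x) \<le> y} \<le> expect (colours V p r) (\<lambda>x. 2 ^ y * (1/2) ^ card (?Z x))"
  proof (intro prob_le_expectation)
    fix x assume "x \<in> {x. card (?Z x) \<le> y}"
    then have "(1/2::real) ^ y \<le> (1/2) ^ card (?Z x)" by (intro power_decreasing) auto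
    then have "2 ^ y * (1/2::real) ^ y \<le> 2 ^ y * (1/2) ^ card (?Z x)" by (intro mult_left_mono) auto
    then show "1 \<le> 2 ^ y * (1/2::real) ^ card (?Z x)" by (simp add: power_one_over)
  qed (use V r in auto)
  also have "\<dots> = 2 ^ y * expect (colours V p r) (\<lambda>x. (1/2) ^ card (?Z x))" by simp
  also have "expect (colours V p r) (\<lambda>x. (1/2) ^ card (?Z x)) =
    expect (colours V p r) (\<lambda>x. \<Prod>e\<in>?W. if x e \<in> (if e \<in> ?X then C else {}) then 1/2 else 1 :: real)"
  proof (intro arg_cong[where f = "expect (colours V p r)"] ext)
    fix x
    have "(1/2::real) ^ card (?Z x) = (\<Prod>e\<in>?W. if e \<in> ?Z x then 1/2 else 1)"
      using finW by (intro power_card_eq_prod) auto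
    also have "\<dots> = (\<Prod>e\<in>?W. if x e \<in> (if e \<in> ?X then C else {}) then 1/2 else 1)"
    proof (intro prod.cong refl if_cong)
      fix e assume "e \<in> ?W"
      moreover have "x e \<noteq> 0" if "x e \<in> C" using that C0 by metis
      ultimately show "e \<in> ?Z x \<longleftrightarrow> x e \<in> (if e \<in> ?X then C else {})"
        by (simp del: neq0_conv) blast
    qed
    finally show "(1/2::real) ^ card (?Z x) =
      (\<Prod>e\<in>?W. if x e \<in> (if e \<in> ?X then C else {}) then 1/2 else 1)" .
  qed
  also have "\<dots> \<le> exp (\<Sum>e\<in>?W. if e \<in> ?X then - ?a / 2 else 0)"
  proof (intro expectation_Pi_pmf_prod_le[where
        g = "\<lambda>e y. if y \<in> (if e \<in> ?X then C else {}) then 1/2 else 1"] finW)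
    fix e
    show "expect (edge_colour_pmf p r) (\<lambda>y. if y \<in> (if e \<in> ?X then C else {}) then 1/2 else 1)
      \<le> 1 + (if e \<in> ?X then - ?a / 2 else 0)"
      using prob_edge_colour_pmf[OF r p C] r by (subst expectation_two_valued) auto
  qed (use r in auto)
  also have "(\<Sum>e\<in>?W. if e \<in> ?X then - ?a / 2 else 0) = - ?a / 2 * card ?X"
    using finW by (subst sum.inter_filter[symmetric]) auto
  also have "exp (- ?a / 2 * card ?X) \<le> exp (- p * card C / (4 * r) * card (ordered_pairs S T))"
  proof -
    have fin: "finite S" "finite T" using V finite_subset by auto
    let ?f = "\<lambda>(u, w). ({u, w}, u < (w :: nat))"
    have "inj_on ?f (ordered_pairs S T)"
      by (auto simp: inj_on_def ordered_pairs_def doubleton_eq_iff)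
    moreover have "?f ` ordered_pairs S T \<subseteq> ?X \<times> UNIV"
      using V by (auto simp: ordered_pairs_def) 
    moreover have "finite (?X \<times> (UNIV :: bool set))" using finW by auto
    ultimately have "card (ordered_pairs S T) \<le> card (?X \<times> (UNIV :: bool set))" by (rule card_inj_on_le)
    then have "card (ordered_pairs S T) \<le> card ?X * 2" by (simp add: card_cartesian_product)
    then have "real (card (ordered_pairs S T)) \<le> real (card ?X * 2)" by (rule of_nat_mono)
    then have "?a / 4 * real (card (ordered_pairs S T)) \<le> ?a / 4 * (real (card ?X) * 2)"
      using p by (intro mult_left_mono) auto
    then show ?thesis by simp
  qed
  finally show ?thesis by (simp add: mult_left_mono)
qed

text \<open>The base \<open>z\<close> stays free because \<open>r\<close> has no upper bound: it is
  later proportional to \<open>r / n\<close>, so that \<open>z ^ y\<close> also pays for the union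
  bound over \<open>r\<close> colours.\<close>

lemma prob_large_colour_class:
  fixes z :: real
  assumes V: "finite V" "card V = n" and r: "r > 0" and p: "0 \<le> p" "p \<le> 1" and c: "c \<in> {1..r}" and z: "z \<ge> 1"
  shows "Pr (colours V p r) {x. card {e \<in> [V]\<^bsup>2\<^esup>. x e \<noteq> 0 \<and> x e = c} \<ge> y}
    \<le> exp (z * p * n ^ 2 / (2 * r)) / z ^ y"
proof -
  let ?W = "[V]\<^bsup>2\<^esup>"
  let ?Z = "\<lambda>x. {e \<in> ?W. x e \<noteq> 0 \<and> x e = c}"
  have finW: "finite ?W" using V by (simp add: finite_imp_finite_nsets)
  have "Pr (colours V p r) {x. card (?Z x) \<ge> y} \<le> expect (colours V p r) (\<lambda>x. z ^ card (?Z x) / z ^ y)"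
  proof (intro prob_le_expectation)
    fix x assume "x \<in> {x. card (?Z x) \<ge> y}"
    then have "z ^ y \<le> z ^ card (?Z x)" using z by (intro power_increasing) auto
    then show "1 \<le> z ^ card (?Z x) / z ^ y" using z by simp
  qed (use V r z in auto)
  also have "\<dots> = expect (colours V p r) (\<lambda>x. z ^ card (?Z x)) / z ^ y" by simp
  also have "expect (colours V p r) (\<lambda>x. z ^ card (?Z x)) =
    expect (colours V p r) (\<lambda>x. \<Prod>e\<in>?W. if x e \<in> {c} then z else 1)"
  proof (intro arg_cong[where f = "expect (colours V p r)"] ext)
    fix x
    have "z ^ card (?Z x) = (\<Prod>e\<in>?W. if e \<in> ?Z x then z else 1)"
      using finW by (intro power_card_eq_prod) auto
    also have "\<dots> = (\<Prod>e\<in>?W. if x e \<in> {c} then z else 1)"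
      using c by (intro prod.cong) auto
    finally show "z ^ card (?Z x) = (\<Prod>e\<in>?W. if x e \<in> {c} then z else 1)" .
  qed
  also have "\<dots> \<le> exp (\<Sum>e\<in>?W. z * p / r)"
  proof (intro expectation_Pi_pmf_prod_le[where g = "\<lambda>e y. if y \<in> {c} then z else 1"] finW)
    fix e
    have "expect (edge_colour_pmf p r) (\<lambda>y. if y \<in> {c} then z else 1) = 1 + (z - 1) * (p * card {c} / r)"
      using prob_edge_colour_pmf[OF r p, of "{c}"] c r by (subst expectation_two_valued) auto
    also have "\<dots> \<le> 1 + z * p / r"
      using p by (auto simp: algebra_simps divide_right_mono)
    finally show "expect (edge_colour_pmf p r) (\<lambda>y. if y \<in> {c} then z else 1) \<le> 1 + z * p / r" .
  qed (use r z in auto)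
  also have "(\<Sum>e\<in>?W. z * p / r) = card ?W * (z * p / r)" by simp
  also have "\<dots> \<le> (n ^ 2 / 2) * (z * p / r)"
    using card_nsets_2_le[OF V(1)] V(2) p z by (intro mult_right_mono) auto
  also have "\<dots> = z * p * n ^ 2 / (2 * r)" by (simp add: mult_ac)
  finally show ?thesis using z by (simp add: divide_right_mono)
qed

section \<open>Short directed cycles inside a class\<close>

lemma inj_on_cycle_edge:
  assumes "distinct xs" "length xs \<ge> 3"
  shows "inj_on (\<lambda>j. {xs ! j, xs ! (Suc j mod length xs)}) {..<length xs}"
proof (rule inj_onI)
  let ?n = "length xs"
  fix j k assume jk: "j \<in> {..<?n}" "k \<in> {..<?n}"
    "{xs ! j, xs ! (Suc j mod ?n)} = {xs ! k, xs ! (Suc k mod ?n)}"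
  have lt: "Suc j mod ?n < ?n" "Suc k mod ?n < ?n" using assms by (auto intro!: mod_less_divisor)
  have eq: "a = b" if "a < ?n" "b < ?n" "xs ! a = xs ! b" for a b
    using that assms(1) nth_eq_iff_index_eq by blast
  from jk(3) consider "xs ! j = xs ! k" | "xs ! j = xs ! (Suc k mod ?n)" "xs ! (Suc j mod ?n) = xs ! k"
    by (auto simp: doubleton_eq_iff)
  then show "j = k"
  proof cases
    case 1 then show ?thesis using eq jk by auto
  next
    case 2
    then have "j = Suc k mod ?n" "Suc j mod ?n = k" using eq jk lt by auto
    then show ?thesis using jk assms(2) by (auto simp: mod_Suc split: if_splits)
  qed
qed

abbreviation closes :: "(nat set \<Rightarrow> nat) \<Rightarrow> nat \<Rightarrow> nat \<Rightarrow> nat list \<Rightarrow> bool" where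
  "closes lab T i xs \<equiv> successively (larc lab T i) xs \<and> larc lab T i (last xs) (hd xs)"

text \<open>With at least three vertices the cyclically consecutive pairs are distinct, so their
  labels are independent. Each must be the one label of class \<open>i\<close> with the right
  orientation, out of \<open>2 * T\<close> labels.\<close>

lemma prob_closed_walk:
  assumes V: "finite V" and xs: "distinct xs" "set xs \<subseteq> V" "3 \<le> length xs" and i: "i < T"
  shows "Pr (labels V T) {lab. closes lab T i xs}
    \<le> (1 / (2 * real T)) ^ length xs"
proof -
  let ?W = "[V]\<^bsup>2\<^esup>" and ?n = "length xs"
  let ?e = "\<lambda>j. {xs ! j, xs ! (Suc j mod ?n)}"
  let ?g = "\<lambda>j. if xs ! j < xs ! (Suc j mod ?n) then i else T + i"
  define B where "B e = (if e \<in> ?e ` {..<?n} then ?g ` {j. j < ?n \<and> e = ?e j} else UNIV)" for e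
  have finW: "finite ?W" using V by (simp add: finite_imp_finite_nsets)
  have inj: "inj_on ?e {..<?n}" using inj_on_cycle_edge[OF xs(1,3)] .
  have T: "T > 0" and ne: "{..<2 * T} \<noteq> {}" using i by (auto simp: lessThan_empty_iff)
  have lt: "Suc j mod ?n < ?n" for j using xs(3) by (auto intro!: mod_less_divisor)
  have sub: "?e ` {..<?n} \<subseteq> ?W"
  proof
    fix e assume "e \<in> ?e ` {..<?n}"
    then obtain j where j: "j < ?n" "e = ?e j" by auto
    have "j \<noteq> Suc j mod ?n" using j xs(3) by (auto simp: mod_Suc)
    then have "xs ! j \<noteq> xs ! (Suc j mod ?n)" using j lt xs(1) nth_eq_iff_index_eq by blast
    then show "e \<in> ?W" using j lt[of j] xs(2) nth_mem by fastforce
  qed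
  have "{lab. closes lab T i xs} \<subseteq> Pi ?W B"
  proof (intro subsetI Pi_I)
    fix lab e assume "lab \<in> {lab. closes lab T i xs}"
    then have lab: "successively (larc lab T i) xs" "larc lab T i (last xs) (hd xs)" by auto
    have g: "lab (?e j) = ?g j" if j: "j < ?n" for j
    proof (cases "Suc j < ?n")
      case True
      then show ?thesis using successively_nth[OF lab(1) True] by (simp add: larc_def)
    next
      case False
      then have "Suc j = ?n" using j by simp
      moreover from this have "xs \<noteq> []" "j = ?n - 1" by auto
      ultimately show ?thesis using lab(2) by (simp add: larc_def last_conv_nth hd_conv_nth)
    qed
    show "lab e \<in> B e"
    proof (cases "e \<in> ?e ` {..<?n}")
      case True
      then obtain j where j: "j < ?n" "e = ?e j" by auto
      then have "lab e \<in> ?g ` {j. j < ?n \<and> e = ?e j}" using g by blast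
      then show ?thesis using True unfolding B_def by presburger
    qed (simp add: B_def)
  qed
  then have "Pr (labels V T) {lab. closes lab T i xs}
      \<le> Pr (labels V T) (Pi ?W B)" by (intro measure_pmf.finite_measure_mono) auto
  also have "\<dots> = (\<Prod>e\<in>?W. Pr (pmf_of_set {..<2 * T}) (B e))"
    using finW by (rule measure_Pi_pmf_Pi)
  also have "\<dots> \<le> (\<Prod>e\<in>?W. if e \<in> ?e ` {..<?n} then 1 / (2 * real T) else 1)"
  proof (intro prod_mono conjI)
    fix e
    show "Pr (pmf_of_set {..<2 * T}) (B e) \<le> (if e \<in> ?e ` {..<?n} then 1 / (2 * real T) else 1)"
    proof (cases "e \<in> ?e ` {..<?n}")
      case True
      then obtain j where "j < ?n" "e = ?e j" by auto
      then have "{k. k < ?n \<and> e = ?e k} = {j}" using inj by (auto simp: inj_on_def)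
      then have Be: "B e = {?g j}" using True by (simp add: B_def)
      have "?g j < 2 * T" using i by auto
      then have "Pr (pmf_of_set {..<2 * T}) {?g j} = 1 / (2 * real T)"
        using prob_unif[of "{..<2 * T}" "{?g j}"] ne by auto
      then show ?thesis using True Be by simp
    qed auto
  qed auto
  also have "\<dots> = (1 / (2 * real T)) ^ card (?e ` {..<?n})"
    using power_card_eq_prod[OF finW sub, of "1 / (2 * real T)"] by simp
  also have "card (?e ` {..<?n}) = ?n" using inj by (simp add: card_image)
  finally show ?thesis .
qed

text \<open>At most \<open>n ^ s\<close> lists of length \<open>s\<close> occur, each closing with
  probability at most \<open>(1 / (2 * T)) ^ s\<close>. As \<open>T\<close> will be linear in
  \<open>n\<close>, the ratio \<open>n / (2 * T)\<close> has a constant bound \<open>D\<close>, and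
  the expectation is bounded independently of \<open>n\<close>.\<close>

lemma expectation_closed_walks:
  assumes V: "finite V" "card V = n" and i: "i < T" and D: "D \<ge> 1" "real n / (2 * T) \<le> D"
  shows "expect (labels V T) (\<lambda>lab. real (card (closed_walks (larc lab T i) V l))) \<le> (real l + 1) * D ^ l"
proof -
  let ?L = "{xs. distinct xs \<and> set xs \<subseteq> V \<and> 3 \<le> length xs \<and> length xs \<le> l}"
  let ?A = "\<lambda>s. {xs. set xs \<subseteq> V \<and> length xs = s}"
  let ?w = "\<lambda>xs. (1 / (2 * real T)) ^ length (xs :: nat list)"
  have T: "T > 0" using i by simp
  have finA: "finite (?A s)" for s using finite_lists_length_eq[OF V(1)] .
  have finL: "finite ?L"
    by (rule finite_subset[OF _ finite_lists_length_le[OF V(1), of l]]) auto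
  have finl: "finite (set_pmf (labels V T))" using V i by simp
  have "real (card (closed_walks (larc lab T i) V l)) =
      (\<Sum>xs\<in>?L. of_bool (lab \<in> {lab. closes lab T i xs}))" for lab
  proof -
    have "closed_walks (larc lab T i) V l =
      {xs \<in> ?L. closes lab T i xs}"
      by (auto simp: closed_walks_def)
    then show ?thesis using finL by (simp add: of_bool_def sum.If_cases Collect_conj_eq Int_assoc)
  qed
  then have "expect (labels V T) (\<lambda>lab. real (card (closed_walks (larc lab T i) V l))) =
    expect (labels V T) (\<lambda>lab. \<Sum>xs\<in>?L. of_bool (lab \<in> {lab. closes lab T i xs}))"
    by simp
  also have "\<dots> = (\<Sum>xs\<in>?L. Pr (labels V T) {lab. closes lab T i xs})"
    unfolding expectation_sum_finite_pmf[OF finl] prob_finite_pmf[OF finl, symmetric] ..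
  also have "\<dots> \<le> (\<Sum>xs\<in>?L. ?w xs)"
    using V i by (intro sum_mono prob_closed_walk) auto
  also have "\<dots> \<le> (\<Sum>xs\<in>(\<Union>s\<in>{..l}. ?A s). ?w xs)"
    using finA by (intro sum_mono2) auto
  also have "\<dots> = (\<Sum>s\<in>{..l}. \<Sum>xs\<in>?A s. ?w xs)"
    using finA by (intro sum.UNION_disjoint) auto
  also have "\<dots> = (\<Sum>s\<in>{..l}. (real n / (2 * T)) ^ s)"
  proof (intro sum.cong refl)
    fix s
    have "(\<Sum>xs\<in>?A s. ?w xs) = card (?A s) * (1 / (2 * real T)) ^ s" by simp
    also have "card (?A s) = n ^ s" using card_lists_length_eq[OF V(1)] V(2) by simp
    finally show "(\<Sum>xs\<in>?A s. ?w xs) = (real n / (2 * T)) ^ s" by (simp add: power_divide)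
  qed
  also have "\<dots> \<le> (\<Sum>s\<in>{..l}. D ^ l)"
  proof (intro sum_mono)
    fix s assume "s \<in> {..l}"
    have "(real n / (2 * T)) ^ s \<le> D ^ s" using D by (intro power_mono) auto
    also have "\<dots> \<le> D ^ l" using D \<open>s \<in> {..l}\<close> by (intro power_increasing) auto
    finally show "(real n / (2 * T)) ^ s \<le> D ^ l" .
  qed
  finally show ?thesis by (simp add: add.commute)
qed

section \<open>From typical outcomes to the packing\<close>

abbreviation packed :: "nat \<Rightarrow> real \<Rightarrow> nat set set \<times> (nat set \<Rightarrow> nat) \<Rightarrow> bool" where
  "packed \<equiv> has_disjoint_rainbow_hamilton_cycles"

text \<open>The deterministic core, for fixed labels and colours. \<open>C'\<close> is the main
  palette of the kept edges; \<open>A\<close>, \<open>B\<close>, \<open>C\<close> are the reserves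
  for the repairs. All classes expand, but only \<open>t\<close> of them have to have few short
  cycles. \<open>k\<close> has one summand for each kind of chain in
  \<open>few_breaks_ordering\<close>.\<close>

lemma disjoint_rainbow_hamilton_cycles_if_robust:
  fixes x :: "nat set \<Rightarrow> nat"
  assumes n: "n \<ge> 3" and V: "V = {1..n}" and es: "set es = [V]\<^bsup>2\<^esup>" and q: "q > 0"
    and A: "0 \<notin> A" "0 \<notin> B" "0 \<notin> C" "0 \<notin> C'"
    and disj: "A \<inter> B = {}" "A \<inter> C = {}" "B \<inter> C = {}" "C' \<inter> (A \<union> B \<union> C) = {}"
    and I: "t \<le> card {i. i < T \<and> card (closed_walks (larc lab T i) V l) \<le> z}"
    and k: "k = s + n div Suc l + z"
    and ex: "\<And>i A B. i < T \<Longrightarrow> A \<subseteq> V \<Longrightarrow> B \<subseteq> V \<Longrightarrow> card A + card B > n + s \<Longrightarrow>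
      \<exists>u\<in>A. \<exists>v\<in>B. larc lab T i u v \<and> {u, v} \<in> kept lab T i C' es x"
    and a: "\<And>v. v \<in> V \<Longrightarrow> card (x ` {e \<in> [V]\<^bsup>2\<^esup>. x e \<noteq> 0 \<and> v \<in> e} \<inter> A) \<ge> 2 * t + k + 2 * q + 1"
    and b: "\<And>v. v \<in> V \<Longrightarrow> card (x ` {e \<in> [V]\<^bsup>2\<^esup>. x e \<noteq> 0 \<and> v \<in> e} \<inter> B) \<ge> 2 * t + k + 2 * q + 1"
    and cl: "\<And>S U. S \<subseteq> V \<Longrightarrow> U \<subseteq> V \<Longrightarrow> card S \<ge> q \<Longrightarrow> card U \<ge> q \<Longrightarrow>
      card {e \<in> [V]\<^bsup>2\<^esup>. x e \<noteq> 0 \<and> x e \<in> C \<and> (\<exists>u\<in>S. \<exists>w\<in>U. e = {u, w})} > t * k + k * m"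
    and mult: "\<And>c. c \<in> C \<Longrightarrow> card {e \<in> [V]\<^bsup>2\<^esup>. x e \<noteq> 0 \<and> x e = c} \<le> m"
  shows "packed n (real t) ({e \<in> [V]\<^bsup>2\<^esup>. x e \<noteq> 0}, x)"
proof -
  let ?F = "{e \<in> [V]\<^bsup>2\<^esup>. x e \<noteq> 0}"
  let ?I = "{i. i < T \<and> card (closed_walks (larc lab T i) V l) \<le> z}"
  let ?G = "\<lambda>i. kept lab T i C' es x"
  have finV: "finite V" and cV: "card V = n" and neV: "V \<noteq> {}" using V n by auto
  have G: "?G i \<subseteq> {e \<in> [V]\<^bsup>2\<^esup>. in_class lab T i e \<and> x e \<in> C'}" for i
    using greedy_rainbow_subset[of "in_class lab T i" C' es x] es by simp
  have nz: "x e \<noteq> 0" if "x e \<in> C'" for e using that A(4) by metis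
  have "\<exists>vs. distinct vs \<and> set vs = V \<and> cyclic_breaks (?G i) vs \<le> k" if i: "i \<in> ?I" for i
  proof -
    let ?R = "\<lambda>u v. larc lab T i u v \<and> {u, v} \<in> ?G i"
    have iT: "i < T" using i by simp
    have "card (closed_walks ?R V l) \<le> card (closed_walks (larc lab T i) V l)"
      by (intro card_mono finite_closed_walks finV closed_walks_mono) auto
    also have "\<dots> \<le> z" using i by simp
    finally have "\<exists>vs. distinct vs \<and> set vs = V \<and> cyclic_breaks (?G i) vs \<le> s + card V div Suc l + z"
    proof (intro few_breaks_ordering[OF finV neV, of ?R])
      show "\<exists>u\<in>A. \<exists>v\<in>B. ?R u v" if "A \<subseteq> V" "B \<subseteq> V" "card V + s < card A + card B" for A B
        using ex[OF iT that(1,2)] that(3) cV by simp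
      show "\<not> ?R v u" if "?R u v" for u v using larc_asym[OF iT] that by blast
    qed auto
    then show ?thesis by (simp add: k cV)
  qed
  then have "\<exists>vs. \<forall>i\<in>?I. distinct (vs i) \<and> set (vs i) = V \<and> cyclic_breaks (?G i) (vs i) \<le> k"
    by (intro bchoice ballI)
  then obtain vs where vs: "\<forall>i\<in>?I. distinct (vs i) \<and> set (vs i) = V \<and> cyclic_breaks (?G i) (vs i) \<le> k"
    by (elim exE)
  have "\<exists>\<C>. finite \<C> \<and> card \<C> = t \<and> pairwise disjnt \<C> \<and>
    (\<forall>H\<in>\<C>. H \<subseteq> ?F \<and> inj_on x H \<and> (\<exists>vs. distinct vs \<and> set vs = V \<and> H = cycle_edges vs))"
  proof (rule rainbow_cycle_packing[where A = A and B = B and C = C and I = ?I and M = ?G and vs = vs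
        and q = q and k = k and m = m])
    show "?G i \<subseteq> ?F \<and> inj_on x (?G i) \<and> x ` ?G i \<inter> (A \<union> B \<union> C) = {}" for i
    proof (intro conjI inj_on_greedy_rainbow)
      show "?G i \<subseteq> ?F" using G[of i] nz by blast
      have "x ` ?G i \<subseteq> C'" using G[of i] by blast
      then show "x ` ?G i \<inter> (A \<union> B \<union> C) = {}" using disj(4) by blast
    qed
    show "?G i \<inter> ?G j = {}" if "i \<in> ?I" "j \<in> ?I" "i \<noteq> j" for i j
    proof -
      have False if e: "e \<in> ?G i" "e \<in> ?G j" for e
      proof -
        have "in_class lab T i e" "in_class lab T j e" using e G by blast+
        then show False using \<open>i \<in> ?I\<close> \<open>j \<in> ?I\<close> \<open>i \<noteq> j\<close> by (auto simp: in_class_def)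
      qed
      then show ?thesis by blast
    qed
    show "2 * t + k + 2 * q + 1 \<le> card (x ` {e \<in> ?F. v \<in> e} \<inter> A)" if "v \<in> V" for v
      using a[OF that] by (simp add: conj_assoc)
    show "2 * t + k + 2 * q + 1 \<le> card (x ` {e \<in> ?F. v \<in> e} \<inter> B)" if "v \<in> V" for v
      using b[OF that] by (simp add: conj_assoc)
    show "t * k + k * m < card {e \<in> ?F. x e \<in> C \<and> (\<exists>u\<in>S. \<exists>w\<in>U. e = {u, w})}"
      if "S \<subseteq> V" "U \<subseteq> V" "q \<le> card S" "q \<le> card U" for S U
      using cl[OF that] by (simp add: conj_assoc)
    show "card {e \<in> ?F. x e = c} \<le> m" if "c \<in> C" for c
      using mult[OF that] by (simp add: conj_assoc)
  qed (use finV neV q disj I vs in auto)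
  then obtain \<C> where C: "finite \<C> \<and> card \<C> = t \<and> pairwise disjnt \<C> \<and>
    (\<forall>H\<in>\<C>. H \<subseteq> ?F \<and> inj_on x H \<and> (\<exists>vs. distinct vs \<and> set vs = V \<and> H = cycle_edges vs))"
    by (elim exE)
  then have H: "H \<subseteq> ?F \<and> inj_on x H \<and> (\<exists>vs. distinct vs \<and> set vs = V \<and> H = cycle_edges vs)"
    if "H \<in> \<C>" for H using that by simp
  have "hamilton_cycle n ?F H \<and> rainbow x H" if "H \<in> \<C>" for H
    using H[OF that] n V unfolding hamilton_cycle_def rainbow_def by blast
  then show ?thesis using C unfolding has_disjoint_rainbow_hamilton_cycles_def prod.case
    by (intro exI[of _ \<C>]) simp
qed

lemma prob_Un_le: "Pr p (A \<union> B) \<le> Pr p A + Pr p B"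
  by (rule measure_Un_le) auto

lemma exists_below_expectation:
  fixes f :: "'a \<Rightarrow> real"
  assumes "finite (set_pmf p)" "expect p f < a"
  shows "\<exists>x. f x < a"
proof (rule ccontr)
  assume "\<not> ?thesis"
  then have "expect p (\<lambda>_. a) \<le> expect p f" using assms(1) by (intro expectation_finite_pmf_mono) (auto simp: not_less)
  then show False using assms(2) by simp
qed

text \<open>A labelling is fixed before the colours are exposed. It must meet two demands at once:
  \<open>\<Psi>\<close>, the total conditional probability that a class expands poorly or grows too
  large, and \<open>N\<close>, the total number of short cycles, are both small. What remains is a
  union bound over colours alone: two palettes at \<open>n\<close> vertices, at most
  \<open>4 ^ n\<close> pairs of sets, and \<open>r\<close> colour classes.\<close>

lemma prob_not_hamilton:
  fixes c \<eta> \<zeta> D p q1 q3 :: real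
  assumes n: "n \<ge> 3" and V: "V = {1..n}" and T: "2 * t \<le> T" "T > 0" and r: "r > 0"
    and p: "0 \<le> p" "p \<le> 1"
    and sub: "A \<subseteq> {1..r}" "B \<subseteq> {1..r}" "C \<subseteq> {1..r}" "C' \<subseteq> {1..r}"
    and disj: "A \<inter> B = {}" "A \<inter> C = {}" "B \<inter> C = {}" "C' \<inter> (A \<union> B \<union> C) = {}"
    and D: "D \<ge> 1" "real n / (2 * T) \<le> D" "8 * ((real l + 1) * D ^ l) \<le> real z + 1"
    and k: "k = s + n div Suc l + z" and q: "q > 0"
    and q1: "0 \<le> q1" "q1 \<le> 1"
      "\<And>K. finite K \<Longrightarrow> card K \<le> cap \<Longrightarrow> Pr (edge_colour_pmf p r) (C' - K) \<ge> q1"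
    and c: "c \<ge> 0" "\<And>m. s < m \<Longrightarrow> m \<le> n \<Longrightarrow> 2 * m \<le> n + s + 1 \<Longrightarrow>
      (exp 1 * n / m) ^ 2 * exp (- (q1 / (2 * real T)) * (real n - real m)) \<le> exp (- c)"
    and q3: "0 \<le> q3" "q3 \<le> 1"
      "\<And>K. finite K \<Longrightarrow> card K \<le> n \<Longrightarrow> Pr (edge_colour_pmf p r) (A - K) \<ge> q3"
      "\<And>K. finite K \<Longrightarrow> card K \<le> n \<Longrightarrow> Pr (edge_colour_pmf p r) (B - K) \<ge> q3"
    and y3: "2 * t + k + 2 * q \<le> y3" and y4: "t * k + k * m \<le> y4" and \<eta>: "0 \<le> \<eta>" and \<zeta>: "1 \<le> \<zeta>"
  shows "Pr (colours V p r)
      {x. \<not> packed n (real t) ({e \<in> [V]\<^bsup>2\<^esup>. x e \<noteq> 0}, x)}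
    \<le> 4 * real T * ((real n + 1) * exp (- c * real s) +
        exp (\<eta> * n ^ 2 * p * card C' / (2 * r * T)) / (1 + \<eta>) ^ Suc cap)
      + 2 * real n * (2 ^ y3 * exp (- q3 / 2 * (real n - 1)))
      + 4 ^ n * (2 ^ y4 * exp (- p * card C / (4 * r) * (real q * (real q - 1))))
      + real r * (exp (\<zeta> * p * n ^ 2 / (2 * r)) / \<zeta> ^ Suc m)"
proof -
  let ?W = "[V]\<^bsup>2\<^esup>"
  have finV: "finite V" and cV: "card V = n" using V by auto
  have finW: "finite ?W" using finV by (simp add: finite_imp_finite_nsets)
  obtain es where es: "distinct es" "set es = ?W" using finite_distinct_list[OF finW] by blast
  have fins: "finite A" "finite B" "finite C" "finite C'"
    by (rule finite_subset[OF sub(1)] finite_subset[OF sub(2)] finite_subset[OF sub(3)]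
        finite_subset[OF sub(4)]; simp)+
  have nz: "0 \<notin> A" "0 \<notin> B" "0 \<notin> C" "0 \<notin> C'" using sub by auto
  let ?G = "\<lambda>lab i. kept lab T i C' es"
  let ?poor = "\<lambda>lab i. {x. card (?G lab i x) \<le> cap \<and>
          (\<exists>A B. A \<subseteq> V \<and> B \<subseteq> V \<and> card A + card B > n + s \<and>
          (\<forall>u\<in>A. \<forall>v\<in>B. larc lab T i u v \<longrightarrow> {u, v} \<notin> ?G lab i x))}"
  let ?large = "\<lambda>lab i. {x. card (?G lab i x) \<ge> Suc cap}"
  let ?b1 = "(real n + 1) * exp (- c * real s)"
  let ?b2 = "exp (\<eta> * n ^ 2 * p * card C' / (2 * r * T)) / (1 + \<eta>) ^ Suc cap"
  let ?b = "real T * (?b1 + ?b2)"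
  let ?b3 = "2 ^ y3 * exp (- q3 / 2 * (real n - 1))"
  let ?b4 = "2 ^ y4 * exp (- p * card C / (4 * r) * (real q * (real q - 1)))"
  let ?b5 = "exp (\<zeta> * p * n ^ 2 / (2 * r)) / \<zeta> ^ Suc m"
  define \<Psi> where "\<Psi> lab = (\<Sum>i<T. Pr (colours V p r) (?poor lab i) + Pr (colours V p r) (?large lab i))" for lab
  define N where "N lab = (\<Sum>i<T. real (card (closed_walks (larc lab T i) V l)))" for lab
  have finl: "finite (set_pmf (labels V T))" using finV T by simp
  have bpos: "?b > 0"
  proof -
    have "0 < ?b1" "0 \<le> ?b2" using \<eta> by auto
    then have "0 < ?b1 + ?b2" by (rule add_pos_nonneg)
    then show ?thesis using T by (intro mult_pos_pos) auto
  qed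
  have expect\<Psi>: "expect (labels V T) \<Psi> \<le> ?b"
  proof -
    have "expect (labels V T) \<Psi> = (\<Sum>i<T. expect (labels V T) (\<lambda>lab. Pr (colours V p r) (?poor lab i))
        + expect (labels V T) (\<lambda>lab. Pr (colours V p r) (?large lab i)))"
      unfolding \<Psi>_def using finl by (simp add: expectation_sum_finite_pmf integrable_measure_pmf_finite)
    also have "\<dots> \<le> (\<Sum>i<T. ?b1 + ?b2)"
    proof (intro sum_mono add_mono)
      fix i assume "i \<in> {..<T}"
      then have i: "i < T" by simp
      show "expect (labels V T) (\<lambda>lab. Pr (colours V p r) (?poor lab i)) \<le> ?b1"
        using c by (intro prob_poor_expansion[OF finV cV es i r q1(1,2) q1(3)]) auto
      show "expect (labels V T) (\<lambda>lab. Pr (colours V p r) (?large lab i)) \<le> ?b2"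
        by (intro prob_large_class[OF finV cV es(2) i r p sub(4) \<eta>])
    qed
    finally show ?thesis by simp
  qed
  have EN: "expect (labels V T) N \<le> real T * (real z + 1) / 8"
  proof -
    have "expect (labels V T) N = (\<Sum>i<T. expect (labels V T) (\<lambda>lab. real (card (closed_walks (larc lab T i) V l))))"
      unfolding N_def using finl by (rule expectation_sum_finite_pmf)
    also have "\<dots> \<le> (\<Sum>i<T. (real l + 1) * D ^ l)"
      using D by (intro sum_mono expectation_closed_walks[OF finV cV]) auto
    also have "\<dots> \<le> (\<Sum>i<T. (real z + 1) / 8)" using D(3) by (intro sum_mono) (simp only: pos_le_divide_eq zero_less_numeral mult.commute)
    finally show ?thesis by simp
  qed
  \<comment> \<open>The expectations are at most \<open>?b\<close> and
    \<open>T * (z + 1) / 8\<close>, so each weighted part contributes at most \<open>1 / 4\<close>.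
    A labelling with weighted sum below 1 satisfies \<open>\<Psi> lab \<le> 4 * ?b\<close> and
    \<open>2 * N lab < T * (z + 1)\<close> simultaneously.\<close>
  have "expect (labels V T) (\<lambda>lab. \<Psi> lab / (4 * ?b) + N lab * (2 / (real T * (real z + 1))))
      = expect (labels V T) \<Psi> / (4 * ?b) + expect (labels V T) N * (2 / (real T * (real z + 1)))"
    using finl by (subst Bochner_Integration.integral_add) (auto simp: integrable_measure_pmf_finite)
  also have "\<dots> \<le> ?b / (4 * ?b) + real T * (real z + 1) / 8 * (2 / (real T * (real z + 1)))"
    using expect\<Psi> EN bpos T by (intro add_mono divide_right_mono mult_right_mono) auto
  also have "\<dots> = 1 / 4 + 1 / 4"
  proof -
    have "y / (4 * y) = 1 / 4" if "y > 0" for y :: real using that by simp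
    from this[OF bpos] have "?b / (4 * ?b) = 1 / 4" .
    moreover have "y / 8 * (2 / y) = 1 / 4" if "y > 0" for y :: real using that by simp
    from this[of "real T * (real z + 1)"]
    have "real T * (real z + 1) / 8 * (2 / (real T * (real z + 1))) = 1 / 4" using T by simp
    ultimately show ?thesis by simp
  qed
  also have "\<dots> < (1 :: real)" by simp
  finally have "\<exists>lab. \<Psi> lab / (4 * ?b) + N lab * (2 / (real T * (real z + 1))) < 1"
    using finl by (rule exists_below_expectation[rotated])
  then obtain lab where lab: "\<Psi> lab / (4 * ?b) + N lab * (2 / (real T * (real z + 1))) < 1" by blast
  have nonneg: "0 \<le> \<Psi> lab" "0 \<le> N lab" by (auto simp: \<Psi>_def N_def intro!: sum_nonneg)
  have "0 \<le> N lab * (2 / (real T * (real z + 1)))" using nonneg by simp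
  then have "\<Psi> lab / (4 * ?b) \<le> 1" using lab by linarith
  moreover have "w \<le> 4 * y" if "w / (4 * y) \<le> 1" "y > 0" for w y :: real
    using that by (simp add: divide_le_eq)
  ultimately have \<Psi>: "\<Psi> lab \<le> 4 * ?b" using bpos by blast
  have "0 \<le> \<Psi> lab / (4 * ?b)" using nonneg bpos by (intro divide_nonneg_pos) auto
  then have "N lab * (2 / (real T * (real z + 1))) < 1" using lab by linarith
  then have N: "2 * N lab < real T * (real z + 1)" using T by (simp add: divide_less_eq mult.commute)
  have I: "t \<le> card {i. i < T \<and> card (closed_walks (larc lab T i) V l) \<le> z}"
  proof -
    \<comment> \<open>A class with more than \<open>z\<close> short cycles adds at least
      \<open>z + 1\<close> to \<open>N lab\<close>, so fewer than half of the
      \<open>T \<ge> 2 * t\<close> classes are bad.\<close>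
    let ?bad = "{i. i < T \<and> \<not> card (closed_walks (larc lab T i) V l) \<le> z}"
    have "real (card ?bad) * (real z + 1) = (\<Sum>i\<in>?bad. real z + 1)" by simp
    also have "\<dots> \<le> (\<Sum>i\<in>?bad. real (card (closed_walks (larc lab T i) V l)))"
      by (intro sum_mono) auto
    also have "\<dots> \<le> N lab" unfolding N_def by (intro sum_mono2) auto
    finally have "2 * (real (card ?bad) * (real z + 1)) < real T * (real z + 1)" using N by linarith
    then have "(2 * real (card ?bad)) * (real z + 1) < real T * (real z + 1)" by (simp add: mult.assoc)
    then have "2 * real (card ?bad) < real T" by (simp add: mult_less_cancel_right)
    then have "2 * card ?bad < T" by linarith
    moreover have "card ({i. i < T \<and> card (closed_walks (larc lab T i) V l) \<le> z} \<union> ?bad) =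
        card {i. i < T \<and> card (closed_walks (larc lab T i) V l) \<le> z} + card ?bad"
      by (rule card_Un_disjoint) auto
    moreover have "{i. i < T \<and> card (closed_walks (larc lab T i) V l) \<le> z} \<union> ?bad = {..<T}" by auto
    ultimately show ?thesis using T(1) by simp
  qed
  let ?few = "\<lambda>A v. {x. card (x ` {e \<in> ?W. x e \<noteq> 0 \<and> v \<in> e} \<inter> A) \<le> y3}"
  let ?sparse = "\<lambda>w. {x. card {e \<in> ?W. x e \<noteq> 0 \<and> x e \<in> C \<and> (\<exists>u\<in>fst w. \<exists>v\<in>snd w. e = {u, v})} \<le> y4}"
  let ?big = "\<lambda>c. {x. card {e \<in> ?W. x e \<noteq> 0 \<and> x e = c} \<ge> Suc m}"
  let ?pairs = "{w. fst w \<subseteq> V \<and> snd w \<subseteq> V \<and> q \<le> card (fst w) \<and> q \<le> card (snd w)}"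
  have pairs: "?pairs \<subseteq> Pow V \<times> Pow V" by auto
  then have finp: "finite ?pairs" by (rule finite_subset) (use finV in auto)
  have "card ?pairs \<le> card (Pow V \<times> Pow V)" using finV pairs by (intro card_mono) auto
  also have "\<dots> = 4 ^ n"
    using finV cV by (simp add: card_cartesian_product card_Pow power_mult_distrib[symmetric])
  finally have "real (card ?pairs) \<le> real (4 ^ n)" by (rule of_nat_mono)
  then have cp: "real (card ?pairs) \<le> 4 ^ n" by (simp only: of_nat_power of_nat_numeral)
  let ?B1 = "\<Union>i\<in>{..<T}. ?poor lab i \<union> ?large lab i" and ?B2 = "\<Union>v\<in>V. ?few A v \<union> ?few B v"
    and ?B3 = "\<Union>w\<in>?pairs. ?sparse w" and ?B4 = "\<Union>c\<in>{1..r}. ?big c"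
  let ?good = "\<lambda>x. packed n (real t) ({e \<in> ?W. x e \<noteq> 0}, x)"
  have "{x. \<not> ?good x} \<subseteq> ?B1 \<union> ?B2 \<union> ?B3 \<union> ?B4"
  proof (intro subsetI, rule ccontr)
    fix x assume x: "x \<in> {x. \<not> ?good x}" "x \<notin> ?B1 \<union> ?B2 \<union> ?B3 \<union> ?B4"
    have notin: "x \<notin> ?B1" "x \<notin> ?B2" "x \<notin> ?B3" "x \<notin> ?B4" using x(2) by simp_all
    have "?good x"
    proof (rule disjoint_rainbow_hamilton_cycles_if_robust[OF n V es(2) q nz disj I k])
      fix i A B assume *: "i < T" "A \<subseteq> V" "B \<subseteq> V" "card A + card B > n + s"
      have "x \<notin> ?poor lab i" "x \<notin> ?large lab i" using notin(1) *(1) by blast+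
      then have "\<not> (\<forall>u\<in>A. \<forall>v\<in>B. larc lab T i u v \<longrightarrow> {u, v} \<notin> ?G lab i x)" using *(2-4) by auto
      then show "\<exists>u\<in>A. \<exists>v\<in>B. larc lab T i u v \<and> {u, v} \<in> ?G lab i x" by blast
    next
      fix v assume "v \<in> V"
      then have "x \<notin> ?few A v" "x \<notin> ?few B v" using notin(2) by blast+
      then show "2 * t + k + 2 * q + 1 \<le> card (x ` {e \<in> ?W. x e \<noteq> 0 \<and> v \<in> e} \<inter> A)"
        "2 * t + k + 2 * q + 1 \<le> card (x ` {e \<in> ?W. x e \<noteq> 0 \<and> v \<in> e} \<inter> B)"
        using y3 by auto
    next
      fix S U assume "S \<subseteq> V" "U \<subseteq> V" "q \<le> card S" "q \<le> card U"
      then have "(S, U) \<in> ?pairs" by simp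
      then have "x \<notin> ?sparse (S, U)" using notin(3) by blast
      then show "t * k + k * m < card {e \<in> ?W. x e \<noteq> 0 \<and> x e \<in> C \<and> (\<exists>u\<in>S. \<exists>w\<in>U. e = {u, w})}"
        using y4 by auto
    next
      fix c assume "c \<in> C"
      then have "x \<notin> ?big c" using notin(4) sub(3) by blast
      then show "card {e \<in> ?W. x e \<noteq> 0 \<and> x e = c} \<le> m" by auto
    qed
    then show False using x(1) by simp
  qed
  then have "Pr (colours V p r) {x. \<not> ?good x} \<le> Pr (colours V p r) (?B1 \<union> ?B2 \<union> ?B3 \<union> ?B4)"
    by (intro measure_pmf.finite_measure_mono) auto
  also have "\<dots> \<le> Pr (colours V p r) ?B1 + Pr (colours V p r) ?B2 + Pr (colours V p r) ?B3 + Pr (colours V p r) ?B4"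
    by (intro order_trans[OF prob_Un_le] add_mono order_refl)
  also have "\<dots> \<le> 4 * ?b + real n * (?b3 + ?b3) + 4 ^ n * ?b4 + real r * ?b5"
  proof (intro add_mono)
    have "Pr (colours V p r) ?B1 \<le> (\<Sum>i<T. Pr (colours V p r) (?poor lab i \<union> ?large lab i))"
      by (rule prob_UN_le) simp
    also have "\<dots> \<le> \<Psi> lab" unfolding \<Psi>_def
      by (intro sum_mono prob_Un_le)
    finally show "Pr (colours V p r) ?B1 \<le> 4 * ?b" using \<Psi> by linarith
    have "Pr (colours V p r) ?B2 \<le> (\<Sum>v\<in>V. Pr (colours V p r) (?few A v \<union> ?few B v))"
      using finV by (rule prob_UN_le)
    also have "\<dots> \<le> (\<Sum>v\<in>V. ?b3 + ?b3)"
    proof (intro sum_mono order_trans[OF prob_Un_le] add_mono)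
      fix v assume v: "v \<in> V"
      show "Pr (colours V p r) (?few A v) \<le> ?b3"
        using q3 by (intro prob_few_colours_at_vertex[OF finV cV es v r q3(1,2) nz(1) fins(1)])
      show "Pr (colours V p r) (?few B v) \<le> ?b3"
        using q3 by (intro prob_few_colours_at_vertex[OF finV cV es v r q3(1,2) nz(2) fins(2)])
    qed
    finally show "Pr (colours V p r) ?B2 \<le> real n * (?b3 + ?b3)" using cV by simp
    have "Pr (colours V p r) ?B3 \<le> (\<Sum>w\<in>?pairs. Pr (colours V p r) (?sparse w))"
      using finp by (rule prob_UN_le)
    also have "\<dots> \<le> (\<Sum>w\<in>?pairs. ?b4)"
    proof (intro sum_mono)
      fix w assume w: "w \<in> ?pairs"
      then have "Pr (colours V p r) (?sparse w)
        \<le> 2 ^ y4 * exp (- p * card C / (4 * r) * card (ordered_pairs (fst w) (snd w)))"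
        by (intro prob_few_edges_between[OF finV _ _ r p sub(3)]) auto
      also have "\<dots> \<le> ?b4"
      proof -
        let ?a = "card (fst w)" and ?d = "card (snd w)"
        have fw: "finite (fst w)" "finite (snd w)" using w finV finite_subset by blast+
        have qq: "q \<le> ?a" "q \<le> ?d" using w by auto
        have "real q * (real q - 1) \<le> real (min ?a ?d) * (real (max ?a ?d) - 1)"
          using qq q by (intro mult_mono) auto
        also have "\<dots> = real (?a * ?d) - real (min ?a ?d)"
          by (auto simp: min_def max_def algebra_simps)
        also have "\<dots> \<le> real (card (ordered_pairs (fst w) (snd w)))"
          using of_nat_mono[OF card_ordered_pairs[OF fw], where 'a = real] by simp
        finally have "p * card C / (4 * r) * (real q * (real q - 1))
          \<le> p * card C / (4 * r) * real (card (ordered_pairs (fst w) (snd w)))"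
          using p by (intro mult_left_mono) auto
        then show ?thesis by simp
      qed
      finally show "Pr (colours V p r) (?sparse w) \<le> ?b4" .
    qed
    also have "\<dots> = card ?pairs * ?b4" by simp
    also have "\<dots> \<le> 4 ^ n * ?b4" using cp by (intro mult_right_mono) auto
    finally show "Pr (colours V p r) ?B3 \<le> 4 ^ n * ?b4" .
    have "Pr (colours V p r) ?B4 \<le> (\<Sum>c\<in>{1..r}. Pr (colours V p r) (?big c))"
      by (rule prob_UN_le) simp
    also have "\<dots> \<le> (\<Sum>c\<in>{1..r}. ?b5)"
      by (intro sum_mono prob_large_colour_class[OF finV cV r p _ \<zeta>])
    finally show "Pr (colours V p r) ?B4 \<le> real r * ?b5" by simp
  qed
  finally show ?thesis by (simp add: algebra_simps)
qed

section \<open>Passing from the perturbed graph to independent edges\<close>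

text \<open>\<open>m\<close> is a mode of the binomial distribution with success probability
  \<open>p = m / N\<close>: the ratio \<open>(N - k) * p / ((k + 1) * (1 - p))\<close> of
  consecutive probabilities is at least 1 for \<open>k < m\<close> and at most 1 for
  \<open>k \<ge> m\<close>. The largest of \<open>N + 1\<close> probabilities with sum 1 is at least
  \<open>1 / (N + 1)\<close>.\<close>

lemma binomial_mode:
  assumes "m \<le> N"
  shows "1 \<le> (real N + 1) * (real (N choose m) * (m / N) ^ m * (1 - m / N) ^ (N - m))"
proof (cases "N = 0")
  case True
  then show ?thesis using assms by simp
next
  case False
  define p where "p = real m / real N"
  define a where "a k = real (N choose k) * p ^ k * (1 - p) ^ (N - k)" for k
  have p: "0 \<le> p" "p \<le> 1" using assms False by (auto simp: p_def)
  have pN: "p * real N = m" using False by (simp add: p_def)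
  \<comment> \<open>Stated without division, since \<open>p\<close> may be 0 or 1.\<close>
  have ratio: "a (Suc k) * (real k + 1) * (1 - p) = a k * (real N - real k) * p" if "k < N" for k
  proof -
    have "Suc k * (N choose Suc k) = (N - k) * (N choose k)"
      by (simp only: binomial_absorb_comp binomial_absorption)
    then have "real (Suc k * (N choose Suc k)) = real ((N - k) * (N choose k))" by simp
    then have 1: "(real k + 1) * real (N choose Suc k) = (real N - real k) * real (N choose k)"
      using that by (simp add: of_nat_diff algebra_simps)
    have 2: "(1 - p) ^ (N - k) = (1 - p) * (1 - p) ^ (N - Suc k)"
      using that by (metis Suc_diff_Suc power_Suc)
    have "a (Suc k) * (real k + 1) * (1 - p) =
        ((real k + 1) * real (N choose Suc k)) * (p * p ^ k * ((1 - p) * (1 - p) ^ (N - Suc k)))"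
      unfolding a_def power_Suc by (simp only: mult_ac)
    also have "\<dots> = ((real N - real k) * real (N choose k)) * (p * p ^ k * (1 - p) ^ (N - k))"
      unfolding 1 2 ..
    finally show ?thesis unfolding a_def by (simp only: mult_ac)
  qed
  have a0: "0 \<le> a k" for k using p by (simp add: a_def)
  have le: "a k \<le> a m" if "k \<le> N" for k
  proof (cases "k \<le> m")
    case True
    then show ?thesis
    proof (induction rule: inc_induct)
      case (step k)
      have kN: "k < N" using step assms by simp
      have "a k \<le> a (Suc k)"
      proof (cases "p = 1")
        case True
        then have "a k = 0" using kN by (simp add: a_def power_0_left)
        then show ?thesis using a0[of "Suc k"] by simp
      next
        case False
        then have p1: "p < 1" using p by simp
        have "real (Suc k) \<le> real m" using step by (simp only: of_nat_le_iff)
        then have "(real k + 1) * (1 - p) \<le> (real N - real k) * p"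
          using pN p by (simp add: algebra_simps)
        then have "a (Suc k) * ((real k + 1) * (1 - p)) \<le> a (Suc k) * ((real N - real k) * p)"
          using a0 by (intro mult_left_mono)
        then have "a k * ((real N - real k) * p) \<le> a (Suc k) * ((real N - real k) * p)"
          using ratio[OF kN] by (simp add: mult.assoc)
        moreover have "0 < (real k + 1) * (1 - p)" using p1 by (intro mult_pos_pos) auto
        then have "0 < (real N - real k) * p"
          using \<open>(real k + 1) * (1 - p) \<le> (real N - real k) * p\<close> by linarith
        ultimately show ?thesis by (simp add: mult_le_cancel_right)
      qed
      then show ?case using step by simp
    qed simp
  next
    case False
    then have "m \<le> k" by simp
    then show ?thesis using that
    proof (induction rule: dec_induct)
      case (step k)
      have kN: "k < N" using step by simp
      have "a (Suc k) \<le> a k"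
      proof (cases "p = 0")
        case True
        then have "a (Suc k) = 0" by (simp add: a_def)
        then show ?thesis using a0[of k] by simp
      next
        case False
        have mk: "real m \<le> real k" using step by simp
        have "(real N - real k) * p \<le> (real k + 1) * (1 - p)"
          using pN p mk by (simp add: algebra_simps)
        then have "a k * ((real N - real k) * p) \<le> a k * ((real k + 1) * (1 - p))"
          using a0 by (intro mult_left_mono)
        then have *: "a (Suc k) * ((real k + 1) * (1 - p)) \<le> a k * ((real k + 1) * (1 - p))"
          using ratio[OF kN] by (simp add: mult.assoc)
        have "m < N" using step by simp
        then have "p < 1" by (simp add: p_def divide_less_eq)
        then have "0 < (real k + 1) * (1 - p)" by (intro mult_pos_pos) auto
        then show ?thesis using * by (simp add: mult_le_cancel_right)
      qed
      then show ?case using step by simp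
    qed simp
  qed
  have "1 = (p + (1 - p)) ^ N" by simp
  also have "\<dots> = (\<Sum>k\<le>N. a k)" unfolding a_def by (rule binomial_ring)
  also have "\<dots> \<le> (\<Sum>k\<le>N. a m)" using le by (intro sum_mono) auto
  also have "\<dots> = (real N + 1) * a m" by simp
  finally show ?thesis by (simp add: a_def p_def)
qed

abbreviation bern :: "'a set \<Rightarrow> real \<Rightarrow> ('a \<Rightarrow> bool) pmf" where
  "bern A p \<equiv> Pi_pmf A False (\<lambda>_. bernoulli_pmf p)"

lemma finite_set_bernoulli [simp]: "finite (set_pmf (bernoulli_pmf p))"
  by (rule finite_subset[OF subset_UNIV]) simp

lemma prob_bind_finite_pmf:
  assumes "finite (set_pmf p)" "\<And>x. x \<in> set_pmf p \<Longrightarrow> finite (set_pmf (f x))"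
  shows "Pr (bind_pmf p f) S = expect p (\<lambda>x. Pr (f x) S)"
proof -
  have fin: "finite (set_pmf (bind_pmf p f))" using assms by simp
  have "Pr (bind_pmf p f) S = expect p (\<lambda>x. expect (f x) (\<lambda>y. of_bool (y \<in> S)))"
    unfolding prob_finite_pmf[OF fin] using assms by (intro expectation_bind_finite_pmf)
  also have "\<dots> = expect p (\<lambda>x. Pr (f x) S)"
    unfolding expectation_finite_pmf[OF assms(1)] using assms(2)
    by (intro sum.cong refl arg_cong2[where f = "(*)"] prob_finite_pmf[symmetric])
  finally show ?thesis .
qed

lemma uniform_subset_le_bernoulli:
  fixes f :: "'a set \<Rightarrow> real"
  assumes A: "finite A" "card A = N" and m: "m \<le> N" and f: "\<And>R. 0 \<le> f R"
  shows "expect (pmf_of_set ([A]\<^bsup>m\<^esup>)) f \<le>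
    (real N + 1) * expect (Pi_pmf A False (\<lambda>_. bernoulli_pmf (m / N))) (\<lambda>b. f {a \<in> A. b a})"
proof -
  let ?p = "real m / real N"
  let ?B = "Pi_pmf A False (\<lambda>_. bernoulli_pmf ?p)"
  let ?\<chi> = "\<lambda>R a. a \<in> R"
  have p: "0 \<le> ?p" "?p \<le> 1" using m by (auto simp: divide_le_eq_1)
  have finS: "finite ([A]\<^bsup>m\<^esup>)" using A by (simp add: finite_imp_finite_nsets)
  have cS: "card ([A]\<^bsup>m\<^esup>) = N choose m" using A by (simp add: card_nsets)
  have "card ([A]\<^bsup>m\<^esup>) > 0" unfolding cS using m by simp
  then have neS: "[A]\<^bsup>m\<^esup> \<noteq> {}" unfolding card_gt_0_iff by (rule conjunct1)
  have pmf: "pmf ?B (?\<chi> R) = ?p ^ m * (1 - ?p) ^ (N - m)" if R: "R \<in> [A]\<^bsup>m\<^esup>" for R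
  proof -
    have RA: "R \<subseteq> A" "card R = m" "finite R" using R by (auto simp: nsets_def)
    have "pmf ?B (?\<chi> R) = (\<Prod>a\<in>A. pmf (bernoulli_pmf ?p) (a \<in> R))"
      using A RA by (subst pmf_Pi) auto
    also have "\<dots> = (\<Prod>a\<in>A. if a \<in> R then ?p else 1 - ?p)"
      using p by (intro prod.cong) auto
    also have "\<dots> = ?p ^ card R * (1 - ?p) ^ card (A - R)"
      using A RA by (simp add: prod.If_cases Int_absorb1 Diff_eq)
    also have "card (A - R) = N - m" using A RA by (simp add: card_Diff_subset)
    finally show ?thesis using RA by simp
  qed
  have inj: "inj_on ?\<chi> (Pow A)" by (auto simp: inj_on_def fun_eq_iff)
  have supp: "set_pmf ?B \<subseteq> ?\<chi> ` Pow A"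
  proof
    fix b assume "b \<in> set_pmf ?B"
    then have "\<forall>a. a \<notin> A \<longrightarrow> \<not> b a" using set_Pi_pmf_subset[OF A(1), of False] by fastforce
    then have "b = ?\<chi> {a \<in> A. b a}" by (auto simp: fun_eq_iff)
    then show "b \<in> ?\<chi> ` Pow A" by blast
  qed
  have "?p ^ m * (1 - ?p) ^ (N - m) * (\<Sum>R\<in>[A]\<^bsup>m\<^esup>. f R) = (\<Sum>R\<in>[A]\<^bsup>m\<^esup>. f {a \<in> A. ?\<chi> R a} * pmf ?B (?\<chi> R))"
    unfolding sum_distrib_left
  proof (intro sum.cong refl)
    fix R assume R: "R \<in> [A]\<^bsup>m\<^esup>"
    then have "{a \<in> A. ?\<chi> R a} = R" by (auto simp: nsets_def)
    then show "?p ^ m * (1 - ?p) ^ (N - m) * f R = f {a \<in> A. ?\<chi> R a} * pmf ?B (?\<chi> R)"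
      using pmf[OF R] by simp
  qed
  also have "\<dots> \<le> (\<Sum>R\<in>Pow A. f {a \<in> A. ?\<chi> R a} * pmf ?B (?\<chi> R))"
    using A f by (intro sum_mono2) (auto simp: nsets_def)
  also have "\<dots> = (\<Sum>b\<in>?\<chi> ` Pow A. f {a \<in> A. b a} * pmf ?B b)"
    by (subst sum.reindex[OF inj]) simp
  also have "\<dots> = expect ?B (\<lambda>b. f {a \<in> A. b a})"
    using supp A by (intro integral_measure_pmf_real[symmetric]) auto
  finally have le: "?p ^ m * (1 - ?p) ^ (N - m) * (\<Sum>R\<in>[A]\<^bsup>m\<^esup>. f R) \<le> expect ?B (\<lambda>b. f {a \<in> A. b a})" .
  have S0: "0 \<le> (\<Sum>R\<in>[A]\<^bsup>m\<^esup>. f R) / (N choose m)" using f by (simp add: sum_nonneg)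
  have "expect (pmf_of_set ([A]\<^bsup>m\<^esup>)) f = (\<Sum>R\<in>[A]\<^bsup>m\<^esup>. f R) / (N choose m)"
    using finS neS cS by (simp add: integral_pmf_of_set)
  also have "\<dots> \<le> (real N + 1) * (real (N choose m) * ?p ^ m * (1 - ?p) ^ (N - m)) *
      ((\<Sum>R\<in>[A]\<^bsup>m\<^esup>. f R) / (N choose m))"
    using mult_right_mono[OF binomial_mode[OF m] S0] by simp
  also have "\<dots> = (real N + 1) * (?p ^ m * (1 - ?p) ^ (N - m) * (\<Sum>R\<in>[A]\<^bsup>m\<^esup>. f R))"
    using m by simp
  also have "\<dots> \<le> (real N + 1) * expect ?B (\<lambda>b. f {a \<in> A. b a})"
    using le by (intro mult_left_mono) auto
  finally show ?thesis .
qed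

text \<open>The density is changed one coordinate at a time: in a single coordinate the expectation
  is affine in the probability, with slope
  \<open>f (x(e := True)) - f (x(e := False)) \<le> 0\<close>.\<close>

lemma expectation_bernoulli_antimono:
  fixes f :: "('a \<Rightarrow> bool) \<Rightarrow> real"
  assumes "finite A" and pq: "0 \<le> p" "p \<le> q" "q \<le> 1" and "antimono f"
  shows "expect (Pi_pmf A False (\<lambda>_. bernoulli_pmf q)) f \<le> expect (Pi_pmf A False (\<lambda>_. bernoulli_pmf p)) f"
  using assms(1,5)
proof (induction A arbitrary: f rule: finite_induct)
  case empty
  then show ?case by simp
next
  case (insert e A)
  let ?g = "\<lambda>w x. w * f (x(e := True)) + (1 - w) * f (x(e := False))"
  have eq: "expect (bern (insert e A) w) f =
      expect (Pi_pmf A False (\<lambda>_. bernoulli_pmf w)) (?g w)" if "0 \<le> w" "w \<le> 1" for w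
  proof -
    have "expect (bern (insert e A) w) f =
       expect (Pi_pmf A False (\<lambda>_. bernoulli_pmf w)) (\<lambda>x. expect (bernoulli_pmf w) (\<lambda>y. f (x(e := y))))"
      using insert.hyps by (intro expectation_Pi_pmf_insert) auto
    then show ?thesis using that by (simp add: mult.commute)
  qed
  have fT: "f (x(e := True)) \<le> f (x(e := False))" for x
    using insert.prems by (rule antimonoD) (auto simp: le_fun_def)
  have g: "antimono (?g q)"
  proof (rule antimonoI)
    fix x y :: "'a \<Rightarrow> bool" assume "x \<le> y"
    then have "x(e := b) \<le> y(e := b)" for b by (auto simp: le_fun_def)
    then have "f (y(e := b)) \<le> f (x(e := b))" for b using insert.prems antimonoD by blast
    then show "?g q y \<le> ?g q x" using pq by (intro add_mono mult_left_mono) auto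
  qed
  have "expect (Pi_pmf A False (\<lambda>_. bernoulli_pmf q)) (?g q) \<le> expect (Pi_pmf A False (\<lambda>_. bernoulli_pmf p)) (?g q)"
    using g by (rule insert.IH)
  also have "\<dots> \<le> expect (Pi_pmf A False (\<lambda>_. bernoulli_pmf p)) (?g p)"
  proof (intro expectation_finite_pmf_mono finite_set_Pi_pmf insert.hyps(1))
    fix x
    have "(q - p) * f (x(e := True)) \<le> (q - p) * f (x(e := False))"
      using fT pq by (intro mult_left_mono) auto
    then show "?g q x \<le> ?g p x" by (simp add: algebra_simps)
  qed auto
  finally show ?case using eq[of p] eq[of q] pq by simp
qed

lemma has_disjoint_rainbow_hamilton_cycles_mono:
  assumes "packed n t (F, c)" "F \<subseteq> F'" "\<And>e. e \<in> F \<Longrightarrow> c e = c' e"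
  shows "packed n t (F', c')"
proof -
  have "hamilton_cycle n F' C \<and> rainbow c' C" if "hamilton_cycle n F C \<and> rainbow c C" for C
    using that assms(2,3) unfolding hamilton_cycle_def rainbow_def
    by (metis (no_types, lifting) inj_on_cong subset_iff)
  then show ?thesis using assms(1) unfolding has_disjoint_rainbow_hamilton_cycles_def prod.case by blast
qed

section \<open>Failure probability as a function of the edge set\<close>

definition failure :: "nat \<Rightarrow> real \<Rightarrow> nat \<Rightarrow> nat set set \<Rightarrow> real" where
  "failure n t r F = Pr (random_coloring r F) {c. \<not> packed n t (F, c)}"

text \<open>A random colouring of \<open>F\<close> is the restriction of one of \<open>F'\<close>,
  and every rainbow cycle in \<open>F\<close> remains available in \<open>F'\<close>.\<close>

lemma failure_antimono:
  assumes "F \<subseteq> F'" "finite F'"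
  shows "failure n t r F' \<le> failure n t r F"
proof -
  let ?res = "\<lambda>c e. if e \<in> F then c e else 0"
  have "failure n t r F = Pr (random_coloring r F') (?res -` {c. \<not> packed n t (F, c)})"
    unfolding failure_def random_coloring_def using assms by (simp add: Pi_pmf_subset[of F' F])
  also have "\<dots> \<ge> failure n t r F'"
    unfolding failure_def
  proof (intro measure_pmf.finite_measure_mono subsetI)
    fix c assume "c \<in> {c. \<not> packed n t (F', c)}"
    then show "c \<in> ?res -` {c. \<not> packed n t (F, c)}"
      using has_disjoint_rainbow_hamilton_cycles_mono[of n t F "?res c" F' c] assms(1) by auto
  qed auto
  finally show ?thesis .
qed

text \<open>\<open>colours\<close> draws presence and colour of an edge at once. It splits into an
  independent edge set followed by a uniform colouring of it, because present edges get positive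
  colours and absent ones get 0.\<close>

lemma expectation_failure:
  assumes V: "finite V" and r: "r > 0"
  shows "expect (bern ([V]\<^bsup>2\<^esup>) p) (\<lambda>b. failure n t r {e \<in> [V]\<^bsup>2\<^esup>. b e})
    = Pr (colours V p r) {x. \<not> packed n t ({e \<in> [V]\<^bsup>2\<^esup>. x e \<noteq> 0}, x)}"
proof -
  let ?W = "[V]\<^bsup>2\<^esup>" and ?U = "pmf_of_set {1..r}"
  let ?S = "{x. \<not> packed n t ({e \<in> ?W. x e \<noteq> 0}, x)}"
  have finW: "finite ?W" using V by (simp add: finite_imp_finite_nsets)
  have finU: "finite (set_pmf ?U)" using r by simp
  let ?col = "\<lambda>b. Pi_pmf ?W 0 (\<lambda>e. if b e then ?U else return_pmf 0)"
  have col: "?col b = random_coloring r {e \<in> ?W. b e}" for b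
  proof -
    have "?col b = Pi_pmf {e \<in> ?W. b e} 0 (\<lambda>e. if b e then ?U else return_pmf 0)"
      using finW by (intro Pi_pmf_subset') auto
    also have "\<dots> = random_coloring r {e \<in> ?W. b e}"
      unfolding random_coloring_def using finW by (intro Pi_pmf_cong) auto
    finally show ?thesis .
  qed
  have fincol: "finite (set_pmf (?col b))" for b
    using finW finU by (intro finite_set_Pi_pmf) auto
  have "colours V p r = bind_pmf (bern ?W p) ?col"
    unfolding edge_colour_pmf_def by (rule Pi_pmf_bind[OF finW])
  moreover have "finite (set_pmf (bern ?W p))"
    using finW by (intro finite_set_Pi_pmf) auto
  ultimately have "Pr (colours V p r) ?S = expect (bern ?W p) (\<lambda>b. Pr (?col b) ?S)"
    using fincol by (simp only: prob_bind_finite_pmf)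
  also have "\<dots> = expect (bern ?W p) (\<lambda>b. failure n t r {e \<in> ?W. b e})"
  proof (intro arg_cong[where f = "expect (bern ?W p)"] ext)
    fix b
    have nz: "{e \<in> ?W. x e \<noteq> 0} = {e \<in> ?W. b e}" if "x \<in> set_pmf (?col b)" for x
    proof -
      have "x e \<in> set_pmf (if b e then ?U else return_pmf 0)" if "e \<in> ?W" for e
        using \<open>x \<in> set_pmf (?col b)\<close> that finW by (auto simp: set_Pi_pmf PiE_dflt_def)
      then show ?thesis using r by (fastforce split: if_splits)
    qed
    have "Pr (?col b) ?S = Pr (?col b) {x. \<not> packed n t ({e \<in> ?W. b e}, x)}"
      using nz by (intro measure_pmf.finite_measure_eq_AE AE_pmfI) auto
    then show "Pr (?col b) ?S = failure n t r {e \<in> ?W. b e}"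
      by (simp add: failure_def col)
  qed
  finally show ?thesis by simp
qed

text \<open>The uniform choice of the new edges costs the factor
  \<open>card (non_edges n G) + 1\<close>. The rest is monotonicity, as more edges only lower the
  failure probability: the edges of \<open>G\<close> are thinned like all others, and the density is
  lowered from \<open>m / card (non_edges n G)\<close> to \<open>p\<close>.\<close>

lemma perturbed_failure_le:
  fixes p :: real
  assumes V: "V = {1..n}" and G: "G \<subseteq> [V]\<^bsup>2\<^esup>" and r: "r > 0" and m: "m \<le> card (non_edges n G)"
    and p: "0 \<le> p" "p \<le> 1" "p * card (non_edges n G) \<le> m"
  shows "1 - Pr (colored_perturbed_graph n G m r) {H. packed n t H}
    \<le> (real (card (non_edges n G)) + 1) *
      Pr (colours V p r) {x. \<not> packed n t ({e \<in> [V]\<^bsup>2\<^esup>. x e \<noteq> 0}, x)}"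
proof -
  let ?W = "[V]\<^bsup>2\<^esup>" and ?X = "non_edges n G"
  let ?h = "failure n t r"
  let ?bern = "\<lambda>p. bern ?W p"
  have finV: "finite V" and finW: "finite ?W" using V by (auto simp: finite_imp_finite_nsets)
  have X: "?X = ?W - G" by (simp add: non_edges_def V)
  have finX: "finite ?X" using finW X by simp
  have finS: "finite ([?X]\<^bsup>m\<^esup>)" using finX by (simp add: finite_imp_finite_nsets)
  have "card ([?X]\<^bsup>m\<^esup>) > 0" using finX m by (simp add: card_nsets)
  then have neS: "[?X]\<^bsup>m\<^esup> \<noteq> {}" unfolding card_gt_0_iff by (rule conjunct1)
  let ?R = "pmf_of_set ([?X]\<^bsup>m\<^esup>)"
  have finR: "finite (set_pmf ?R)" using finS neS by simp
  have h0: "0 \<le> ?h F" for F by (simp add: failure_def)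
  have anti: "antimono (\<lambda>b. ?h {e \<in> ?W. b e})"
    using finW by (intro antimonoI failure_antimono) (auto simp: le_fun_def)
  have "1 - Pr (colored_perturbed_graph n G m r) {H. packed n t H}
     = Pr (colored_perturbed_graph n G m r) {H. \<not> packed n t H}"
    by (subst measure_pmf.prob_compl[symmetric]) (auto intro: arg_cong[where f = "Pr _"])
  also have "\<dots> = expect ?R (\<lambda>R. ?h (G \<union> R))"
  proof -
    have "colored_perturbed_graph n G m r =
        bind_pmf ?R (\<lambda>R. map_pmf (Pair (G \<union> R)) (random_coloring r (G \<union> R)))"
      by (simp add: colored_perturbed_graph_def perturbed_graph_def bind_map_pmf)
    moreover have "finite (set_pmf (random_coloring r (G \<union> R)))" if "R \<in> set_pmf ?R" for R
    proof -
      have "R \<in> [?X]\<^bsup>m\<^esup>" using that finS neS by simp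
      then have "finite (G \<union> R)" using G finW finX by (auto simp: nsets_def intro: finite_subset)
      then show ?thesis unfolding random_coloring_def using r by (intro finite_set_Pi_pmf) auto
    qed
    ultimately have "Pr (colored_perturbed_graph n G m r) {H. \<not> packed n t H}
      = expect ?R (\<lambda>R. Pr (map_pmf (Pair (G \<union> R)) (random_coloring r (G \<union> R)))
          {H. \<not> packed n t H})"
      using finR by (simp add: prob_bind_finite_pmf)
    also have "\<dots> = expect ?R (\<lambda>R. ?h (G \<union> R))"
      by (intro arg_cong[where f = "expect ?R"] ext) (simp add: failure_def vimage_def)
    finally show ?thesis .
  qed
  also have "\<dots> \<le> (real (card ?X) + 1) * expect (?bern p) (\<lambda>b. ?h {e \<in> ?W. b e})"
  \<comment> \<open>If there are no non-edges, the quotient \<open>m / card ?X\<close> is 0 and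
    \<open>p\<close> may exceed it. Then \<open>G\<close> is complete and monotonicity alone
    suffices.\<close>
  proof (cases "card ?X = 0")
    case True
    then have "G = ?W" using finX X G by auto
    have "expect ?R (\<lambda>R. ?h (G \<union> R)) \<le> expect ?R (\<lambda>R. expect (?bern p) (\<lambda>b. ?h {e \<in> ?W. b e}))"
    proof (intro expectation_finite_pmf_mono finR)
      fix R assume "R \<in> set_pmf ?R"
      then have "R \<in> [?X]\<^bsup>m\<^esup>" using finS neS by simp
      then have GR: "G \<union> R = ?W" using \<open>G = ?W\<close> X by (auto simp: nsets_def)
      have "expect (?bern p) (\<lambda>_. ?h ?W) \<le> expect (?bern p) (\<lambda>b. ?h {e \<in> ?W. b e})"
        using finW by (intro expectation_finite_pmf_mono failure_antimono finite_set_Pi_pmf) auto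
      then show "?h (G \<union> R) \<le> expect (?bern p) (\<lambda>b. ?h {e \<in> ?W. b e})" using GR by simp
    qed
    then show ?thesis using True by simp
  next
    case False
    let ?q = "real m / real (card ?X)"
    have q: "p \<le> ?q" "?q \<le> 1" using p(3) m False by (auto simp: pos_le_divide_eq)
    have "expect ?R (\<lambda>R. ?h (G \<union> R)) \<le> (real (card ?X) + 1) *
        expect (bern ?X ?q) (\<lambda>b. ?h (G \<union> {e \<in> ?X. b e}))"
      using finX m h0 by (intro uniform_subset_le_bernoulli) auto
    also have "bern ?X ?q =
        map_pmf (\<lambda>f e. if e \<in> ?X then f e else False) (?bern ?q)"
      using finW X by (intro Pi_pmf_subset) auto
    also have "expect \<dots> (\<lambda>b. ?h (G \<union> {e \<in> ?X. b e})) = expect (?bern ?q) (\<lambda>b. ?h (G \<union> {e \<in> ?X. b e}))"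
      by (simp add: conj_commute cong: conj_cong)
    also have "\<dots> \<le> expect (?bern ?q) (\<lambda>b. ?h {e \<in> ?W. b e})"
      using finW X G by (intro expectation_finite_pmf_mono failure_antimono finite_set_Pi_pmf)
        (auto intro: finite_subset)
    also have "\<dots> \<le> expect (?bern p) (\<lambda>b. ?h {e \<in> ?W. b e})"
      using anti finW p q by (intro expectation_bernoulli_antimono) auto
    finally show ?thesis by (simp add: mult_left_mono)
  qed
  also have "expect (?bern p) (\<lambda>b. ?h {e \<in> ?W. b e}) =
      Pr (colours V p r) {x. \<not> packed n t ({e \<in> ?W. x e \<noteq> 0}, x)}"
    using finV r by (rule expectation_failure)
  finally show ?thesis .
qed

section \<open>Choice of the parameters\<close>

lemma exp_one_bounds: "(27 / 10 :: real) \<le> exp 1" "exp 1 \<le> (272 / 100 :: real)"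
proof -
  have "(1 + 1 / real 100) ^ 100 \<le> exp (1 :: real)"
    by (rule exp_ge_one_plus_x_over_n_power_n) auto
  then show "(27 / 10 :: real) \<le> exp 1" by (rule order_trans[rotated]) (simp add: power_divide)
  show "exp 1 \<le> (272 / 100 :: real)" using e_less_272 by simp
qed

text \<open>With \<open>t = \<tau> * n\<close>, the density \<open>p\<close> is such that
  \<open>p * n ^ 2 / 2 = (435 + 75 * \<theta>) * t * n\<close>. Whichever term attains the minimum
  in \<open>\<tau>\<close>, \<open>p\<close> is at least \<open>3 / 2 * \<delta>\<close>; this
  converts \<open>\<epsilon> = exp (- 11) * \<delta> ^ 2\<close> into a small multiple of
  \<open>p ^ 2\<close>.\<close>

lemma parameter_bounds:
  fixes \<delta> \<theta> \<tau> p \<epsilon> :: real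
  assumes "0 < \<delta>" "\<delta> < 1 / 2" "\<theta> = - ln \<delta>" "\<tau> = min (\<delta> / 260) (1 / (1000 + 200 * \<theta>))"
    "p = (870 + 150 * \<theta>) * \<tau>" "\<epsilon> = exp (- 11 - 2 * \<theta>)"
  shows "2 / 3 \<le> \<theta>" "0 < \<tau>" "0 < p" "p \<le> 1" "\<tau> \<le> p / 970" "0 < \<epsilon>" "\<epsilon> \<le> 8 / 10 ^ 6 * p ^ 2"
proof -
  have "ln \<delta> \<le> ln (1 / 2)" using assms(1,2) by (subst ln_le_cancel_iff) auto
  then show \<theta>: "2 / 3 \<le> \<theta>" using ln2_ge_two_thirds assms(3) by (simp add: ln_div)
  show \<tau>: "0 < \<tau>" using assms(1,4) \<theta> by simp
  show "0 < p" using assms(5) \<theta> \<tau> by simp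
  have "p \<le> (870 + 150 * \<theta>) * (1 / (1000 + 200 * \<theta>))"
    unfolding assms(5) using assms(4) \<theta> by (intro mult_left_mono) auto
  also have "\<dots> \<le> 1" using \<theta> by (simp add: divide_simps)
  finally show p1: "p \<le> 1" .
  have "970 * \<tau> \<le> (870 + 150 * \<theta>) * \<tau>" using \<theta> \<tau> by (intro mult_right_mono) auto
  then show "\<tau> \<le> p / 970" using assms(5) by simp
  show "0 < \<epsilon>" using assms(6) by simp
  have p\<delta>: "3 / 2 * \<delta> \<le> p"
  proof (cases "\<delta> / 260 \<le> 1 / (1000 + 200 * \<theta>)")
    case True
    then have "p = (870 + 150 * \<theta>) * (\<delta> / 260)" using assms(4,5) by simp
    moreover have "970 * (\<delta> / 260) \<le> (870 + 150 * \<theta>) * (\<delta> / 260)"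
      using \<theta> assms(1) by (intro mult_right_mono) auto
    ultimately have "970 * (\<delta> / 260) \<le> p" by (simp only:)
    then show ?thesis using assms(1) by linarith
  next
    case False
    then have "p = (870 + 150 * \<theta>) / (1000 + 200 * \<theta>)" using assms(4,5) by simp
    moreover have "3 / 4 \<le> (870 + 150 * \<theta>) / (1000 + 200 * \<theta>)" using \<theta> by (simp add: le_divide_eq)
    ultimately have "3 / 4 \<le> p" by (simp only:)
    then show ?thesis using assms(2) by linarith
  qed
  have "\<epsilon> = exp (- 11) * exp (ln \<delta> + ln \<delta>)" using assms(3,6) by (simp add: exp_add[symmetric])
  also have "exp (ln \<delta> + ln \<delta>) = \<delta> ^ 2" by (simp only: exp_add exp_ln[OF assms(1)] power2_eq_square)
  also have "exp (- 11 :: real) \<le> 18 / 10 ^ 6"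
  proof -
    have "(27 / 10 :: real) ^ 11 \<le> exp 1 ^ 11" using exp_one_bounds by (intro power_mono) auto
    also have "\<dots> = exp 11" by (simp add: exp_of_nat_mult[symmetric])
    finally have "10 ^ 6 / 18 \<le> exp (11 :: real)" by (rule order_trans[rotated]) (simp add: power_divide)
    then show ?thesis by (simp add: exp_minus field_simps)
  qed
  finally have "\<epsilon> \<le> 18 / 10 ^ 6 * \<delta> ^ 2" by (simp add: mult_right_mono)
  moreover have "(3 / 2 * \<delta>) ^ 2 \<le> p ^ 2" using p\<delta> assms(1) by (intro power_mono) auto
  then have "\<delta> ^ 2 \<le> 4 / 9 * p ^ 2" by (simp add: power_mult_distrib power_divide)
  ultimately show "\<epsilon> \<le> 8 / 10 ^ 6 * p ^ 2" by simp
qed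

text \<open>Two regimes. For \<open>m \<le> n / 20\<close> the entropy may reach
  \<open>ln (n / m) = 11 + 2 * \<theta>\<close>, while \<open>n - m \<ge> 95 / 100 * n\<close>. The
  coefficients in \<open>h\<close> are made for this case: \<open>95 / 100\<close> of them,
  \<open>24.3675\<close> and \<open>4.06125\<close>, just exceed the required \<open>24.3\<close>
  and \<open>4\<close>. For larger \<open>m\<close> only \<open>n - m \<ge> 49 / 100 * n\<close> is
  available, but \<open>ln (n / m) \<le> 4\<close> leaves ample room.\<close>

lemma expansion_exponent:
  fixes h \<theta> \<epsilon> :: real
  assumes \<theta>: "2 / 3 \<le> \<theta>" and \<epsilon>: "\<epsilon> = exp (- 11 - 2 * \<theta>)" and h: "real n * h \<ge> 2565 / 100 + 4275 / 1000 * \<theta>"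
    and h0: "0 \<le> h" and m: "\<epsilon> * n \<le> m" "real m \<le> 51 / 100 * n" and n: "n > 0" "m > 0"
  shows "(exp 1 * n / m) ^ 2 * exp (- h * (real n - real m)) \<le> exp (- (3 / 10))"
proof -
  have pos: "real n / real m > 0" using n by simp
  have "(exp 1 * n / m) ^ 2 = exp (2 + 2 * ln (real n / real m))"
    using pos by (simp add: exp_add power_mult_distrib power_divide exp_of_nat_mult[symmetric]
        exp_double power2_eq_square[of "exp 1 :: real"] mult_exp_exp flip: times_divide_eq_right)
  then have "(exp 1 * n / m) ^ 2 * exp (- h * (real n - real m)) =
      exp (2 + 2 * ln (real n / real m) - h * (real n - real m))"
    by (simp add: exp_add[symmetric])
  also have "2 + 2 * ln (real n / real m) - h * (real n - real m) \<le> - (3 / 10)"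
  proof (cases "20 * real m \<le> real n")
    case True
    have "real n / real m \<le> 1 / \<epsilon>" using m(1) n \<epsilon> by (simp add: field_simps)
    then have "ln (real n / real m) \<le> ln (1 / \<epsilon>)" using pos \<epsilon> by (subst ln_le_cancel_iff) auto
    also have "\<dots> = 11 + 2 * \<theta>" by (simp add: \<epsilon> ln_div)
    finally have 1: "ln (real n / real m) \<le> 11 + 2 * \<theta>" .
    have "h * (95 / 100 * real n) \<le> h * (real n - real m)" using True h0 by (intro mult_left_mono) auto
    then have "h * (real n - real m) \<ge> 95 / 100 * (2565 / 100) + 95 / 100 * (4275 / 1000) * \<theta>"
    proof -
      have "h * (95 / 100 * real n) = 95 / 100 * (real n * h)" by simp
      then show ?thesis using h \<open>h * (95 / 100 * real n) \<le> h * (real n - real m)\<close> by linarith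
    qed
    then show ?thesis using 1 \<theta> by linarith
  next
    case False
    have "real n / real m \<le> 20" using False n by (simp add: field_simps)
    also have "(20 :: real) \<le> (27 / 10) ^ 4" by (simp add: power_divide)
    also have "\<dots> \<le> exp 1 ^ 4" using exp_one_bounds by (intro power_mono) auto
    also have "\<dots> = exp 4" by (simp add: exp_of_nat_mult[symmetric])
    finally have "ln (real n / real m) \<le> ln (exp 4)" using pos by (subst ln_le_cancel_iff) auto
    then have "ln (real n / real m) \<le> 4" by simp
    moreover have "h * (49 / 100 * real n) \<le> h * (real n - real m)" using m(2) h0 by (intro mult_left_mono) auto
    then have "h * (real n - real m) \<ge> 49 / 100 * (2565 / 100) + 49 / 100 * (4275 / 1000) * \<theta>"
    proof -
      have "h * (49 / 100 * real n) = 49 / 100 * (real n * h)" by simp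
      then show ?thesis using h \<open>h * (49 / 100 * real n) \<le> h * (real n - real m)\<close> by linarith
    qed
    ultimately show ?thesis using \<theta> by linarith
  qed
  finally show ?thesis by simp
qed

text \<open>The three lower bounds on \<open>n\<close> have separate purposes: the first makes
  rounding negligible even against \<open>p ^ 2 * n\<close>, the second does so for the rounding of
  \<open>T\<close>, and the third lets the tolerated number \<open>z\<close> of short cycles, about
  \<open>\<epsilon> * n\<close>, reach eight times the bound on their expectation.\<close>

lemma prob_not_hamilton_explicit:
  fixes \<delta> \<theta> \<tau> p \<epsilon> D :: real
  assumes \<delta>: "0 < \<delta>" "\<delta> < 1 / 2" and \<theta>: "\<theta> = - ln \<delta>"
    and \<tau>: "\<tau> = min (\<delta> / 260) (1 / (1000 + 200 * \<theta>))"
    and p: "p = (870 + 150 * \<theta>) * \<tau>" and \<epsilon>: "\<epsilon> = exp (- 11 - 2 * \<theta>)"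
    and D: "D = max 1 (48 / 100 * (120 + 20 * \<theta>) / p)" and l: "l = nat \<lceil>1 / \<epsilon>\<rceil>"
    and n: "real n \<ge> 100000000 / p ^ 2" "real n \<ge> 100 * (120 + 20 * \<theta>) / p"
      "real n \<ge> 8 * ((real l + 1) * D ^ l) / \<epsilon>"
    and r: "real r \<ge> (120 + 20 * \<theta>) * real n" and V: "V = {1..n}"
  shows "Pr (colours V p r)
      {x. \<not> packed n (real (nat \<lceil>\<tau> * n\<rceil>)) ({e \<in> [V]\<^bsup>2\<^esup>. x e \<noteq> 0}, x)}
    \<le> 4 * real n * ((real n + 1) * exp (- (3 / 10 * \<epsilon>) * real n) + exp (- (2 / 100) * real n))
      + 2 * real n * (exp (5 - 2 / 1000 * p * real n))
      + 4 ^ n * exp (- (2 / 100000000 * p ^ 3) * real n ^ 2)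
      + 133 * real n * exp (- (8 / 10000 * p) * real n)"
proof -
  note par = parameter_bounds[OF \<delta> \<theta> \<tau> p \<epsilon>]
  let ?K = "120 + 20 * \<theta>"
  have K: "400 / 3 \<le> ?K" using par(1) by simp
  have p0: "0 < p" "p \<le> 1" using par by auto
  have p2: "0 < p ^ 2" "p ^ 2 \<le> 1" "p ^ 2 \<le> p" "0 < p ^ 3"
    using p0 power_le_one[of p 2] mult_left_mono[of p 1 p] by (auto simp: power2_eq_square)
  have np2: "100000000 \<le> p ^ 2 * n" using n(1) p2 by (simp add: divide_le_eq mult.commute)
  have np: "100000000 \<le> p * n"
    using np2 mult_right_mono[OF p2(3), of "real n"] by linarith
  have n8: "100000000 \<le> real n"
    using np mult_right_mono[OF p0(2), of "real n"] by linarith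
  have npK: "100 * ?K \<le> p * n" using n(2) p0 by (simp add: divide_le_eq mult.commute)
  have \<epsilon>1: "0 < \<epsilon>" "\<epsilon> \<le> 8 / 1000000 * p ^ 2" "\<epsilon> \<le> 8 / 1000000" using par p2 by auto
  \<comment> \<open>With this \<open>T\<close> a class has at most about \<open>48/100 * card ?C'\<close> edges with colours in \<open>?C'\<close>,
      so that half of these colours remain free.\<close>
  define T where "T = nat \<lceil>p * n / (96 / 100 * ?K)\<rceil>"
  define s where "s = nat \<lceil>\<epsilon> * n\<rceil>"
  define z where "z = nat \<lfloor>\<epsilon> * n\<rfloor>"
  define k where "k = s + n div Suc l + z"
  define t where "t = nat \<lceil>\<tau> * n\<rceil>"
  \<comment> \<open>Each reserve gets about \<open>r / 30\<close> colours, so at least nine tenths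
    of all colours remain for the main palette \<open>?C'\<close>.\<close>
  define w where "w = r div 30"
  \<comment> \<open>\<open>q\<close> is limited from both sides: \<open>2 * q\<close> neighbours
    must fit into the colour reserve at a vertex, while about \<open>q ^ 2\<close> pairs must
    contain enough closing edges.\<close>
  define q where "q = nat \<lfloor>6 / 1000 * p * n\<rfloor>"
  \<comment> \<open>Since \<open>r \<ge> 400 / 3 * n\<close>, a colour class has mean size at most
    \<open>3 / 800 * p * n\<close>; the threshold is nearly three times this.\<close>
  define m where "m = nat \<lfloor>p * n / 90\<rfloor>"
  let ?A = "{1..w}" and ?B = "{w + 1..2 * w}" and ?C = "{2 * w + 1..3 * w}" and ?C' = "{3 * w + 1..r}"
  define cap where "cap = card ?C' div 2"
  define q1 where "q1 = p * card ?C' / (2 * real r)"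
  \<comment> \<open>A reserve holds about \<open>r / 30\<close> colours, of which at most
    \<open>n \<le> 3 / 400 * r\<close> are blocked at a vertex; more than \<open>r / 40\<close> are
    left.\<close>
  define q3 where "q3 = p / 40"
  have n0: "n > 0" "real n > 0" "n \<ge> 3" using n8 by auto
  have rn: "400 / 3 * real n \<le> real r"
    using r mult_right_mono[OF K, of "real n"] by linarith
  have r0: "r > 0" "real r > 0" using rn n0 by auto
  have e0: "0 \<le> \<epsilon> * n" "0 \<le> \<tau> * n" "0 \<le> 6 / 1000 * p * n" "0 \<le> p * n / 90"
    using \<epsilon>1 par(2) p0 by auto
  have sb: "\<epsilon> * n \<le> s" "s \<le> \<epsilon> * n + 1"
    using e0 unfolding s_def by linarith+
  have zb: "z \<le> \<epsilon> * n" "\<epsilon> * n \<le> real z + 1"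
    using e0 unfolding z_def by linarith+
  have tb: "\<tau> * n \<le> t" "t \<le> \<tau> * n + 1"
    using e0 unfolding t_def by linarith+
  have Tb: "p * n / (96 / 100 * ?K) \<le> T" "T \<le> p * n / (96 / 100 * ?K) + 1"
  proof -
    have "0 \<le> p * n / (96 / 100 * ?K)" using p0 K by simp
    then show "p * n / (96 / 100 * ?K) \<le> T" "T \<le> p * n / (96 / 100 * ?K) + 1"
      unfolding T_def by linarith+
  qed
  have qb: "q \<le> 6 / 1000 * p * n" "6 / 1000 * p * n \<le> real q + 1"
    using e0 unfolding q_def by linarith+
  have mb: "m \<le> p * n / 90" "p * n / 90 \<le> real m + 1"
    using e0 unfolding m_def by linarith+
  have wb: "real r / 30 - 1 \<le> w" "30 * w \<le> r" "real w \<le> real r / 30"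
    unfolding w_def by linarith+
  have cards: "card ?A = w" "card ?B = w" "card ?C = w" "card ?C' = r - 3 * w" by auto
  have cC': "9 / 10 * real r \<le> card ?C'" "real (card ?C') \<le> r"
    unfolding cards using wb by (auto simp: of_nat_diff)
  have "0 < p * n / (96 / 100 * ?K)" using np K by (intro divide_pos_pos) auto
  then have Tpos: "T > 0" "real T > 0" using Tb(1) by auto
  have TK: "p * n \<le> 96 / 100 * ?K * T" using Tb(1) K by (simp add: divide_le_eq mult.commute)
  have t2: "2 * t \<le> T"
  proof -
    \<comment> \<open>The left side is \<open>806.4 + 134.4 * \<theta>\<close>, so
      \<open>T \<ge> 7 * \<tau> * n\<close>. Together with \<open>T \<ge> 100\<close> this leaves
      ample room for the factor 2 and for the ceiling in \<open>t\<close>.\<close>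
    have "7 * (96 / 100 * ?K) \<le> 870 + 150 * \<theta>" using par(1) by simp
    then have "7 * (96 / 100 * ?K) * (\<tau> * n) \<le> (870 + 150 * \<theta>) * (\<tau> * n)"
      using par(2) by (intro mult_right_mono) auto
    also have "\<dots> = p * n" by (simp add: p)
    also have "\<dots> \<le> (96 / 100 * ?K) * T" using TK by simp
    finally have "(96 / 100 * ?K) * (7 * (\<tau> * n)) \<le> (96 / 100 * ?K) * T" by (simp only: mult_ac)
    then have 7: "7 * (\<tau> * n) \<le> T" using K by (simp only: mult_le_cancel_left) auto
    have "100 * (96 / 100 * ?K) \<le> 100 * ?K" using K by simp
    also have "\<dots> \<le> p * n" by (rule npK)
    also have "\<dots> \<le> 96 / 100 * ?K * T" by (rule TK)
    finally have "100 * (96 / 100 * ?K) \<le> (96 / 100 * ?K) * T" .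
    then have "(96 / 100 * ?K) * 100 \<le> (96 / 100 * ?K) * T" by (simp only: mult.commute)
    then have "100 \<le> real T" by (rule mult_left_le_imp_le) (use K in auto)
    then have "real (2 * t) \<le> T" using tb(2) 7 par(2) by simp
    then show ?thesis by (simp only: of_nat_le_iff)
  qed
  have Tn: "T \<le> n"
  proof -
    have "p * n / (96 / 100 * ?K) \<le> p * n / 2" using p0 K by (intro divide_left_mono) auto
    also have "\<dots> \<le> n / 2" using mult_right_mono[OF p0(2), of "real n"] by simp
    finally have "real T \<le> n" using Tb(2) n8 by linarith
    then show ?thesis by simp
  qed
  have D1: "D \<ge> 1" "real n / (2 * real T) \<le> D"
  proof -
    show "D \<ge> 1" by (simp add: D)
    have "real n / (2 * real T) \<le> 48 / 100 * ?K / p"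
      using TK Tpos p0 by (simp add: divide_le_eq le_divide_eq mult_ac)
    then show "real n / (2 * real T) \<le> D" by (simp add: D)
  qed
  have D2: "8 * ((real l + 1) * D ^ l) \<le> real z + 1"
    using n(3) \<epsilon>1 zb(2) by (simp add: divide_le_eq mult_ac)
  \<comment> \<open>\<open>s\<close>, \<open>n div Suc l\<close> and \<open>z\<close> each
    contribute about \<open>\<epsilon> * n\<close>, the middle one because
    \<open>l \<ge> 1 / \<epsilon>\<close>; the \<open>+ 1\<close> is the ceiling in
    \<open>s\<close>.\<close>
  have kb: "k \<le> 3 * (\<epsilon> * n) + 1"
  proof -
    have "1 / \<epsilon> \<le> real (Suc l)" unfolding l by linarith
    then have "1 \<le> \<epsilon> * real (Suc l)" using \<epsilon>1 by (simp add: divide_le_eq mult.commute)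
    then have "real n \<le> (\<epsilon> * n) * real (Suc l)"
      using mult_left_mono[of 1 "\<epsilon> * real (Suc l)" "real n"] by (simp add: mult_ac)
    then have "n / real (Suc l) \<le> \<epsilon> * n" by (simp add: divide_le_eq)
    moreover have "real (n div Suc l) \<le> n / real (Suc l)" by (rule of_nat_div_le_of_nat)
    ultimately show ?thesis unfolding k_def using sb zb by simp
  qed
  have kb': "k \<le> 25 / 1000000 * (p ^ 2 * n)"
  proof -
    have "\<epsilon> * n \<le> 8 / 1000000 * (p ^ 2 * n)" using mult_right_mono[OF \<epsilon>1(2), of "real n"] by simp
    then show ?thesis using kb np2 by linarith
  qed
  have tb': "t \<le> p * n / 960"
  proof -
    have "\<tau> * n \<le> p * n / 970" using mult_right_mono[OF par(5), of "real n"] by simp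
    then show ?thesis using tb np by linarith
  qed
  have \<kappa>: "Pr (edge_colour_pmf p r) S = p * card S / r" if "S \<subseteq> {1..r}" for S
    using r0 p0 that by (intro prob_edge_colour_pmf) auto
  have subs: "?A \<subseteq> {1..r}" "?B \<subseteq> {1..r}" "?C \<subseteq> {1..r}" "?C' \<subseteq> {1..r}"
    using wb(2) by auto
  have q1b: "0 \<le> q1" "q1 \<le> 1"
  proof -
    show "0 \<le> q1" using p0 by (simp add: q1_def)
    have "p * card ?C' \<le> 1 * real r" using cC'(2) p0 by (intro mult_mono) auto
    then show "q1 \<le> 1" using r0 by (simp add: q1_def divide_le_eq)
  qed
  have q1K: "q1 \<le> Pr (edge_colour_pmf p r) (?C' - K)" if "finite K" "card K \<le> cap" for K
  proof -
    have "card ?C' - card K \<le> card (?C' - K)" using that(1) by (intro diff_card_le_card_Diff)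
    moreover have "2 * cap \<le> card ?C'" by (simp add: cap_def)
    ultimately have "card ?C' \<le> 2 * card (?C' - K)" using that(2) by linarith
    then have "real (card ?C') \<le> real (2 * card (?C' - K))" by (rule of_nat_mono)
    then have "p * (real (card ?C') / 2) \<le> p * card (?C' - K)" using p0 by (intro mult_left_mono) auto
    then have "q1 \<le> p * card (?C' - K) / r" using r0 by (simp add: q1_def field_simps)
    moreover have "?C' - K \<subseteq> {1..r}" using subs(4) by blast
    ultimately show ?thesis using \<kappa> by simp
  qed
  have q3b: "0 \<le> q3" "q3 \<le> 1" using p0 by (auto simp: q3_def)
  have q3K: "q3 \<le> Pr (edge_colour_pmf p r) (S - K)"
    if "finite K" "card K \<le> n" and S: "S \<subseteq> {1..r}" "card S = w" for S K
  proof -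
    have "card S - card K \<le> card (S - K)" using that(1) by (intro diff_card_le_card_Diff)
    then have "real w \<le> real (card (S - K)) + n" using that by linarith
    then have "real r / 40 \<le> real (card (S - K))" using wb(1) rn n8 by linarith
    then have "p * (real r / 40) \<le> p * card (S - K)" using p0 by (intro mult_left_mono) auto
    then have "q3 \<le> p * card (S - K) / r" using r0 by (simp add: q3_def field_simps)
    moreover have "S - K \<subseteq> {1..r}" using S by blast
    ultimately show ?thesis using \<kappa> by simp
  qed
  have q0: "q > 0" using qb(2) np by (intro gr0I) auto
  have q1lo: "45 / 100 * p \<le> q1"
  proof -
    have "p * (9 / 10 * real r) \<le> p * card ?C'" using cC'(1) p0 by (intro mult_left_mono) auto
    then show ?thesis using r0 by (simp add: q1_def field_simps)
  qed
  have ex: "(exp 1 * n / j) ^ 2 * exp (- (q1 / (2 * real T)) * (real n - real j)) \<le> exp (- (3 / 10))"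
    if j: "s < j" "j \<le> n" "2 * j \<le> n + s + 1" for j
  proof (rule expansion_exponent[OF par(1) \<epsilon>])
    show "0 \<le> q1 / (2 * real T)" using q1b by simp
    have "real s < real j" using j by simp
    then show "\<epsilon> * n \<le> j" using sb by linarith
    have "real (2 * j) \<le> real (n + s + 1)" using j(3) by (rule of_nat_mono)
    then have "2 * real j \<le> real n + real s + 1" by simp
    then show "real j \<le> 51 / 100 * n"
      using sb mult_right_mono[OF \<epsilon>1(3), of "real n"] n8 by linarith
    \<comment> \<open>Passing from 96 to 95 pays for the ceiling in \<open>T\<close>. With
      \<open>q1 \<ge> 45 / 100 * p\<close> the result is
      \<open>n * q1 / (2 * T) \<ge> 45 / 100 * (95 / 100 * ?K) / 2\<close>, the origin of the
      coefficients in \<open>expansion_exponent\<close>.\<close>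
    have "95 / 100 * ?K * T \<le> p * n"
    proof -
      have "95 / 100 * ?K * T \<le> 95 / 100 * ?K * (p * n / (96 / 100 * ?K) + 1)"
        using Tb(2) K by (intro mult_left_mono) auto
      also have "\<dots> = 95 / 96 * (p * n) + 95 / 100 * ?K" using K by (simp add: field_simps)
      also have "\<dots> \<le> p * n" using npK K np by linarith
      finally show ?thesis .
    qed
    then have "45 / 100 * (95 / 100 * ?K * T) \<le> 45 / 100 * (p * n)" by (intro mult_left_mono) auto
    also have "\<dots> \<le> q1 * n" using mult_right_mono[OF q1lo, of "real n"] by simp
    finally have "45 / 100 * (95 / 100 * ?K * T) / (2 * real T) \<le> q1 * n / (2 * real T)"
      by (rule divide_right_mono) simp
    moreover have "45 / 100 * (95 / 100 * ?K * T) / (2 * real T) = 45 / 100 * (95 / 100 * ?K) / 2"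
      using Tpos by simp
    ultimately have "45 / 100 * (95 / 100 * ?K) / 2 \<le> q1 * n / (2 * real T)" by (simp only:)
    moreover have "2565 / 100 + 4275 / 1000 * \<theta> = 45 / 100 * (95 / 100 * ?K) / 2"
      by (simp add: field_simps)
    moreover have "n * (q1 / (2 * real T)) = q1 * n / (2 * real T)" by simp
    ultimately show "2565 / 100 + 4275 / 1000 * \<theta> \<le> n * (q1 / (2 * real T))" by (simp only:)
  qed (use n0 j in auto)
  define y3 where "y3 = 2 * t + k + 2 * q"
  define y4 where "y4 = t * k + k * m"
  \<comment> \<open>The factor \<open>exp 1\<close> contributes at least
    \<open>exp (p * n / 90)\<close> to \<open>\<zeta> ^ Suc m\<close>, which beats the numerator
    \<open>exp (exp 1 * p * n / 266)\<close>. The other factor is at least 1 because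
    \<open>133 < 400 / 3\<close>, and one copy of it cancels the number \<open>r\<close> of colours
    in the union bound.\<close>
  define \<zeta> where "\<zeta> = exp 1 * (real r / (133 * real n))"
  have rho: "1 \<le> real r / (133 * real n)" using rn n0 by (simp add: le_divide_eq)
  have \<zeta>1: "1 \<le> \<zeta>"
    using mult_mono[of 1 "exp 1 :: real" 1 "real r / (133 * real n)"] rho by (simp add: \<zeta>_def)
  have two: "(2::real) ^ y \<le> exp (6945 / 10000 * y)" for y :: nat
  proof -
    have "(2::real) ^ y = exp (ln 2 * y)" by (simp add: exp_of_nat2_mult)
    also have "\<dots> \<le> exp (6945 / 10000 * y)" unfolding exp_le_cancel_iff
      using ln2_le_25_over_36 by (intro mult_right_mono) auto
    finally show ?thesis .
  qed
  have main: "Pr (colours V p r)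
      {x. \<not> packed n (real t) ({e \<in> [V]\<^bsup>2\<^esup>. x e \<noteq> 0}, x)}
    \<le> 4 * real T * ((real n + 1) * exp (- (3 / 10) * real s) +
        exp (2 / 100 * real n ^ 2 * p * card ?C' / (2 * real r * real T)) / (1 + 2 / 100) ^ Suc cap)
      + 2 * real n * (2 ^ y3 * exp (- q3 / 2 * (real n - 1)))
      + 4 ^ n * (2 ^ y4 * exp (- p * card ?C / (4 * real r) * (real q * (real q - 1))))
      + real r * (exp (\<zeta> * p * real n ^ 2 / (2 * real r)) / \<zeta> ^ Suc m)"
  proof (rule prob_not_hamilton[where A = ?A and B = ?B and C = ?C and C' = ?C' and k = k and ?y3.0 = y3
        and ?y4.0 = y4 and z = z and l = l and D = D and q = q and ?q1.0 = q1 and ?q3.0 = q3 and m = m])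
    show "q1 \<le> Pr (edge_colour_pmf p r) (?C' - K)" if "finite K" "card K \<le> cap" for K
      using that by (rule q1K)
    show "q3 \<le> Pr (edge_colour_pmf p r) (?A - K)" if "finite K" "card K \<le> n" for K
      using that subs(1) cards(1) by (rule q3K)
    show "q3 \<le> Pr (edge_colour_pmf p r) (?B - K)" if "finite K" "card K \<le> n" for K
      using that subs(2) cards(2) by (rule q3K)
    show "(exp 1 * real n / real j)\<^sup>2 * exp (- (q1 / (2 * real T)) * (real n - real j)) \<le> exp (- (3 / 10))"
      if "s < j" "j \<le> n" "2 * j \<le> n + s + 1" for j using that by (rule ex)
    show "?A \<inter> ?B = {}" "?A \<inter> ?C = {}" "?B \<inter> ?C = {}" "?C' \<inter> (?A \<union> ?B \<union> ?C) = {}" by auto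
    show "2 * t + k + 2 * q \<le> y3" "t * k + k * m \<le> y4" by (simp_all add: y3_def y4_def)
  qed (fact n0 V t2 Tpos r0 subs D1 D2 k_def q0 q1b q3b \<zeta>1 | use p0 in simp)+
  have L1: "exp (- (3 / 10) * real s) \<le> exp (- (3 / 10 * \<epsilon>) * real n)" using sb(1) by simp
  \<comment> \<open>The weight \<open>\<eta> = 2 / 100\<close> is just fine enough for the gap
    between the mean, at most \<open>48 / 100 * card ?C'\<close>, and the cap of about
    \<open>50 / 100 * card ?C'\<close>: per colour of \<open>?C'\<close> the exponent is at most
    \<open>0.0096\<close>, against at least \<open>0.0098\<close> from
    \<open>ln (1 + 2 / 100) / 2\<close>.\<close>
  have L2: "exp (2 / 100 * real n ^ 2 * p * card ?C' / (2 * real r * real T)) / (1 + 2 / 100) ^ Suc cap \<le> exp (- (2 / 100) * real n)"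
  proof -
    let ?c = "real (card ?C')"
    have "p * real n ^ 2 / (2 * real T) \<le> 48 / 100 * real r"
    proof -
      have "p * n * n \<le> 96 / 100 * ?K * T * n" using TK by (intro mult_right_mono) auto
      also have "\<dots> = 96 / 100 * T * (?K * n)" by simp
      also have "\<dots> \<le> 96 / 100 * T * r" using r by (intro mult_left_mono) auto
      finally show ?thesis using Tpos by (simp add: divide_le_eq power2_eq_square mult_ac)
    qed
    then have "2 / 100 * ?c / r * (p * real n ^ 2 / (2 * real T)) \<le> 2 / 100 * ?c / r * (48 / 100 * real r)"
      by (intro mult_left_mono) auto
    then have a: "2 / 100 * real n ^ 2 * p * ?c / (2 * real r * real T) \<le> 96 / 10000 * ?c"
      using r0 Tpos by (simp add: field_simps)
    have "2 / 100 - (2 / 100) ^ 2 \<le> ln (1 + 2 / 100 :: real)"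
      using abs_ln_one_plus_x_minus_x_bound_nonneg[of "2 / 100 :: real"] by (simp add: abs_le_iff)
    then have ln: "196 / 10000 \<le> ln (1 + 2 / 100 :: real)" by (simp add: power2_eq_square)
    have "x \<le> 2 * Suc (x div 2)" for x :: nat by presburger
    then have "?c \<le> real (2 * Suc cap)" unfolding cap_def by (rule of_nat_mono)
    then have "?c \<le> 2 * real (Suc cap)" by simp
    then have "196 / 10000 * (?c / 2) \<le> ln (1 + 2 / 100) * real (Suc cap)"
      using ln by (intro mult_mono) auto
    then have "exp (98 / 10000 * ?c) \<le> exp (ln (1 + 2 / 100) * real (Suc cap))" by simp
    also have "\<dots> = (1 + 2 / 100) ^ Suc cap" by (simp only: exp_of_nat2_mult) simp
    finally have "exp (2 / 100 * real n ^ 2 * p * ?c / (2 * real r * real T)) / (1 + 2 / 100) ^ Suc cap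
        \<le> exp (96 / 10000 * ?c) / exp (98 / 10000 * ?c)"
      using a by (intro frac_le) auto
    also have "\<dots> = exp (- (2 / 10000 * ?c))" by (simp add: exp_diff[symmetric])
    also have "\<dots> \<le> exp (- (2 / 100) * real n)" using cC'(1) rn by simp
    finally show ?thesis .
  qed
  \<comment> \<open>Each unit of \<open>y3 \<le> 0.01415 * p * n\<close> costs
    \<open>ln 2 < 0.6945\<close>, in total less than \<open>0.0099 * p * n\<close>, against the gain
    of \<open>p * n / 80\<close>. The 5 generously covers the \<open>- 1\<close> in
    \<open>real n - 1\<close>.\<close>
  have L3: "2 ^ y3 * exp (- q3 / 2 * (real n - 1)) \<le> exp (5 - 2 / 1000 * p * real n)"
  proof -
    have pn2: "p ^ 2 * n \<le> p * n" using p2(3) by (intro mult_right_mono) auto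
    have y3: "real y3 \<le> 1415 / 100000 * (p * n)"
      unfolding y3_def using tb' kb' qb(1) pn2 by simp
    have "2 ^ y3 * exp (- q3 / 2 * (real n - 1)) \<le> exp (6945 / 10000 * y3) * exp (- q3 / 2 * (real n - 1))"
      using two by (intro mult_right_mono) auto
    also have "\<dots> = exp (6945 / 10000 * y3 - q3 / 2 * (real n - 1))" by (simp add: exp_add[symmetric])
    also have "\<dots> \<le> exp (5 - 2 / 1000 * p * real n)"
    proof -
      have "q3 / 2 * (real n - 1) = 1 / 80 * (p * n) - p / 80" by (simp add: q3_def diff_divide_distrib right_diff_distrib)
      then have "6945 / 10000 * y3 - q3 / 2 * (real n - 1) \<le> 5 - 2 / 1000 * (p * real n)"
        using y3 p0 np by linarith
      then show ?thesis by (simp add: mult.assoc)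
    qed
    finally show ?thesis .
  qed
  \<comment> \<open>Both exponents are of order \<open>p ^ 3 * n ^ 2\<close>: the loss through
    \<open>y4\<close> has coefficient about \<open>2.1 / 10 ^ 7\<close>, the gain more than
    \<open>2.8 / 10 ^ 7\<close>. The comparison rests on \<open>k\<close> being a tiny multiple of
    \<open>p ^ 2 * n\<close>.\<close>
  have L4: "2 ^ y4 * exp (- p * card ?C / (4 * real r) * (real q * (real q - 1))) \<le> exp (- (2 / 100000000 * p ^ 3) * real n ^ 2)"
  proof -
    let ?P = "p ^ 3 * real n ^ 2"
    have P0: "0 \<le> ?P" using p2 by simp
    have "real y4 = real k * (real t + real m)" by (simp add: y4_def algebra_simps)
    also have "\<dots> \<le> 25 / 1000000 * (p ^ 2 * n) * (p * n / 960 + p * n / 90)"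
      using kb' tb' mb(1) p0 by (intro mult_mono add_mono) auto
    also have "\<dots> = 25 / 1000000 * (1 / 960 + 1 / 90) * ?P"
      by (simp add: power2_eq_square power3_eq_cube algebra_simps)
    also have "\<dots> \<le> 305 / 1000000000 * ?P" using P0 by (intro mult_right_mono) auto
    finally have y4: "real y4 \<le> 305 / 1000000000 * ?P" .
    have "599 / 100000 * (p * n) \<le> real q" "599 / 100000 * (p * n) \<le> real q - 1"
      using qb(2) np by (auto simp: mult.assoc)
    then have "(599 / 100000 * (p * n)) * (599 / 100000 * (p * n)) \<le> real q * (real q - 1)"
      using p0 by (intro mult_mono) auto
    then have qq: "358 / 10000000 * (p ^ 2 * real n ^ 2) \<le> real q * (real q - 1)"
    proof (rule order_trans[rotated])
      have "(599 / 100000 * (p * n)) * (599 / 100000 * (p * n)) = (599 / 100000) ^ 2 * (p ^ 2 * real n ^ 2)"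
        by (simp add: power2_eq_square)
      moreover have "358 / 10000000 * (p ^ 2 * real n ^ 2) \<le> (599 / 100000) ^ 2 * (p ^ 2 * real n ^ 2)"
        by (intro mult_right_mono) (auto simp: power2_eq_square)
      ultimately show "358 / 10000000 * (p ^ 2 * real n ^ 2) \<le> (599 / 100000 * (p * n)) * (599 / 100000 * (p * n))"
        by (simp only:)
    qed
    have "real r / 31 \<le> w" using wb(1) rn n8 by linarith
    then have "p * (real r / 31) \<le> p * w" using p0 by (intro mult_left_mono) auto
    then have p124: "p / 124 \<le> p * w / (4 * real r)" using r0 by (simp add: field_simps)
    have "p / 124 * (358 / 10000000 * (p ^ 2 * real n ^ 2)) \<le> p * w / (4 * real r) * (real q * (real q - 1))"
      by (rule mult_mono[OF p124 qq]) (use p0 in auto)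
    moreover have "p / 124 * (358 / 10000000 * (p ^ 2 * real n ^ 2)) = 358 / 10000000 / 124 * ?P"
      by (simp add: power2_eq_square power3_eq_cube)
    ultimately have "358 / 10000000 / 124 * ?P \<le> p * w / (4 * real r) * (real q * (real q - 1))"
      by (simp only:)
    then have e: "2887 / 10000000000 * ?P \<le> p * w / (4 * real r) * (real q * (real q - 1))"
      using P0 by linarith
    have "2 ^ y4 * exp (- p * card ?C / (4 * real r) * (real q * (real q - 1)))
       \<le> exp (6945 / 10000 * y4) * exp (- p * card ?C / (4 * real r) * (real q * (real q - 1)))"
      using two by (intro mult_right_mono) auto
    also have "\<dots> = exp (6945 / 10000 * y4 - p * w / (4 * real r) * (real q * (real q - 1)))"
      unfolding cards by (simp add: exp_add[symmetric])
    also have "\<dots> \<le> exp (- (2 / 100000000 * ?P))"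
    proof -
      have "6945 / 10000 * y4 - p * w / (4 * real r) * (real q * (real q - 1)) \<le> - (2 / 100000000 * ?P)"
        using y4 e P0 by linarith
      then show ?thesis by simp
    qed
    finally show ?thesis by (simp add: mult.assoc)
  qed
  have L5: "real r * (exp (\<zeta> * p * real n ^ 2 / (2 * real r)) / \<zeta> ^ Suc m) \<le> 133 * real n * exp (- (8 / 10000 * p) * real n)"
  proof -
    let ?\<rho> = "real r / (133 * real n)"
    have "\<zeta> * p * real n ^ 2 / (2 * real r) = exp 1 * (p * n) / 266"
      using n0 r0 by (simp add: \<zeta>_def power2_eq_square field_simps)
    also have "\<dots> \<le> (272 / 100) * (p * n) / 266"
      using exp_one_bounds p0 by (intro divide_right_mono mult_right_mono) auto
    finally have a: "\<zeta> * p * real n ^ 2 / (2 * real r) \<le> 1023 / 100000 * (p * n)" using np by linarith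
    have "exp (p * n / 90) * ?\<rho> \<le> exp (real (Suc m)) * ?\<rho> ^ Suc m"
      using mb(2) rho power_increasing[of 1 "Suc m" ?\<rho>] by (intro mult_mono) auto
    also have "\<dots> = \<zeta> ^ Suc m" 
      by (simp only: \<zeta>_def power_mult_distrib exp_of_nat_mult[symmetric] mult_1_right)
    finally have b: "exp (p * n / 90) * ?\<rho> \<le> \<zeta> ^ Suc m" .
    have "exp (\<zeta> * p * real n ^ 2 / (2 * real r)) / \<zeta> ^ Suc m \<le> exp (1023 / 100000 * (p * n)) / (exp (p * n / 90) * ?\<rho>)"
      using a b rho by (intro frac_le mult_pos_pos) auto
    then have "real r * (exp (\<zeta> * p * real n ^ 2 / (2 * real r)) / \<zeta> ^ Suc m)
      \<le> real r * (exp (1023 / 100000 * (p * n)) / (exp (p * n / 90) * ?\<rho>))"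
      by (intro mult_left_mono) auto
    also have "\<dots> = 133 * real n * (exp (1023 / 100000 * (p * n)) / exp (p * n / 90))"
      using r0 n0 by (simp add: field_simps)
    also have "exp (1023 / 100000 * (p * n)) / exp (p * n / 90) = exp (1023 / 100000 * (p * n) - p * n / 90)"
      by (rule exp_diff[symmetric])
    also have "133 * real n * \<dots> \<le> 133 * real n * exp (- (8 / 10000 * p) * real n)"
      using np by (intro mult_left_mono) auto
    finally show ?thesis .
  qed
  have "4 * real T * ((real n + 1) * exp (- (3 / 10) * real s) +
        exp (2 / 100 * real n ^ 2 * p * card ?C' / (2 * real r * real T)) / (1 + 2 / 100) ^ Suc cap)
      \<le> 4 * real n * ((real n + 1) * exp (- (3 / 10 * \<epsilon>) * real n) + exp (- (2 / 100) * real n))"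
    using L1 L2 Tn by (intro mult_mono add_mono mult_left_mono) auto
  moreover have "2 * real n * (2 ^ y3 * exp (- q3 / 2 * (real n - 1))) \<le> 2 * real n * exp (5 - 2 / 1000 * p * real n)"
    using L3 by (intro mult_left_mono) auto
  moreover have "4 ^ n * (2 ^ y4 * exp (- p * card ?C / (4 * real r) * (real q * (real q - 1))))
      \<le> 4 ^ n * exp (- (2 / 100000000 * p ^ 3) * real n ^ 2)"
    using L4 by (intro mult_left_mono) auto
  ultimately show ?thesis using main L5 unfolding t_def by linarith
qed

section \<open>Passage to the limit\<close>

lemma failure_bound_tendsto:
  fixes p \<epsilon> :: real
  assumes "0 < p" "0 < \<epsilon>"
  shows "((\<lambda>n. (real n ^ 2 + 1) *
     (4 * real n * ((real n + 1) * exp (- (3 / 10 * \<epsilon>) * real n) + exp (- (2 / 100) * real n))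
      + 2 * real n * (exp (5 - 2 / 1000 * p * real n))
      + 4 ^ n * exp (- (2 / 100000000 * p ^ 3) * real n ^ 2)
      + 133 * real n * exp (- (8 / 10000 * p) * real n))) \<longlongrightarrow> 0) sequentially"
proof -
  \<comment> \<open>Only the positivity of the four rates matters. The factor \<open>4 ^ n\<close>
    is harmless against an exponent quadratic in \<open>n\<close>.\<close>
  define a b c d where "a = 3 / 10 * \<epsilon>" and "b = 2 / 1000 * p" and "c = 2 / 100000000 * p ^ 3"
    and "d = 8 / 10000 * p"
  have pos: "0 < a" "0 < b" "0 < c" "0 < d" using assms by (auto simp: a_def b_def c_def d_def)
  have "((\<lambda>n. (real n ^ 2 + 1) * (4 * real n * ((real n + 1) * exp (- a * real n)))) \<longlongrightarrow> 0) sequentially"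
    using pos(1) by real_asymp
  moreover have "((\<lambda>n. (real n ^ 2 + 1) * (4 * real n) * exp (- (2 / 100) * real n)) \<longlongrightarrow> 0) sequentially"
    by real_asymp
  moreover have "((\<lambda>n. (real n ^ 2 + 1) * (2 * real n) * exp (5 - b * real n)) \<longlongrightarrow> 0) sequentially"
    using pos(2) by real_asymp
  moreover have "((\<lambda>n. (real n ^ 2 + 1) * (4 ^ n * exp (- c * real n ^ 2))) \<longlongrightarrow> 0) sequentially"
    using pos(3) by real_asymp
  moreover have "((\<lambda>n. (real n ^ 2 + 1) * (133 * real n) * exp (- d * real n)) \<longlongrightarrow> 0) sequentially"
    using pos(4) by real_asymp
  ultimately have "((\<lambda>n. (real n ^ 2 + 1) * (4 * real n * ((real n + 1) * exp (- a * real n)))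
      + (real n ^ 2 + 1) * (4 * real n) * exp (- (2 / 100) * real n)
      + (real n ^ 2 + 1) * (2 * real n) * exp (5 - b * real n)
      + (real n ^ 2 + 1) * (4 ^ n * exp (- c * real n ^ 2))
      + (real n ^ 2 + 1) * (133 * real n) * exp (- d * real n)) \<longlongrightarrow> 0) sequentially"
    by (intro tendsto_add_zero)
  then have "((\<lambda>n. (real n ^ 2 + 1) *
     (4 * real n * ((real n + 1) * exp (- a * real n) + exp (- (2 / 100) * real n))
      + 2 * real n * (exp (5 - b * real n))
      + 4 ^ n * exp (- c * real n ^ 2)
      + 133 * real n * exp (- d * real n))) \<longlongrightarrow> 0) sequentially"
    by (simp only: distrib_left mult.assoc)
  then show ?thesis by (simp only: a_def b_def c_def d_def)
qed

lemma has_disjoint_rainbow_hamilton_cycles_le: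
  "packed n x G \<Longrightarrow> y \<le> x \<Longrightarrow> packed n y G"
  unfolding has_disjoint_rainbow_hamilton_cycles_def case_prod_beta by (meson order_trans)

theorem theorem1:
  fixes \<delta> \<theta> :: real and t :: "nat \<Rightarrow> real"
  assumes "0 < \<delta>" and "\<delta> < 1 / 2"
    and "\<theta> = - ln \<delta>"
    and "\<And>n. t n = min (\<delta> * real n / 260) (real n / (1000 + 200 * \<theta>))"
  shows "\<forall>\<epsilon>>0. \<forall>\<^sub>F n in sequentially. \<forall>E m r.
     E \<subseteq> [{1..n}]\<^bsup>2\<^esup> \<longrightarrow>
     real (min_degree n E) \<ge> \<delta> * real n \<longrightarrow>
     real m \<ge> min ((435 + 75 * \<theta>) * t n * real n) (real (card (non_edges n E))) \<longrightarrow>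
     m \<le> card (non_edges n E) \<longrightarrow>
     real r \<ge> (120 + 20 * \<theta>) * real n \<longrightarrow>
     measure_pmf.prob (colored_perturbed_graph n E m r)
       {G. has_disjoint_rainbow_hamilton_cycles n (t n) G} \<ge> 1 - \<epsilon>"
proof (intro allI impI, goal_cases)
  case (1 \<epsilon>)
  note \<epsilon> = 1
  \<comment> \<open>With \<open>t n = \<tau> * n\<close>, all of \<open>\<tau>\<close>,
    \<open>p\<close>, \<open>\<eta>\<close>, \<open>D\<close> and \<open>l\<close> are constants
    depending on \<open>\<delta>\<close> alone; \<open>\<eta>\<close> is the expansion defect, since
    \<open>\<epsilon>\<close> denotes the error probability here.\<close>
  define \<tau> where "\<tau> = min (\<delta> / 260) (1 / (1000 + 200 * \<theta>))"
  define p where "p = (870 + 150 * \<theta>) * \<tau>"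
  define \<eta> where "\<eta> = exp (- 11 - 2 * \<theta>)"
  define D where "D = max 1 (48 / 100 * (120 + 20 * \<theta>) / p)"
  define l where "l = nat \<lceil>1 / \<eta>\<rceil>"
  note par = parameter_bounds[OF assms(1,2,3) \<tau>_def p_def \<eta>_def]
  let ?b = "\<lambda>n. 4 * real n * ((real n + 1) * exp (- (3 / 10 * \<eta>) * real n) + exp (- (2 / 100) * real n))
      + 2 * real n * (exp (5 - 2 / 1000 * p * real n))
      + 4 ^ n * exp (- (2 / 100000000 * p ^ 3) * real n ^ 2)
      + 133 * real n * exp (- (8 / 10000 * p) * real n)"
  have t: "t n = \<tau> * n" for n
    unfolding assms(4) \<tau>_def using par(1) by (simp add: min_mult_distrib_right)
  have large: "\<forall>\<^sub>F n in sequentially. real n \<ge> C" for C :: real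
    using filterlim_real_sequentially by (simp add: filterlim_at_top)
  have "\<forall>\<^sub>F n in sequentially. (real n ^ 2 + 1) * ?b n < \<epsilon>"
    using failure_bound_tendsto[OF par(3,6)] \<epsilon> by (rule order_tendstoD(2))
  then show ?case
    using large[of 1] large[of "100000000 / p ^ 2"] large[of "100 * (120 + 20 * \<theta>) / p"]
      large[of "8 * ((real l + 1) * D ^ l) / \<eta>"]
  proof (eventually_elim, intro allI impI)
    fix n m r :: nat and G :: "nat set set"
    assume n: "(real n ^ 2 + 1) * ?b n < \<epsilon>" "1 \<le> real n" "100000000 / p ^ 2 \<le> real n"
      "100 * (120 + 20 * \<theta>) / p \<le> real n" "8 * ((real l + 1) * D ^ l) / \<eta> \<le> real n"
      and G: "G \<subseteq> [{1..n}]\<^bsup>2\<^esup>" 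
      and m: "min ((435 + 75 * \<theta>) * t n * real n) (real (card (non_edges n G))) \<le> real m"
        "m \<le> card (non_edges n G)"
      and r: "(120 + 20 * \<theta>) * real n \<le> real r"
    let ?V = "{1..n}" and ?N = "real (card (non_edges n G))" and ?t = "real (nat \<lceil>\<tau> * n\<rceil>)"
    have "card (non_edges n G) \<le> card ([?V]\<^bsup>2\<^esup>)"
      unfolding non_edges_def by (intro card_mono) (auto simp: finite_imp_finite_nsets)
    then have "?N \<le> real (card ([?V]\<^bsup>2\<^esup>))" by (rule of_nat_mono)
    also have "\<dots> \<le> real n ^ 2 / 2" using card_nsets_2_le[of ?V] by simp
    finally have N: "?N \<le> real n ^ 2 / 2" .
    have "1 * 1 \<le> (120 + 20 * \<theta>) * real n" using par(1) n(2) by (intro mult_mono) auto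
    then have r0: "r > 0" using r by (intro gr0I) auto
    \<comment> \<open>If \<open>m\<close> reaches the number of non-edges, \<open>p \<le> 1\<close>
      suffices. Otherwise \<open>m\<close> is at least
      \<open>(435 + 75 * \<theta>) * t n * n = p * n ^ 2 / 2\<close>, and \<open>n ^ 2 / 2\<close>
      bounds the number of non-edges.\<close>
    have pm: "p * ?N \<le> m"
    proof (cases "?N \<le> m")
      case True
      have "p * ?N \<le> 1 * ?N" using par(4) by (intro mult_right_mono) auto
      then show ?thesis using True by simp
    next
      case False
      then have "(435 + 75 * \<theta>) * t n * real n \<le> m" using m(1) by linarith
      moreover have "(435 + 75 * \<theta>) * t n * real n = p * (real n ^ 2 / 2)"
        by (simp add: t p_def power2_eq_square field_simps)
      moreover have "p * ?N \<le> p * (real n ^ 2 / 2)" using N par(3) by (intro mult_left_mono) auto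
      ultimately show ?thesis by linarith
    qed
    \<comment> \<open>The packing is built for an integral number of cycles, the ceiling of
      \<open>t n\<close>.\<close>
    have ceil: "t n \<le> ?t" unfolding t using par(2) by linarith
    have "1 - measure_pmf.prob (colored_perturbed_graph n G m r) {H. has_disjoint_rainbow_hamilton_cycles n ?t H}
      \<le> (?N + 1) * Pr (colours ?V p r)
          {x. \<not> has_disjoint_rainbow_hamilton_cycles n ?t ({e \<in> [?V]\<^bsup>2\<^esup>. x e \<noteq> 0}, x)}"
      using par(3,4) pm by (intro perturbed_failure_le[OF refl G r0 m(2)]) auto
    also have "\<dots> \<le> (real n ^ 2 + 1) * ?b n"
    proof (intro mult_mono)
      show "?N + 1 \<le> real n ^ 2 + 1" using N zero_le_power2[of "real n"] by linarith
      show "Pr (colours ?V p r)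
          {x. \<not> has_disjoint_rainbow_hamilton_cycles n ?t ({e \<in> [?V]\<^bsup>2\<^esup>. x e \<noteq> 0}, x)} \<le> ?b n"
        by (rule prob_not_hamilton_explicit[OF assms(1,2,3) \<tau>_def p_def \<eta>_def D_def l_def n(3,4,5) r refl])
    qed auto
    also have "\<dots> < \<epsilon>" by (rule n(1))
    finally have "1 - \<epsilon> \<le> measure_pmf.prob (colored_perturbed_graph n G m r)
        {H. has_disjoint_rainbow_hamilton_cycles n ?t H}" by linarith
    also have "\<dots> \<le> measure_pmf.prob (colored_perturbed_graph n G m r)
        {H. has_disjoint_rainbow_hamilton_cycles n (t n) H}"
      using has_disjoint_rainbow_hamilton_cycles_le[OF _ ceil]
      by (intro measure_pmf.finite_measure_mono) auto
    finally show "1 - \<epsilon> \<le> measure_pmf.prob (colored_perturbed_graph n G m r)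
        {G. has_disjoint_rainbow_hamilton_cycles n (t n) G}" .
  qed
qed

end
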